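(* Let $H$ be a complex separable Hilbert space and let $\mathcal{G}$ be a countably infinite group of unitary operators on $H$ (not necessarily abelian). Then all of the following hold. (a) Let $X$ and $Y$ be wandering subspaces of $H$ for $\mathcal{G}$ such that $\sum_{g \in \mathcal{G}} \oplus^{\perp} g(X) \subseteq \sum_{g \in \mathcal{G}} \oplus^{\perp} g(Y)$ and $\dim(Y) < \infty$. Then there exists a wandering subspace $X'$ of $H$ for $\mathcal{G}$ such that (i) $g(X) \perp h(X')$ for all $g, h \in \mathcal{G}$; (ii) $\sum_{g} \oplus^{\perp} g(X) \oplus^{\perp} \sum_{g} \oplus^{\perp} g(X') = \sum_{g} \oplus^{\perp} g(Y)$; (iii) $\dim(X) + \dim(X') = \dim(Y)$. (b) Let $X = \{x_1,\dots,x_r\}$ and $Y = \{y_1,\dots,y_s\}$ be finite subsets of $H$ with $r < s$, $V_0 = \overline{\mathrm{span}}\, \mathcal{G}(X)$, $V_1 = \overline{\mathrm{span}}\, \mathcal{G}(Y)$, $V_0 \subset V_1$, and let $W_0$ be a closed subspace of $V_1$ with $V_0 \oplus W_0 = V_1$. If $\mathcal{G}(X)$ and $\mathcal{G}(Y)$ are Riesz bases for $V_0$ and $V_1$ respectively, then there exists $\Gamma = \{z_1,\dots,z_{s-r}\} \subseteq W_0$ with $\mathcal{G}(\Gamma)$ a Riesz basis for $W_0$ if and only if $g(W_0) \subseteq W_0$ for all $g \in \mathcal{G}$. (c) With $X, Y, r<s, V_0 \subset V_1, W_0$ as in (b) (with $V_0 + W_0 = V_1$, $V_0 \cap W_0 =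 \{0\}$), if $\mathcal{G}(X)$ and $\mathcal{G}(Y)$ are frames for $V_0$ and $V_1$ respectively, then there exists a finite subset $\Gamma = \{z_1,\dots,z_p\} \subseteq W_0$ (for some positive integer $p$) with $\mathcal{G}(\Gamma)$ a frame for $W_0$ if and only if $g(W_0) \subseteq W_0$ for all $g \in \mathcal{G}$. (d) Let $X = \{x_1,\dots,x_r\}$, $\tilde X = \{\tilde x_1,\dots,\tilde x_r\}$, $Y = \{y_1,\dots,y_s\}$, $\tilde Y = \{\tilde y_1,\dots,\tilde y_s\}$ be finite subsets of $H$ such that $\mathcal{G}(X)$, $\mathcal{G}(\tilde X)$, $\mathcal{G}(Y)$, $\mathcal{G}(\tilde Y)$ are Riesz bases for their closed linear spans $V_0$, $\tilde V_0$, $V_1$, $\tilde V_1$, $\mathcal{G}(X)$ is biorthogonal to $\mathcal{G}(\tilde X)$, $\mathcal{G}(Y)$ is biorthogonal to $\mathcal{G}(\tilde Y)$, $V_0 \subset V_1$, $\tilde V_0 \subset \tilde V_1$; let $W_0 = V_1 \cap \tilde V_0^{\perp}$ and $\tilde W_0 = \tilde V_1 \cap V_0^{\perp}$. If $r < s$, then there exists $\Gamma = \{z_1,\dots,z_{s-r}\} \subseteq W_0$ such that $\mathcal{G}(\Gamma)$ is a Riesz basis for $W_0$ and $\mathcal{G}(X \cup \Gamma)$ is a Riesz basis for $V_1$, and there exists $\tilde\Gamma = \{\tilde z_1,\dots,\tilde z_{s-r}\} \subseteq \tilde W_0$ such that $\mathcal{G}(\tilde\Gamma)$ is a Riesz basis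 for $\tilde W_0$, $\mathcal{G}(\tilde X \cup \tilde\Gamma)$ is a Riesz basis for $\tilde V_1$, and $\mathcal{G}(\tilde\Gamma)$ is biorthogonal to $\mathcal{G}(\Gamma)$.
   Context: A closed subspace $M$ of $H$ is a wandering subspace for $\mathcal{G}$ if $g(M) \perp h(M)$ for all $g \neq h$ in $\mathcal{G}$; $\sum_{g} \oplus^{\perp} g(M)$ denotes the closed orthogonal direct sum of the subspaces $g(M)$, and $A \oplus^{\perp} B$ denotes an orthogonal direct sum. For a finite set $S=\{v_1,\dots,v_k\}\subset H$, $\mathcal{G}(S)$ denotes the indexed family $\{g v_j : g \in \mathcal{G},\ j=1,\dots,k\}$. A countable family $\{v_n\}_{n\in J}$ is a Riesz basis for its closed span $V$ if $A\sum|a_n|^2 \le \|\sum a_n v_n\|^2 \le B\sum|a_n|^2$ for all $\{a_n\}\in\ell^2(J)$, for some $0<A\le B$; it is a frame for its closed span $V$ if $A\|f\|^2 \le \sum|\langle f, v_n\rangle|^2 \le B\|f\|^2$ for all $f\in V$. For closed subspaces, $V_1 = V \oplus W$ means $V\cap W=\{0\}$ and $V+W$ is closed and equals $V_1$. Families $\{v_n\}$, $\{\tilde v_n\}$ are biorthogonal if $\langle v_n, \tilde v_m\rangle = \delta_{n,m}$. $V^\perp$ is the orthogonal complement in $H$. *)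

theory Defs
  imports "HOL-Analysis.Analysis"
begin

text \<open>HOL-Analysis only provides real inner product spaces, so we introduce
complex inner product spaces as a type class: a real normed vector space with a
complex scalar multiplication (compatible with the real one) and a sesquilinear
Hermitian inner product (conjugate-linear in the first argument) inducing the norm.\<close>

class complex_inner = real_normed_vector +
  fixes scaleC :: "complex \<Rightarrow> 'a \<Rightarrow> 'a"
    and cinner :: "'a \<Rightarrow> 'a \<Rightarrow> complex"
  assumes scaleC_add_right: "scaleC a (x + y) = scaleC a x + scaleC a y"
    and scaleC_add_left: "scaleC (a + b) x = scaleC a x + scaleC b x"
    and scaleC_scaleC: "scaleC a (scaleC b x) = scaleC (a * b) x"
    and scaleC_one: "scaleC 1 x = x"
    and scaleR_scaleC: "scaleR r x = scaleC (complex_of_real r) x"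
    and cinner_commute: "cinner x y = cnj (cinner y x)"
    and cinner_add_left: "cinner (x + y) z = cinner x z + cinner y z"
    and cinner_scaleC_left: "cinner (scaleC a x) y = cnj a * cinner x y"
    and cinner_self_norm: "cinner x x = complex_of_real ((norm x)\<^sup>2)"

class complex_hilbert = complex_inner + complete_space

instantiation complex :: complex_inner
begin
definition scaleC_complex :: "complex \<Rightarrow> complex \<Rightarrow> complex" where
  "scaleC_complex a x = a * x"
definition cinner_complex :: "complex \<Rightarrow> complex \<Rightarrow> complex" where
  "cinner_complex x y = cnj x * y"
instance
proof
  fix a b :: complex and x y z :: complex and r :: real
  show "scaleC a (x + y) = scaleC a x + scaleC a y" by (simp add: scaleC_complex_def algebra_simps)
  show "scaleC (a + b) x = scaleC a x + scaleC b x" by (simp add: scaleC_complex_def algebra_simps)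
  show "scaleC a (scaleC b x) = scaleC (a * b) x" by (simp add: scaleC_complex_def algebra_simps)
  show "scaleC 1 x = x" by (simp add: scaleC_complex_def)
  show "scaleR r x = scaleC (complex_of_real r) x" by (simp add: scaleC_complex_def scaleR_conv_of_real)
  show "cinner x y = cnj (cinner y x)" by (simp add: cinner_complex_def mult.commute)
  show "cinner (x + y) z = cinner x z + cinner y z" by (simp add: cinner_complex_def algebra_simps)
  show "cinner (scaleC a x) y = cnj a * cinner x y" by (simp add: cinner_complex_def scaleC_complex_def algebra_simps)
  show "cinner x x = complex_of_real ((norm x)\<^sup>2)"
    by (simp add: cinner_complex_def complex_norm_square mult.commute del: of_real_power)
qed
end

instance complex :: complex_hilbert ..

abbreviation cspan :: "'a::complex_inner set \<Rightarrow> 'a set" where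
  "cspan S \<equiv> module.span scaleC S"

abbreviation cdim :: "'a::complex_inner set \<Rightarrow> nat" where
  "cdim S \<equiv> vector_space.dim scaleC S"

definition csubspace :: "'a::complex_inner set \<Rightarrow> bool" where
  "csubspace S \<longleftrightarrow> module.subspace scaleC S"

definition closed_csubspace :: "'a::complex_inner set \<Rightarrow> bool" where
  "closed_csubspace S \<longleftrightarrow> csubspace S \<and> closed S"

definition cfinite_dim :: "'a::complex_inner set \<Rightarrow> bool" where
  "cfinite_dim S \<longleftrightarrow> (\<exists>B. finite B \<and> cspan B = S)"

definition ccspan :: "'a::complex_inner set \<Rightarrow> 'a set" where
  "ccspan S = closure (cspan S)"

definition orth :: "'a::complex_inner set \<Rightarrow> 'a set \<Rightarrow> bool" where
  "orth A B \<longleftrightarrow> (\<forall>a\<in>A. \<forall>b\<in>B. cinner a b = 0)"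

definition orth_compl :: "'a::complex_inner set \<Rightarrow> 'a set" where
  "orth_compl V = {x. \<forall>v\<in>V. cinner v x = 0}"

definition clinear :: "('a::complex_inner \<Rightarrow> 'a) \<Rightarrow> bool" where
  "clinear U \<longleftrightarrow> (\<forall>x y. U (x + y) = U x + U y) \<and> (\<forall>a x. U (scaleC a x) = scaleC a (U x))"

definition unitary :: "('a::complex_inner \<Rightarrow> 'a) \<Rightarrow> bool" where
  "unitary U \<longleftrightarrow> clinear U \<and> surj U \<and> (\<forall>x y. cinner (U x) (U y) = cinner x y)"

definition unitary_group :: "('a::complex_inner \<Rightarrow> 'a) set \<Rightarrow> bool" where
  "unitary_group G \<longleftrightarrow> (\<forall>g\<in>G. unitary g) \<and> id \<in> G \<and>
     (\<forall>g\<in>G. \<forall>h\<in>G. g \<circ> h \<in> G) \<and> (\<forall>g\<in>G. inv g \<in> G)"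

definition wandering :: "('a::complex_inner \<Rightarrow> 'a) set \<Rightarrow> 'a set \<Rightarrow> bool" where
  "wandering G M \<longleftrightarrow> closed_csubspace M \<and>
     (\<forall>g\<in>G. \<forall>h\<in>G. g \<noteq> h \<longrightarrow> orth (g ` M) (h ` M))"

text \<open>The closed orthogonal direct sum of the subspaces \<open>g(M)\<close>, \<open>g \<in> G\<close>
  (for a wandering subspace), i.e. the closed span of their union.\<close>
definition orbit_sum :: "('a::complex_inner \<Rightarrow> 'a) set \<Rightarrow> 'a set \<Rightarrow> 'a set" where
  "orbit_sum G M = ccspan (\<Union>g\<in>G. g ` M)"

text \<open>For a finite set \<open>S = {v_0,...,v_(k-1)}\<close> given as \<open>v :: nat \<Rightarrow> 'a\<close>,
  \<open>G(S)\<close> is the family \<open>(g,j) \<mapsto> g (v j)\<close> indexed by \<open>G \<times> {..<k}\<close>.\<close>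
definition gfam :: "(nat \<Rightarrow> 'a) \<Rightarrow> ('a \<Rightarrow> 'a) \<times> nat \<Rightarrow> 'a" where
  "gfam v = (\<lambda>(g, j). g (v j))"

definition riesz_basis_for :: "('i \<Rightarrow> 'a::complex_inner) \<Rightarrow> 'i set \<Rightarrow> 'a set \<Rightarrow> bool" where
  "riesz_basis_for v J V \<longleftrightarrow> ccspan (v ` J) = V \<and>
     (\<exists>A B. 0 < A \<and> A \<le> B \<and>
        (\<forall>a :: 'i \<Rightarrow> complex. (\<lambda>n. (cmod (a n))\<^sup>2) summable_on J \<longrightarrow>
            (\<lambda>n. scaleC (a n) (v n)) summable_on J \<and>
            A * (\<Sum>\<^sub>\<infinity>n\<in>J. (cmod (a n))\<^sup>2) \<le> (norm (\<Sum>\<^sub>\<infinity>n\<in>J. scaleC (a n) (v n)))\<^sup>2 \<and>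
            (norm (\<Sum>\<^sub>\<infinity>n\<in>J. scaleC (a n) (v n)))\<^sup>2 \<le> B * (\<Sum>\<^sub>\<infinity>n\<in>J. (cmod (a n))\<^sup>2)))"

definition frame_for :: "('i \<Rightarrow> 'a::complex_inner) \<Rightarrow> 'i set \<Rightarrow> 'a set \<Rightarrow> bool" where
  "frame_for v J V \<longleftrightarrow> ccspan (v ` J) = V \<and>
     (\<exists>A B. 0 < A \<and> A \<le> B \<and>
        (\<forall>f\<in>V. (\<lambda>n. (cmod (cinner f (v n)))\<^sup>2) summable_on J \<and>
            A * (norm f)\<^sup>2 \<le> (\<Sum>\<^sub>\<infinity>n\<in>J. (cmod (cinner f (v n)))\<^sup>2) \<and>
            (\<Sum>\<^sub>\<infinity>n\<in>J. (cmod (cinner f (v n)))\<^sup>2) \<le> B * (norm f)\<^sup>2))"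

definition biorthogonal :: "('i \<Rightarrow> 'a::complex_inner) \<Rightarrow> ('i \<Rightarrow> 'a) \<Rightarrow> 'i set \<Rightarrow> bool" where
  "biorthogonal v w J \<longleftrightarrow> (\<forall>n\<in>J. \<forall>m\<in>J. cinner (v n) (w m) = (if n = m then 1 else 0))"

text \<open>Concatenation \<open>X \<union> \<Gamma>\<close> of \<open>x_0..x_(r-1)\<close> and \<open>z_0,...\<close>, as one indexed finite family.\<close>
definition concat_fam :: "nat \<Rightarrow> (nat \<Rightarrow> 'a) \<Rightarrow> (nat \<Rightarrow> 'a) \<Rightarrow> nat \<Rightarrow> 'a" where
  "concat_fam r x z = (\<lambda>j. if j < r then x j else z (j - r))"

definition separable_H :: "'a::metric_space itself \<Rightarrow> bool" where
  "separable_H _ \<longleftrightarrow> (\<exists>D::'a set. countable D \<and> closure D = UNIV)"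

end

theory Submission
  imports Defs
begin

text \<open>
The heart of the matter is a cancellation property: if \<open>x\<^sub>0, \<dots>, x\<^sub>r\<^sub>-\<^sub>1\<close> generate an orthonormal
orbit inside the closed span \<open>K\<close> of the orthonormal orbit of \<open>y\<^sub>0, \<dots>, y\<^sub>s\<^sub>-\<^sub>1\<close>, then the orthogonal
complement \<open>A\<close> of the \<open>x\<close>-part is isomorphic, as a representation of \<open>G\<close>, to the span \<open>B\<close> of the
orbit of \<open>y\<^sub>r, \<dots>, y\<^sub>s\<^sub>-\<^sub>1\<close>. The sum of \<open>\<parallel>P y\<^sub>j\<parallel>\<^sup>2\<close> over \<open>j\<close> is a faithful trace on the projections \<open>P\<close> in
the commutant, by Parseval and the substitution of \<open>g\<close> by its inverse. By Zorn's lemma there is a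
maximal isometry commuting with \<open>G\<close> between subspaces of \<open>A\<close> and \<open>B\<close>; let \<open>A''\<close> and \<open>B''\<close> be what it
leaves over. By polar decomposition every operator of the commutant maps \<open>A''\<close> into the complement
of \<open>B''\<close>, so the vectors that the commutant sends into that complement form a subspace \<open>Z\<close>,
invariant under the commutant, that contains \<open>A''\<close> and is orthogonal to \<open>B''\<close>. Comparing traces
inside \<open>Z\<close> gives \<open>A'' = 0\<close>, and then comparing them in \<open>K\<close> gives \<open>B'' = 0\<close>.

Part (a) is this statement for orthonormal bases of the wandering subspaces. For (b), Riesz bases
are orthonormalised by the inverse square root of the frame operator, and the complement found is
carried to \<open>W\<^sub>0\<close> by the oblique projection, which is bounded by Baire's theorem. For (c) one projects
the given frame to \<open>W\<^sub>0\<close>. For (d) one takes the dual basis of the basis of \<open>V\<^sub>1\<close> obtained from (b).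
\<close>

text \<open>Cancellation of a common summand fails for unitary representations in general, because
  infinite multiplicity allows proper isometries, and for a non-abelian \<open>G\<close> no
  multiplicity function on a dual group is at hand. The finite number \<open>s\<close> of generators
  is the remedy: it makes the trace finite, and the trace agrees on the initial and the final space
  of a partial isometry in the commutant, so equal parts can be subtracted. The obstacle left is
  that a maximal matching may stop with leftovers on both sides that no nonzero operator of the
  commutant connects; equality of their traces alone does not exclude this. The subspace
  \<open>Z\<close> acts as a central projection that contains one leftover and annihilates the
  other. The trace identity can be cut down to \<open>Z\<close> since the projection onto
  \<open>Z\<close> commutes with \<open>G\<close> and with the commutant; this is why
  \<open>Z\<close> is built from all operators of the commutant and not just as the complement of a
  leftover.\<close>

instance complex_hilbert \<subseteq> banach ..

global_interpretation cvs: vector_space "scaleC :: complex \<Rightarrow> 'a \<Rightarrow> 'a::complex_inner"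
  by unfold_locales (simp_all add: scaleC_add_right scaleC_add_left scaleC_scaleC scaleC_one)

section \<open>Complex inner product spaces\<close>

lemma cinner_add_right: "cinner x (y + z) = cinner x y + cinner x z"
  by (metis cinner_add_left cinner_commute complex_cnj_add)

lemma cinner_scaleC_right [simp]: "cinner x (scaleC a y) = a * cinner x y"
  by (metis cinner_commute cinner_scaleC_left complex_cnj_cnj complex_cnj_mult)

lemmas cinner_scaleC_left [simp]

lemma cinner_scaleR_right [simp]: "cinner x (r *\<^sub>R y) = r *\<^sub>R cinner x y"
  by (simp only: scaleR_scaleC[of r y] cinner_scaleC_right scaleR_conv_of_real)

lemma cinner_scaleR_left [simp]: "cinner (r *\<^sub>R x) y = r *\<^sub>R cinner x y"
  by (simp only: scaleR_scaleC[of r x] cinner_scaleC_left scaleR_conv_of_real complex_cnj_complex_of_real)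

lemma cinner_zero_left [simp]: "cinner 0 x = 0"
  by (metis cinner_scaleR_left scaleR_zero_left)

lemma cinner_zero_right [simp]: "cinner x 0 = 0"
  by (metis cinner_scaleR_right scaleR_zero_left)

lemma cinner_minus_left [simp]: "cinner (- x) y = - cinner x y"
  by (metis cinner_scaleR_left scaleR_minus1_left)

lemma cinner_minus_right [simp]: "cinner y (- x) = - cinner y x"
  by (metis cinner_scaleR_right scaleR_minus1_left)

lemma cinner_diff_left: "cinner (x - y) z = cinner x z - cinner y z"
  using cinner_add_left[of x "- y" z] by simp

lemma cinner_diff_right: "cinner z (x - y) = cinner z x - cinner z y"
  using cinner_add_right[of z x "- y"] by simp

lemma cinner_sum_left: "cinner (sum f S) y = (\<Sum>i\<in>S. cinner (f i) y)"
  by (induct S rule: infinite_finite_induct) (simp_all add: cinner_add_left)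

lemma cinner_sum_right: "cinner y (sum f S) = (\<Sum>i\<in>S. cinner y (f i))"
  by (induct S rule: infinite_finite_induct) (simp_all add: cinner_add_right)

lemma cinner_self_eq_0 [simp]: "cinner x x = 0 \<longleftrightarrow> x = 0"
  by (simp add: cinner_self_norm)

lemma Re_cinner_self: "Re (cinner x x) = (norm x)\<^sup>2"
  by (simp add: cinner_self_norm)

lemma cmod_cinner_commute: "cmod (cinner x y) = cmod (cinner y x)"
  by (metis cinner_commute complex_mod_cnj)

lemma cinner_eq_0_commute: "cinner x y = 0 \<longleftrightarrow> cinner y x = 0"
  by (metis cmod_cinner_commute norm_eq_zero)

lemma norm_scaleC [simp]: "norm (scaleC a x) = cmod a * norm x"
proof -
  have "complex_of_real ((norm (scaleC a x))\<^sup>2) = (a * cnj a) * cinner x x"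
    unfolding cinner_self_norm[of "scaleC a x", symmetric] by simp
  also have "\<dots> = complex_of_real ((cmod a * norm x)\<^sup>2)"
    unfolding complex_norm_square[symmetric] cinner_self_norm by (simp add: power_mult_distrib)
  finally have "complex_of_real ((norm (scaleC a x))\<^sup>2) = complex_of_real ((cmod a * norm x)\<^sup>2)" .
  then have "(norm (scaleC a x))\<^sup>2 = (cmod a * norm x)\<^sup>2"
    by (simp only: of_real_eq_iff)
  then show ?thesis
    by (simp add: power2_eq_iff_nonneg)
qed

lemma norm_add_sq: "(norm (x + y))\<^sup>2 = (norm x)\<^sup>2 + 2 * Re (cinner x y) + (norm (y::'a::complex_inner))\<^sup>2"
proof -
  have "Re (cinner y x) = Re (cinner x y)"
    by (metis cinner_commute cnj.simps(1))
  then show ?thesis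
    unfolding Re_cinner_self[symmetric] by (simp add: cinner_add_left cinner_add_right)
qed

lemma norm_diff_sq: "(norm (x - y))\<^sup>2 = (norm x)\<^sup>2 - 2 * Re (cinner x y) + (norm (y::'a::complex_inner))\<^sup>2"
  using norm_add_sq[of x "- y"] by simp

lemma norm_add_sq_orth: "cinner x y = 0 \<Longrightarrow> (norm (x + y))\<^sup>2 = (norm x)\<^sup>2 + (norm y)\<^sup>2"
  by (simp add: norm_add_sq)

lemma parallelogram:
  "(norm (x + y))\<^sup>2 + (norm (x - y))\<^sup>2 = 2 * (norm x)\<^sup>2 + 2 * (norm (y::'a::complex_inner))\<^sup>2"
  by (simp add: norm_add_sq norm_diff_sq)

lemma cinner_component_orth:
  "y \<noteq> 0 \<Longrightarrow> cinner y (x - scaleC (cinner y x / complex_of_real ((norm y)\<^sup>2)) y) = 0"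
  by (simp add: cinner_diff_right cinner_self_norm)

lemma cauchy_schwarz: "cmod (cinner x y) \<le> norm x * norm y"
proof (cases "y = 0")
  case False
  define a where "a = cinner y x / (norm y)\<^sup>2"
  have o: "cinner (scaleC a y) (x - scaleC a y) = 0"
    using cinner_component_orth[OF False, of x] by (simp add: a_def)
  have "(norm x)\<^sup>2 = (norm (scaleC a y))\<^sup>2 + (norm (x - scaleC a y))\<^sup>2"
    using norm_add_sq_orth[OF o] by simp
  then have "(norm (scaleC a y))\<^sup>2 \<le> (norm x)\<^sup>2" by simp
  then have "norm (scaleC a y) \<le> norm x" by (simp add: power2_le_iff_abs_le)
  then have "cmod a * norm y \<le> norm x" by simp
  moreover have "cmod a * norm y = cmod (cinner y x) / norm y"
    using False by (simp add: a_def norm_divide power2_eq_square norm_mult)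
  ultimately show ?thesis
    using False by (simp add: cmod_cinner_commute[of x y] divide_le_eq)
qed simp

lemma bounded_bilinear_cinner: "bounded_bilinear (cinner :: 'a::complex_inner \<Rightarrow> 'a \<Rightarrow> complex)"
proof
  show "\<exists>K. \<forall>a b. cmod (cinner a (b::'a)) \<le> norm a * norm b * K"
    by (rule exI[of _ 1]) (simp add: cauchy_schwarz)
qed (simp_all add: cinner_add_left cinner_add_right)

lemmas tendsto_cinner [tendsto_intros] = bounded_bilinear.tendsto[OF bounded_bilinear_cinner]
lemmas continuous_on_cinner [continuous_intros] =
  bounded_bilinear.continuous_on[OF bounded_bilinear_cinner]
lemmas bounded_linear_cinner_right = bounded_bilinear.bounded_linear_right[OF bounded_bilinear_cinner]
lemmas bounded_linear_cinner_left = bounded_bilinear.bounded_linear_left[OF bounded_bilinear_cinner]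

lemma bounded_linear_scaleC: "bounded_linear (scaleC a :: 'a::complex_inner \<Rightarrow> 'a)"
  by (rule bounded_linear_intro[where K = "cmod a"])
    (simp_all add: scaleC_add_right scaleR_scaleC scaleC_scaleC mult.commute)

lemmas tendsto_scaleC [tendsto_intros] = bounded_linear.tendsto[OF bounded_linear_scaleC]

lemma cinner_self_le:
  assumes "cinner x x = cinner y z"
  shows "(norm x)\<^sup>2 \<le> norm y * norm z"
proof -
  have "complex_of_real ((norm x)\<^sup>2) = cinner y z" using assms cinner_self_norm by metis
  then have "(norm x)\<^sup>2 = cmod (cinner y z)" by (metis abs_of_nonneg norm_of_real zero_le_power2)
  then show ?thesis using cauchy_schwarz[of y z] by simp
qed

text \<open>By Cauchy-Schwarz. The hypothesis says that \<open>x - y\<close> is orthogonal to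
  \<open>x\<close>; this is how oblique projections are later seen not to decrease norms on an
  orthogonal complement.\<close>

lemma norm_le_of_cinner_self:
  assumes "cinner x x = cinner x y"
  shows "norm x \<le> norm y"
  using cinner_self_le[OF assms] by (cases "x = 0") (auto simp: power2_eq_square)

section \<open>Closed subspaces\<close>

lemma closed_csubspaceD:
  assumes "closed_csubspace V"
  shows "0 \<in> V" "x \<in> V \<Longrightarrow> y \<in> V \<Longrightarrow> x + y \<in> V" "x \<in> V \<Longrightarrow> y \<in> V \<Longrightarrow> x - y \<in> V"
    "x \<in> V \<Longrightarrow> scaleC a x \<in> V" "x \<in> V \<Longrightarrow> r *\<^sub>R x \<in> V" "closed V"
  using assms by (auto simp: closed_csubspace_def csubspace_def scaleR_scaleC
      intro: cvs.subspace_0 cvs.subspace_add cvs.subspace_diff cvs.subspace_scale)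

lemma closed_csubspaceI:
  assumes "0 \<in> V" "\<And>x y. x \<in> V \<Longrightarrow> y \<in> V \<Longrightarrow> x + y \<in> V" "\<And>a x. x \<in> V \<Longrightarrow> scaleC a x \<in> V" "closed V"
  shows "closed_csubspace V"
  using assms by (simp add: closed_csubspace_def csubspace_def cvs.subspace_def)

lemma closed_csubspace_sum:
  "closed_csubspace V \<Longrightarrow> (\<And>i. i \<in> F \<Longrightarrow> f i \<in> V) \<Longrightarrow> sum f F \<in> V"
  by (simp add: closed_csubspace_def csubspace_def cvs.subspace_sum)

lemma closed_csubspace_UNIV: "closed_csubspace UNIV"
  by (rule closed_csubspaceI) auto

lemma closed_csubspace_zero: "closed_csubspace {0}"
  by (rule closed_csubspaceI) auto

lemma closed_csubspace_Int: "closed_csubspace V \<Longrightarrow> closed_csubspace W \<Longrightarrow> closed_csubspace (V \<inter> W)"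
  by (rule closed_csubspaceI) (auto dest: closed_csubspaceD)

lemma closed_csubspace_orth_compl: "closed_csubspace (orth_compl (V::'a::complex_inner set))"
proof (rule closed_csubspaceI)
  have "orth_compl V = (\<Inter>v\<in>V. {x. cinner v x = 0})" by (auto simp: orth_compl_def)
  moreover have "closed {x. cinner v x = 0}" for v :: 'a
    by (intro closed_Collect_eq continuous_intros)
  ultimately show "closed (orth_compl V)" by auto
qed (auto simp: orth_compl_def cinner_add_right)

lemma orth_complD: "x \<in> orth_compl V \<Longrightarrow> v \<in> V \<Longrightarrow> cinner v x = 0"
  "x \<in> orth_compl V \<Longrightarrow> v \<in> V \<Longrightarrow> cinner x v = 0"
  by (auto simp: orth_compl_def cinner_eq_0_commute)

lemma closed_csubspace_ccspan: "closed_csubspace (ccspan (S::'a::complex_inner set))"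
proof (rule closed_csubspaceI)
  show "closed (ccspan S)" by (simp add: ccspan_def)
  show "0 \<in> ccspan S"
    unfolding ccspan_def by (meson closure_subset cvs.span_zero subsetD)
next
  fix x y :: 'a assume "x \<in> ccspan S" "y \<in> ccspan S"
  then obtain u v where "\<And>n. u n \<in> cspan S" "u \<longlonglongrightarrow> x" "\<And>n. v n \<in> cspan S" "v \<longlonglongrightarrow> y"
    unfolding ccspan_def closure_sequential by blast
  then have "\<And>n. u n + v n \<in> cspan S" "(\<lambda>n. u n + v n) \<longlonglongrightarrow> x + y"
    by (auto intro: cvs.span_add tendsto_intros)
  then show "x + y \<in> ccspan S"
    unfolding ccspan_def closure_sequential by (intro exI[of _ "\<lambda>n. u n + v n"]) auto
next
  fix a and x :: 'a assume "x \<in> ccspan S"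
  then obtain u where "\<And>n. u n \<in> cspan S" "u \<longlonglongrightarrow> x"
    unfolding ccspan_def closure_sequential by blast
  then have "\<And>n. scaleC a (u n) \<in> cspan S" "(\<lambda>n. scaleC a (u n)) \<longlonglongrightarrow> scaleC a x"
    by (auto intro: cvs.span_scale tendsto_intros)
  then show "scaleC a x \<in> ccspan S"
    unfolding ccspan_def closure_sequential by (intro exI[of _ "\<lambda>n. scaleC a (u n)"]) auto
qed

lemma subset_ccspan: "S \<subseteq> ccspan S"
  unfolding ccspan_def using closure_subset cvs.span_superset by blast

lemma in_ccspan: "x \<in> S \<Longrightarrow> x \<in> ccspan S"
  using subset_ccspan by (rule subsetD)

lemma ccspan_least: "S \<subseteq> V \<Longrightarrow> closed_csubspace V \<Longrightarrow> ccspan S \<subseteq> V"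
  unfolding ccspan_def closed_csubspace_def csubspace_def
  by (simp add: closure_minimal cvs.span_minimal)

lemma ccspan_mono: "S \<subseteq> T \<Longrightarrow> ccspan S \<subseteq> ccspan T"
  by (meson ccspan_least closed_csubspace_ccspan order_trans subset_ccspan)

lemma ccspan_eq: "closed_csubspace V \<Longrightarrow> S \<subseteq> V \<Longrightarrow> V \<subseteq> ccspan S \<Longrightarrow> ccspan S = V"
  using ccspan_least by blast

lemma orth_compl_ccspan: "orth_compl (ccspan S) = orth_compl (S::'a::complex_inner set)"
proof
  show "orth_compl (ccspan S) \<subseteq> orth_compl S"
    using subset_ccspan by (fastforce simp: orth_compl_def)
  show "orth_compl S \<subseteq> orth_compl (ccspan S)"
  proof
    fix x assume x: "x \<in> orth_compl S"
    then have "S \<subseteq> orth_compl {x}" by (auto simp: orth_compl_def cinner_eq_0_commute)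
    then have "ccspan S \<subseteq> orth_compl {x}" by (rule ccspan_least) (rule closed_csubspace_orth_compl)
    then show "x \<in> orth_compl (ccspan S)" by (auto simp: orth_compl_def cinner_eq_0_commute)
  qed
qed

section \<open>Orthogonal projections\<close>

lemma nearest_point_exists:
  fixes V :: "'a::complex_hilbert set"
  assumes V: "closed_csubspace V"
  shows "\<exists>p\<in>V. \<forall>v\<in>V. norm (f - p) \<le> norm (f - v)"
proof -
  define d where "d = Inf ((\<lambda>v. (norm (f - v))\<^sup>2) ` V)"
  have bdd: "bdd_below ((\<lambda>v. (norm (f - v))\<^sup>2) ` V)" by (rule bdd_belowI[of _ 0]) auto
  have d_le: "d \<le> (norm (f - v))\<^sup>2" if "v \<in> V" for v
    unfolding d_def using bdd that by (auto intro: cINF_lower)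
  have "\<exists>v\<in>V. (norm (f - v))\<^sup>2 < d + 1 / Suc n" for n
  proof -
    have "d < d + 1 / Suc n" by simp
    then show ?thesis unfolding d_def using bdd closed_csubspaceD(1)[OF V]
      by (subst (asm) cINF_less_iff) auto
  qed
  then obtain p where p: "\<And>n. p n \<in> V" "\<And>n. (norm (f - p n))\<^sup>2 < d + 1 / Suc n" by metis
  \<comment> \<open>The midpoint of \<open>p m\<close> and \<open>p n\<close> lies in
    \<open>V\<close>, so its squared distance from \<open>f\<close> is at least \<open>d\<close>;
    the parallelogram law turns this into closeness of the two points.\<close>
  have close: "(norm (p m - p n))\<^sup>2 \<le> 2 / Suc m + 2 / Suc n" for m n
  proof -
    have "(1/2) *\<^sub>R (p m + p n) \<in> V" using V p(1) by (simp add: closed_csubspaceD)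
    then have "d \<le> (norm (f - (1/2) *\<^sub>R (p m + p n)))\<^sup>2" by (rule d_le)
    also have "f - (1/2) *\<^sub>R (p m + p n) = (1/2) *\<^sub>R ((f - p m) + (f - p n))"
      by (simp add: algebra_simps flip: scaleR_add_left)
    finally have "4 * d \<le> (norm ((f - p m) + (f - p n)))\<^sup>2"
      by (simp add: power2_eq_square)
    moreover have "(norm ((f - p m) - (f - p n)))\<^sup>2 = (norm (p m - p n))\<^sup>2"
      by (simp add: norm_minus_commute)
    ultimately show ?thesis
      using parallelogram[of "f - p m" "f - p n"] p(2)[of m] p(2)[of n] by simp
  qed
  have "Cauchy p"
  proof (rule metric_CauchyI)
    fix e :: real assume e: "0 < e"
    obtain N where N: "4 / e\<^sup>2 < real N" using reals_Archimedean2 by blast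
    have "dist (p m) (p n) < e" if "m \<ge> N" "n \<ge> N" for m n
    proof -
      have "N > 0" using N e by (metis divide_pos_pos of_nat_0_less_iff order_less_trans zero_less_numeral zero_less_power)
      have "2 / real (Suc m) \<le> 2 / N" "2 / real (Suc n) \<le> 2 / N"
        using that \<open>N > 0\<close> by (auto intro!: divide_left_mono)
      then have "(norm (p m - p n))\<^sup>2 \<le> 4 / N" using close[of m n] by simp
      also have "\<dots> < e\<^sup>2" using N e \<open>N > 0\<close> by (simp add: field_simps)
      finally show ?thesis using e by (simp add: dist_norm power2_less_imp_less)
    qed
    then show "\<exists>M. \<forall>m\<ge>M. \<forall>n\<ge>M. dist (p m) (p n) < e" by blast
  qed
  then obtain q where q: "p \<longlonglongrightarrow> q" using Cauchy_convergent convergent_def by blast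
  have qV: "q \<in> V" using closed_sequentially[OF closed_csubspaceD(6)[OF V]] p(1) q by blast
  have "(\<lambda>n. (norm (f - p n))\<^sup>2) \<longlonglongrightarrow> (norm (f - q))\<^sup>2" by (intro tendsto_intros q)
  moreover have "(\<lambda>n. d + 1 / Suc n) \<longlonglongrightarrow> d + 0"
    by (intro tendsto_intros LIMSEQ_Suc lim_1_over_n)
  ultimately have "(norm (f - q))\<^sup>2 \<le> d"
    using p(2) by (metis (no_types, lifting) LIMSEQ_le add.right_neutral less_imp_le)
  then have "norm (f - q) \<le> norm (f - v)" if "v \<in> V" for v
    using d_le[OF that] by (meson norm_ge_zero order_trans power2_le_imp_le)
  then show ?thesis using qV by blast
qed

lemma orth_projection_exists:
  fixes V :: "'a::complex_hilbert set"
  assumes V: "closed_csubspace V"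
  shows "\<exists>p\<in>V. f - p \<in> orth_compl V"
proof -
  obtain p where p: "p \<in> V" "\<And>v. v \<in> V \<Longrightarrow> norm (f - p) \<le> norm (f - v)"
    using nearest_point_exists[OF V] by blast
  have "cinner v (f - p) = 0" if v: "v \<in> V" for v
  proof (rule ccontr)
    assume nz: "cinner v (f - p) \<noteq> 0"
    then have v0: "v \<noteq> 0" by auto
    \<comment> \<open>The best correction along \<open>v\<close>: moving \<open>p\<close> by
      \<open>scaleC a v\<close> removes the component of \<open>f - p\<close> along \<open>v\<close>
      and would strictly shorten the distance.\<close>
    define a where "a = cinner v (f - p) / (norm v)\<^sup>2"
    have o: "cinner (scaleC a v) (f - p - scaleC a v) = 0"
      using cinner_component_orth[OF v0, of "f - p"] by (simp add: a_def)
    have "(norm (f - p))\<^sup>2 = (norm (scaleC a v))\<^sup>2 + (norm (f - p - scaleC a v))\<^sup>2"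
      using norm_add_sq_orth[OF o] by simp
    moreover have "norm (f - p) \<le> norm (f - p - scaleC a v)"
      using p(2)[of "p + scaleC a v"] p(1) v V by (simp add: closed_csubspaceD algebra_simps)
    moreover have "norm (scaleC a v) > 0" using nz v0 by (simp add: a_def)
    ultimately show False
      by (smt (verit) norm_ge_zero power2_le_imp_le power_mono zero_less_power2)
  qed
  then show ?thesis using p(1) by (auto simp: orth_compl_def)
qed

definition proj :: "'a::complex_hilbert set \<Rightarrow> 'a \<Rightarrow> 'a" where
  "proj V f = (SOME p. p \<in> V \<and> f - p \<in> orth_compl V)"

context
  fixes V :: "'a::complex_hilbert set"
  assumes V: "closed_csubspace V"
begin

lemma proj_in: "proj V f \<in> V" and proj_orth: "f - proj V f \<in> orth_compl V"
  using someI_ex[of "\<lambda>p. p \<in> V \<and> f - p \<in> orth_compl V"] orth_projection_exists[OF V]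
  unfolding proj_def by blast+

lemma proj_eqI:
  assumes "p \<in> V" "f - p \<in> orth_compl V"
  shows "proj V f = p"
proof -
  have "p - proj V f \<in> V" using assms proj_in V by (simp add: closed_csubspaceD)
  moreover have "(f - proj V f) - (f - p) \<in> orth_compl V"
    by (rule closed_csubspaceD(3)[OF closed_csubspace_orth_compl]) (use assms proj_orth in auto)
  then have "p - proj V f \<in> orth_compl V" by (simp add: algebra_simps)
  ultimately have "cinner (p - proj V f) (p - proj V f) = 0" by (rule orth_complD(1)[rotated])
  then show ?thesis by simp
qed

lemma proj_id: "f \<in> V \<Longrightarrow> proj V f = f"
  by (rule proj_eqI) (auto simp: orth_compl_def)

lemma proj_zero_iff: "proj V f = 0 \<longleftrightarrow> f \<in> orth_compl V"
  using proj_eqI[of 0 f] proj_orth[of f] closed_csubspaceD(1)[OF V] by auto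

lemma proj_add: "proj V (f + h) = proj V f + proj V h"
proof (rule proj_eqI)
  have "(f - proj V f) + (h - proj V h) \<in> orth_compl V"
    by (rule closed_csubspaceD(2)[OF closed_csubspace_orth_compl]) (rule proj_orth)+
  then show "f + h - (proj V f + proj V h) \<in> orth_compl V" by (simp add: algebra_simps)
qed (simp add: proj_in closed_csubspaceD[OF V])

lemma proj_scaleC: "proj V (scaleC a f) = scaleC a (proj V f)"
proof (rule proj_eqI)
  have "scaleC a (f - proj V f) \<in> orth_compl V"
    by (rule closed_csubspaceD(4)[OF closed_csubspace_orth_compl]) (rule proj_orth)
  then show "scaleC a f - scaleC a (proj V f) \<in> orth_compl V" by (simp add: cvs.scale_right_diff_distrib)
qed (simp add: proj_in closed_csubspaceD[OF V])

lemma norm_proj_sq: "(norm f)\<^sup>2 = (norm (proj V f))\<^sup>2 + (norm (f - proj V f))\<^sup>2"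
  using norm_add_sq_orth[of "proj V f" "f - proj V f"] orth_complD(1)[OF proj_orth proj_in] by simp

lemma norm_proj_le: "norm (proj V f) \<le> norm f"
  using norm_proj_sq[of f] by (metis add.commute le_add_same_cancel2 norm_ge_zero power2_le_imp_le zero_le_power2)

lemma cinner_proj: "cinner (proj V f) h = cinner f (proj V h)"
proof -
  have "cinner (proj V f) (h - proj V h) = 0" "cinner (f - proj V f) (proj V h) = 0"
    using orth_complD proj_in proj_orth by blast+
  then show ?thesis by (simp add: cinner_diff_left cinner_diff_right)
qed

lemma cinner_proj_left: "v \<in> V \<Longrightarrow> cinner v (proj V f) = cinner v f"
  using cinner_proj[of v f] proj_id[of v] by simp

end

text \<open>A closed subspace contains its double orthogonal complement: the residual
  \<open>f - proj V f\<close> is itself an admissible \<open>z\<close>, so it is orthogonal to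
  \<open>f\<close> as well as to the projection.\<close>

lemma in_closed_csubspaceI:
  fixes V :: "'a::complex_hilbert set"
  assumes V: "closed_csubspace V" and "\<And>z. z \<in> orth_compl V \<Longrightarrow> cinner z f = 0"
  shows "f \<in> V"
proof -
  have "cinner (f - proj V f) (f - proj V f) = 0"
    using assms(2)[OF proj_orth[OF V]] orth_complD(2)[OF proj_orth[OF V] proj_in[OF V]]
    by (simp add: cinner_diff_right)
  then show ?thesis using proj_in[OF V, of f] by simp
qed

text \<open>Totality inside \<open>V\<close> suffices: the residual of the projection onto the
  closed span of \<open>S\<close> stays in \<open>V\<close> and is orthogonal to \<open>S\<close>,
  so it vanishes.\<close>

lemma ccspan_eqI_orth:
  fixes V :: "'a::complex_hilbert set"
  assumes V: "closed_csubspace V" and S: "S \<subseteq> V"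
    and z: "\<And>f. f \<in> V \<Longrightarrow> (\<And>s. s \<in> S \<Longrightarrow> cinner s f = 0) \<Longrightarrow> f = 0"
  shows "ccspan S = V"
proof (rule ccspan_eq[OF V S], rule subsetI)
  fix f assume f: "f \<in> V"
  let ?p = "proj (ccspan S) f"
  have "f - ?p \<in> orth_compl S"
    using proj_orth[OF closed_csubspace_ccspan, of f S] by (simp add: orth_compl_ccspan)
  moreover have "?p \<in> V" using proj_in[OF closed_csubspace_ccspan] ccspan_least[OF S V] by blast
  ultimately have "f - ?p = 0" using f V by (intro z) (auto simp: closed_csubspaceD orth_compl_def)
  then show "f \<in> ccspan S" using proj_in[OF closed_csubspace_ccspan, of S f] by simp
qed

section \<open>Bounded complex-linear operators and the Riesz representation\<close>

definition bclinear :: "('a::complex_inner \<Rightarrow> 'a) \<Rightarrow> bool" where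
  "bclinear T \<longleftrightarrow> clinear T \<and> (\<exists>C. \<forall>f. norm (T f) \<le> C * norm f)"

lemma bclinearI:
  assumes "\<And>x y. T (x + y) = T x + T y" "\<And>a x. T (scaleC a x) = scaleC a (T x)"
    "\<And>f. norm (T f) \<le> C * norm f"
  shows "bclinear T"
  using assms unfolding bclinear_def clinear_def by blast

lemma bclinear_add: "bclinear T \<Longrightarrow> T (x + y) = T x + T y"
  and bclinear_scaleC: "bclinear T \<Longrightarrow> T (scaleC a x) = scaleC a (T x)"
  by (auto simp: bclinear_def clinear_def)

lemma bclinear_scaleR: "bclinear T \<Longrightarrow> T (r *\<^sub>R x) = r *\<^sub>R T x"
  by (simp add: scaleR_scaleC bclinear_scaleC)

lemma bclinear_bounded:
  assumes "bclinear T"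
  obtains C where "C > 0" "\<And>f. norm (T f) \<le> C * norm f"
proof -
  obtain C where C: "\<And>f. norm (T f) \<le> C * norm f" using assms by (auto simp: bclinear_def)
  have "norm (T f) \<le> (\<bar>C\<bar> + 1) * norm f" for f
    by (rule order_trans[OF C]) (simp add: mult_right_mono)
  then show ?thesis using that[of "\<bar>C\<bar> + 1"] by simp
qed

lemma bclinear_bounded_linear: 
  assumes "bclinear T" shows "bounded_linear T"
proof -
  obtain C where "C > 0" "\<And>f. norm (T f) \<le> C * norm f" using bclinear_bounded[OF assms] by blast
  then show ?thesis
    using assms by (intro bounded_linear_intro[where K = C])
      (simp_all add: bclinear_add bclinear_scaleC scaleR_scaleC mult.commute)
qed

lemma bclinear_diff: "bclinear T \<Longrightarrow> T (x - y) = T x - T y"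
  by (simp add: bclinear_bounded_linear bounded_linear.linear linear_diff)

lemma bclinear_zero [simp]: "bclinear T \<Longrightarrow> T 0 = 0"
  by (simp add: bclinear_bounded_linear bounded_linear.linear linear_0)

lemma bclinear_sum: "bclinear T \<Longrightarrow> T (sum f S) = (\<Sum>i\<in>S. T (f i))"
  by (simp add: bclinear_bounded_linear bounded_linear.linear linear_sum)

lemma bclinear_proj: "closed_csubspace V \<Longrightarrow> bclinear (proj V)"
  by (rule bclinearI[where C = 1]) (simp_all add: proj_add proj_scaleC norm_proj_le)

lemma bclinear_id: "bclinear (\<lambda>x. x)"
  by (rule bclinearI[where C = 1]) simp_all

lemma bclinear_compose:
  assumes "bclinear S" "bclinear T" shows "bclinear (\<lambda>x. S (T x))"
proof -
  obtain C where C: "C > 0" "\<And>f. norm (S f) \<le> C * norm f" using bclinear_bounded[OF assms(1)] by blast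
  obtain C' where C': "C' > 0" "\<And>f. norm (T f) \<le> C' * norm f" using bclinear_bounded[OF assms(2)] by blast
  have "norm (S (T f)) \<le> C * C' * norm f" for f
    using C(1) order_trans[OF C(2) mult_left_mono[OF C'(2)]] by (simp add: mult.assoc)
  then show ?thesis using assms
    by (intro bclinearI[where C = "C * C'"]) (simp_all add: bclinear_add bclinear_scaleC)
qed

lemma closed_csubspace_vimage:
  assumes T: "bclinear T" and V: "closed_csubspace V"
  shows "closed_csubspace {x. T x \<in> V}"
proof (rule closed_csubspaceI)
  have "continuous_on UNIV T"
    by (simp add: bclinear_bounded_linear[OF T] linear_continuous_on)
  then have "closed (T -` V)" by (intro closed_vimage closed_csubspaceD(6)[OF V])
  then show "closed {x. T x \<in> V}" by (simp add: vimage_def)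
qed (use T V in \<open>auto simp: bclinear_add bclinear_scaleC closed_csubspaceD\<close>)

text \<open>Linearity and boundedness are required on the closed subspace only, which yields adjoint
  vectors inside \<open>V\<close> without constructing adjoint operators. The representing vector is
  a multiple of some \<open>e\<close> in \<open>V\<close> orthogonal to the kernel: subtracting a
  suitable multiple of \<open>e\<close> from any \<open>x\<close> lands in the kernel.\<close>

lemma riesz_representation:
  fixes V :: "'a::complex_hilbert set" and \<phi> :: "'a \<Rightarrow> complex"
  assumes V: "closed_csubspace V"
    and add: "\<And>x y. x \<in> V \<Longrightarrow> y \<in> V \<Longrightarrow> \<phi> (x + y) = \<phi> x + \<phi> y"
    and scale: "\<And>a x. x \<in> V \<Longrightarrow> \<phi> (scaleC a x) = a * \<phi> x"
    and bound: "\<And>x. x \<in> V \<Longrightarrow> cmod (\<phi> x) \<le> C * norm x"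
  shows "\<exists>w\<in>V. (\<forall>x\<in>V. \<phi> x = cinner w x)"
proof -
  have \<phi>0: "\<phi> 0 = 0" using scale[of 0 0] closed_csubspaceD(1)[OF V] by simp
  have diff: "\<phi> (x - y) = \<phi> x - \<phi> y" if "x \<in> V" "y \<in> V" for x y
    using add[of "x - y" y] that V by (simp add: closed_csubspaceD)
  let ?N = "{x\<in>V. \<phi> x = 0}"
  have N: "closed_csubspace ?N"
  proof (rule closed_csubspaceI)
    show "closed ?N"
    proof (rule closed_sequential_limits[THEN iffD2], intro allI impI)
      fix u l assume ul: "(\<forall>n. u n \<in> ?N) \<and> u \<longlonglongrightarrow> l"
      then have l: "l \<in> V" using closed_sequentially[OF closed_csubspaceD(6)[OF V]] by blast
      have "cmod (\<phi> l) \<le> C * norm (l - u n)" for n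
        using bound[of "l - u n"] ul l V by (simp add: closed_csubspaceD diff)
      moreover have "(\<lambda>n. C * norm (l - u n)) \<longlonglongrightarrow> C * norm (l - l)"
        by (intro tendsto_intros) (use ul in auto)
      ultimately have "cmod (\<phi> l) \<le> 0" by (intro LIMSEQ_le_const) auto
      then show "l \<in> ?N" using l by simp
    qed
  qed (use V \<phi>0 add scale in \<open>auto simp: closed_csubspaceD\<close>)
  show ?thesis
  proof (cases "\<forall>x\<in>V. \<phi> x = 0")
    case True
    then show ?thesis using closed_csubspaceD(1)[OF V] by (intro bexI[of _ 0]) auto
  next
    case False
    then obtain y where y: "y \<in> V" "\<phi> y \<noteq> 0" by blast
    define e where "e = y - proj ?N y"
    have p: "proj ?N y \<in> ?N" by (rule proj_in[OF N])
    have e: "e \<in> V" "\<phi> e = \<phi> y" "e \<in> orth_compl ?N"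
      using p y V proj_orth[OF N, of y] by (auto simp: e_def closed_csubspaceD diff)
    then have e0: "e \<noteq> 0" using y \<phi>0 by auto
    \<comment> \<open>The factor is forced by \<open>cinner w e = \<phi> e\<close>.\<close>
    define w where "w = scaleC (cnj (\<phi> e) / (norm e)\<^sup>2) e"
    have w: "w \<in> V" using e V by (simp add: w_def closed_csubspaceD)
    have rep: "\<phi> x = cinner w x" if x: "x \<in> V" for x
    proof -
      have "x - scaleC (\<phi> x / \<phi> e) e \<in> ?N" using x e y V by (simp add: closed_csubspaceD diff scale)
      then have "cinner e (x - scaleC (\<phi> x / \<phi> e) e) = 0" using e(3) orth_complD by blast
      then have "cinner e x = \<phi> x / \<phi> e * (norm e)\<^sup>2" by (simp add: cinner_diff_right cinner_self_norm)
      then show ?thesis using e0 e(2) y by (simp add: w_def)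
    qed
    show ?thesis using w rep by blast
  qed
qed

section \<open>Square roots of positive operators\<close>

text \<open>The coefficients of the power series of \<open>sqrt (1 - t)\<close>.\<close>
definition sqrt_coeff :: "nat \<Rightarrow> real" where
  "sqrt_coeff k = pochhammer (- 1 / 2) k / fact k"

lemma sqrt_coeff_gbinomial: "sqrt_coeff k = (- 1) ^ k * ((1 / 2) gchoose k)"
  by (simp add: sqrt_coeff_def gbinomial_pochhammer flip: power_mult_distrib)

lemma sqrt_coeff_nonpos: "sqrt_coeff (Suc k) \<le> 0"
proof -
  have "pochhammer (- 1 / 2) (Suc k) = (- 1 / 2) * pochhammer (1 / 2 :: real) k"
    by (simp add: pochhammer_rec)
  moreover have "pochhammer (1 / 2 :: real) k \<ge> 0" by (intro pochhammer_nonneg) simp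
  ultimately show ?thesis by (simp add: sqrt_coeff_def divide_nonpos_pos)
qed

text \<open>Dividing the series by \<open>1 - t\<close> shows that the partial sums are the
  coefficients of the inverse square root of \<open>1 - t\<close>, namely
  \<open>pochhammer (1 / 2) m / fact m\<close>.\<close>

lemma sum_sqrt_coeff_nonneg: "(\<Sum>k\<le>m. sqrt_coeff k) \<ge> 0"
proof -
  have "(\<Sum>k\<le>m. sqrt_coeff k) = (- 1) ^ m * ((- 1 / 2 :: real) gchoose m)"
    using gbinomial_sum_lower_neg[of "1 / 2 :: real" m] by (simp add: sqrt_coeff_gbinomial mult.commute)
  also have "\<dots> = pochhammer (1 / 2) m / fact m"
    by (simp add: gbinomial_pochhammer flip: power_mult_distrib)
  also have "\<dots> \<ge> 0" by (intro divide_nonneg_nonneg pochhammer_nonneg) simp_all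
  finally show ?thesis .
qed

text \<open>Only the coefficient with index 0 is positive, and it is 1; so an absolute partial sum
  is 2 minus the signed one, hence at most 2. Summability at the boundary point \<open>t = 1\<close>
  lets the series be applied to contractions of norm exactly 1.\<close>

lemma sqrt_coeff_abs_summable: "(\<lambda>k. \<bar>sqrt_coeff k\<bar>) summable_on UNIV"
proof -
  have "(\<Sum>k\<le>m. \<bar>sqrt_coeff k\<bar>) \<le> 2" for m
  proof -
    have "(\<Sum>k\<le>m. \<bar>sqrt_coeff k\<bar>) = (\<Sum>k\<le>m. 2 * (if k = 0 then 1 else 0) - sqrt_coeff k)"
    proof (rule sum.cong)
      fix k show "\<bar>sqrt_coeff k\<bar> = 2 * (if k = 0 then 1 else 0) - sqrt_coeff k"
        by (cases k) (simp_all add: sqrt_coeff_nonpos, simp add: sqrt_coeff_def)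
    qed simp
    also have "\<dots> = 2 - (\<Sum>k\<le>m. sqrt_coeff k)" by (simp add: sum_subtractf flip: sum_distrib_left)
    finally show ?thesis using sum_sqrt_coeff_nonneg[of m] by simp
  qed
  then have "summable (\<lambda>k. \<bar>sqrt_coeff k\<bar>)"
    by (intro bounded_imp_summable[of _ 2]) auto
  then show ?thesis by (intro summable_nonneg_imp_summable_on) auto
qed

text \<open>Vandermonde's identity for \<open>1 / 2 + 1 / 2 = 1\<close>: the square of the series is
  \<open>1 - t\<close>.\<close>

lemma sqrt_coeff_convolution:
  "(\<Sum>k\<le>n. sqrt_coeff k * sqrt_coeff (n - k)) = (if n = 0 then 1 else if n = 1 then - 1 else 0)"
proof -
  have "(\<Sum>k\<le>n. sqrt_coeff k * sqrt_coeff (n - k)) =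
      (\<Sum>k\<le>n. (- 1) ^ n * ((1 / 2 gchoose k) * (1 / 2 gchoose (n - k))))"
  proof (rule sum.cong)
    fix k assume "k \<in> {..n}"
    then have "(- 1 :: real) ^ n = (- 1) ^ k * (- 1) ^ (n - k)" by (simp flip: power_add)
    then show "sqrt_coeff k * sqrt_coeff (n - k) = (- 1) ^ n * ((1 / 2 gchoose k) * (1 / 2 gchoose (n - k)))"
      by (simp add: sqrt_coeff_gbinomial)
  qed simp
  also have "\<dots> = (- 1) ^ n * (1 gchoose n)"
    using gbinomial_Vandermonde[of "1 / 2 :: real" "1 / 2" n] by (simp add: atMost_atLeast0 flip: sum_distrib_left)
  also have "\<dots> = (- 1) ^ n * real (1 choose n)" by (metis binomial_gbinomial of_nat_1)
  finally show ?thesis by (cases "n \<le> 1") (auto simp: le_Suc_eq)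
qed

definition sqrt_series :: "('a::complex_hilbert \<Rightarrow> 'a) \<Rightarrow> 'a \<Rightarrow> 'a" where
  "sqrt_series E f = (\<Sum>\<^sub>\<infinity>k. sqrt_coeff k *\<^sub>R (E ^^ k) f)"

lemma
  fixes E :: "'a::complex_hilbert \<Rightarrow> 'a"
  assumes E: "bclinear E" and contr: "\<And>f. norm (E f) \<le> norm f"
  shows sqrt_series_has_sum: "((\<lambda>k. sqrt_coeff k *\<^sub>R (E ^^ k) f) has_sum sqrt_series E f) UNIV"
    and bclinear_sqrt_series: "bclinear (sqrt_series E)"
    and sqrt_series_squared: "sqrt_series E (sqrt_series E f) = f - E f"
proof -
  let ?S = "sqrt_series E"
  have Ek: "norm ((E ^^ k) f) \<le> norm f" for k f
    by (induction k) (auto intro: order_trans[OF contr])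
  have bEk: "bclinear (E ^^ k)" for k
    by (induction k) (use E in \<open>auto simp: o_def id_def bclinear_id intro: bclinear_compose\<close>)
  let ?M = "\<Sum>\<^sub>\<infinity>k. \<bar>sqrt_coeff k\<bar>"
  have abs: "(\<lambda>k. \<bar>sqrt_coeff k\<bar> * norm f) summable_on UNIV" for f :: 'a
    by (intro summable_on_cmult_left sqrt_coeff_abs_summable)
  have asum: "(\<lambda>k. sqrt_coeff k *\<^sub>R (E ^^ k) f) abs_summable_on UNIV" for f
    by (rule Infinite_Sum.abs_summable_on_comparison_test'[OF abs[of f]]) (simp add: mult_left_mono Ek)
  show hs: "((\<lambda>k. sqrt_coeff k *\<^sub>R (E ^^ k) f) has_sum ?S f) UNIV" for f
    unfolding sqrt_series_def by (rule has_sum_infsum[OF abs_summable_summable[OF asum]])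
  show bS: "bclinear ?S"
  proof (rule bclinearI[where C = ?M])
    fix x y show "?S (x + y) = ?S x + ?S y"
      using has_sum_add[OF hs[of x] hs[of y]] hs[of "x + y"]
      by (intro has_sum_unique) (auto simp: bclinear_add[OF bEk] scaleR_add_right)
  next
    fix a x show "?S (scaleC a x) = scaleC a (?S x)"
      using has_sum_bounded_linear[OF bounded_linear_scaleC[of a] hs[of x]] hs[of "scaleC a x"]
      by (intro has_sum_unique) (auto simp: bclinear_scaleC[OF bEk] scaleR_scaleC scaleC_scaleC mult.commute)
  next
    fix f
    have "norm (?S f) \<le> (\<Sum>\<^sub>\<infinity>k. norm (sqrt_coeff k *\<^sub>R (E ^^ k) f))"
      unfolding sqrt_series_def by (rule norm_infsum_bound[OF asum])
    also have "\<dots> \<le> (\<Sum>\<^sub>\<infinity>k. \<bar>sqrt_coeff k\<bar> * norm f)"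
      using asum abs by (intro infsum_mono) (auto simp: mult_left_mono Ek)
    finally show "norm (?S f) \<le> ?M * norm f"
      by (simp add: infsum_cmult_left' sqrt_coeff_abs_summable)
  qed
  \<comment> \<open>The double series of the composition. Absolute summability permits regrouping
    along the antidiagonals \<open>k + l = n\<close>, where the convolution identity leaves only
    \<open>n = 0\<close> and \<open>n = 1\<close>.\<close>
  define F where "F = (\<lambda>(k, l). (sqrt_coeff k * sqrt_coeff l) *\<^sub>R (E ^^ (k + l)) f)"
  have "F abs_summable_on UNIV \<times> UNIV"
  proof -
    have "(\<lambda>(k, l). \<bar>sqrt_coeff k\<bar> * \<bar>sqrt_coeff l\<bar>) summable_on UNIV \<times> UNIV"
    proof -
      have "(\<lambda>p. norm ((\<lambda>(k, l). \<bar>sqrt_coeff k\<bar> * \<bar>sqrt_coeff l\<bar>) p)) summable_on UNIV \<times> UNIV"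
        by (rule Infinite_Sum.abs_summable_on_Sigma_iff[THEN iffD2])
          (simp add: abs_mult infsum_cmult_right' summable_on_cmult_right sqrt_coeff_abs_summable
            abs_of_nonneg[OF infsum_nonneg] summable_on_cmult_left)
      then show ?thesis by (rule abs_summable_summable)
    qed
    then have "(\<lambda>p. (\<lambda>(k, l). \<bar>sqrt_coeff k\<bar> * \<bar>sqrt_coeff l\<bar>) p * norm f) summable_on UNIV \<times> UNIV"
      by (rule summable_on_cmult_left)
    then show ?thesis
      by (rule Infinite_Sum.abs_summable_on_comparison_test')
        (auto simp: F_def abs_mult intro!: mult_left_mono Ek)
  qed
  then have FS: "F summable_on UNIV \<times> UNIV" by (rule abs_summable_summable)
  have "?S (?S f) = (\<Sum>\<^sub>\<infinity>k. \<Sum>\<^sub>\<infinity>l. F (k, l))"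
    unfolding sqrt_series_def[of E "?S f"]
  proof (rule infsum_cong)
    fix k
    have "bounded_linear (\<lambda>x. sqrt_coeff k *\<^sub>R (E ^^ k) x)"
      by (intro bounded_linear_compose[OF bounded_linear_scaleR_right] bclinear_bounded_linear bEk)
    from has_sum_bounded_linear[OF this hs[of f]]
    have "((\<lambda>l. F (k, l)) has_sum (sqrt_coeff k *\<^sub>R (E ^^ k) (?S f))) UNIV"
      by (simp add: F_def bclinear_scaleC[OF bEk] funpow_add
          bclinear_scaleR[OF bEk])
    then show "sqrt_coeff k *\<^sub>R (E ^^ k) (?S f) = (\<Sum>\<^sub>\<infinity>l. F (k, l))" by (simp add: infsumI)
  qed
  also have "\<dots> = infsum F (UNIV \<times> UNIV)" by (rule infsum_Sigma_banach[OF FS])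
  also have "\<dots> = infsum (\<lambda>(n, k). F (k, n - k)) (SIGMA n:UNIV. {..n})"
    by (rule infsum_reindex_bij_witness[where i = "\<lambda>(n, k). (k, n - k)" and j = "\<lambda>(k, l). (k + l, k)"]) auto
  also have "\<dots> = (\<Sum>\<^sub>\<infinity>n. \<Sum>\<^sub>\<infinity>k\<in>{..n}. F (k, n - k))"
  proof (rule infsum_Sigma'_banach[symmetric])
    show "(\<lambda>(n, k). F (k, n - k)) summable_on (SIGMA n:UNIV. {..n})"
      by (rule summable_on_reindex_bij_witness[THEN iffD1, OF _ _ _ _ _ FS,
            where i1 = "\<lambda>(n, k). (k, n - k)" and j1 = "\<lambda>(k, l). (k + l, k)"]) auto
  qed
  also have "\<dots> = (\<Sum>\<^sub>\<infinity>n. (if n = 0 then 1 else if n = 1 then - 1 else 0) *\<^sub>R (E ^^ n) f)"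
    unfolding sqrt_coeff_convolution[symmetric]
    by (simp add: F_def scaleR_sum_left)
  also have "\<dots> = f - E f"
    by (rule infsumI, rule has_sum_finite_neutralI[where B = "{0, 1}"]) auto
  finally show "?S (?S f) = f - E f" .
qed

text \<open>The norm bound encodes that \<open>D\<close> lies between 0 and \<open>B\<close>: it
  makes \<open>E = 1 - D / B\<close> a contraction, and \<open>sqrt B\<close> times the series in
  \<open>E\<close> is the root. As a pointwise limit of polynomials in \<open>D\<close>, the root
  inherits self-adjointness and commutes with every bounded operator that commutes with
  \<open>D\<close>.\<close>

lemma sqrt_operator:
  fixes D :: "'a::complex_hilbert \<Rightarrow> 'a"
  assumes D: "bclinear D" and sa: "\<And>f h. cinner (D f) h = cinner f (D h)"
    and B: "B > 0" "\<And>f. (norm (D f))\<^sup>2 \<le> B * Re (cinner f (D f))"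
  shows "\<exists>S. bclinear S \<and> (\<forall>f h. cinner (S f) h = cinner f (S h)) \<and> (\<forall>f. S (S f) = D f) \<and>
    (\<forall>T. bclinear T \<and> (\<forall>f. D (T f) = T (D f)) \<longrightarrow> (\<forall>f. S (T f) = T (S f)))"
proof -
  define E where "E = (\<lambda>f. f - (1 / B) *\<^sub>R D f)"
  have dpos: "0 \<le> Re (cinner f (D f))" for f
    using order_trans[OF zero_le_power2 B(2)[of f]] B(1) by (simp add: zero_le_mult_iff)
  have contr: "norm (E f) \<le> norm f" for f
  proof -
    have "(norm (E f))\<^sup>2 = (norm f)\<^sup>2 - 2 / B * Re (cinner f (D f)) + (norm (D f))\<^sup>2 / B\<^sup>2"
      by (simp add: E_def norm_diff_sq power_divide)
    also have "(norm (D f))\<^sup>2 / B\<^sup>2 \<le> B * Re (cinner f (D f)) / B\<^sup>2"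
      by (intro divide_right_mono B) simp
    also have "\<dots> = 1 / B * Re (cinner f (D f))" using B(1) by (simp add: power2_eq_square)
    finally have "(norm (E f))\<^sup>2 \<le> (norm f)\<^sup>2 - 1 / B * Re (cinner f (D f))" by (simp add: algebra_simps)
    also have "\<dots> \<le> (norm f)\<^sup>2" using dpos[of f] B(1) by simp
    finally show ?thesis by (rule power2_le_imp_le) simp
  qed
  have E: "bclinear E"
  proof (rule bclinearI[where C = 1])
    show "E (x + y) = E x + E y" for x y
      by (simp add: E_def bclinear_add[OF D] scaleR_add_right)
    show "E (scaleC a x) = scaleC a (E x)" for a x
      by (simp add: E_def bclinear_scaleC[OF D] cvs.scale_right_diff_distrib
          scaleR_scaleC[of _ "scaleC _ _ :: 'a"] scaleR_scaleC[of _ "D x"] scaleC_scaleC mult.commute)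
  qed (simp add: contr)
  have Esa: "cinner (E f) h = cinner f (E h)" for f h
    by (simp add: E_def cinner_diff_left cinner_diff_right sa)
  define S0 where "S0 = sqrt_series E"
  note hs = sqrt_series_has_sum[OF E contr, folded S0_def]
  note bS0 = bclinear_sqrt_series[OF E contr, folded S0_def]
  note sq = sqrt_series_squared[OF E contr, folded S0_def]
  define S where "S = (\<lambda>f. sqrt B *\<^sub>R S0 f)"
  have Eksa: "cinner ((E ^^ k) f) h = cinner f ((E ^^ k) h)" for k f h
    by (induction k arbitrary: f h) (simp_all add: Esa funpow_swap1)
  have S0sa: "cinner (S0 f) h = cinner f (S0 h)" for f h
  proof (rule has_sum_unique)
    show "((\<lambda>k. cinner (sqrt_coeff k *\<^sub>R (E ^^ k) f) h) has_sum cinner (S0 f) h) UNIV"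
      using has_sum_bounded_linear[OF bounded_linear_cinner_left[of h] hs[of f]] .
    show "((\<lambda>k. cinner (sqrt_coeff k *\<^sub>R (E ^^ k) f) h) has_sum cinner f (S0 h)) UNIV"
      using has_sum_bounded_linear[OF bounded_linear_cinner_right[of f] hs[of h]] by (simp add: Eksa)
  qed
  have bS: "bclinear S"
    unfolding S_def scaleR_scaleC
  proof (rule bclinear_compose[OF _ bS0])
    show "bclinear (scaleC (complex_of_real (sqrt B)) :: 'a \<Rightarrow> 'a)"
      by (rule bclinearI[where C = "\<bar>sqrt B\<bar>"]) (simp_all add: scaleC_add_right scaleC_scaleC mult.commute)
  qed
  have 1: "cinner (S f) h = cinner f (S h)" for f h by (simp add: S_def S0sa)
  have 2: "S (S f) = D f" for f
  proof -
    have "S (S f) = B *\<^sub>R S0 (S0 f)"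
      using B(1) by (simp add: S_def bclinear_scaleR[OF bS0])
    also have "\<dots> = D f" using B(1) unfolding sq by (simp add: E_def)
    finally show ?thesis .
  qed
  have 3: "S (T f) = T (S f)" if T: "bclinear T" and c: "\<And>f. D (T f) = T (D f)" for T f
  proof -
    note bT = bclinear_bounded_linear[OF T]
    have "E (T f) = T (E f)" for f
      by (simp add: E_def c bclinear_diff[OF T] bclinear_scaleR[OF T])
    then have "(E ^^ k) (T f) = T ((E ^^ k) f)" for k
      by (induction k) simp_all
    then have "S0 (T f) = T (S0 f)"
      using has_sum_bounded_linear[OF bT hs[of f]] hs[of "T f"]
      by (intro has_sum_unique) (auto simp: bclinear_scaleR[OF T])
    then show ?thesis by (simp add: S_def bclinear_scaleR[OF T])
  qed
  show ?thesis using bS 1 2 3 by (intro exI[of _ S]) blast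
qed

section \<open>Bessel and Riesz sequences\<close>

lemma bclinear_minus: "bclinear S \<Longrightarrow> bclinear T \<Longrightarrow> bclinear (\<lambda>x. S x - T x)"
proof -
  assume S: "bclinear S" and T: "bclinear T"
  obtain C where C: "C > 0" "\<And>f. norm (S f) \<le> C * norm f" using bclinear_bounded[OF S] by blast
  obtain C' where C': "C' > 0" "\<And>f. norm (T f) \<le> C' * norm f" using bclinear_bounded[OF T] by blast
  show ?thesis
  proof (rule bclinearI[where C = "C + C'"])
    show "norm (S f - T f) \<le> (C + C') * norm f" for f
      using norm_triangle_ineq4[of "S f" "T f"] C(2)[of f] C'(2)[of f] by (simp add: distrib_right)
  qed (simp_all add: bclinear_add[OF S] bclinear_add[OF T] bclinear_scaleC[OF S] bclinear_scaleC[OF T]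
      cvs.scale_right_diff_distrib)
qed

lemma bclinear_eq_on_ccspan:
  assumes "bclinear S" "bclinear T" "\<And>x. x \<in> X \<Longrightarrow> S x = T x" "f \<in> ccspan X"
  shows "S f = T f"
proof -
  have "ccspan X \<subseteq> {x. S x - T x \<in> {0}}"
    by (rule ccspan_least) (use assms(3) closed_csubspace_vimage[OF bclinear_minus[OF assms(1,2)] closed_csubspace_zero] in auto)
  then show ?thesis using assms(4) by auto
qed

lemma bclinear_image_ccspan_subset:
  assumes "bclinear T" "\<And>x. x \<in> X \<Longrightarrow> T x \<in> V" "closed_csubspace V" "f \<in> ccspan X"
  shows "T f \<in> V"
proof -
  have "ccspan X \<subseteq> {x. T x \<in> V}"
    by (rule ccspan_least) (use assms(2) closed_csubspace_vimage[OF assms(1,3)] in auto)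
  then show ?thesis using assms(4) by auto
qed

text \<open>The lower bound lets a convergent sequence of images be pulled back to a Cauchy sequence
  in \<open>V\<close>.\<close>

lemma closed_csubspace_image:
  fixes T :: "'a::complex_hilbert \<Rightarrow> 'a"
  assumes T: "bclinear T" and V: "closed_csubspace V" and c: "c > 0" "\<And>f. f \<in> V \<Longrightarrow> c * norm f \<le> norm (T f)"
  shows "closed_csubspace (T ` V)"
proof (rule closed_csubspaceI)
  show "0 \<in> T ` V" using T closed_csubspaceD(1)[OF V] by (intro image_eqI[of _ _ 0]) auto
  show "x + y \<in> T ` V" if "x \<in> T ` V" "y \<in> T ` V" for x y
    using that V by (auto simp: bclinear_add[OF T, symmetric] closed_csubspaceD)
  show "scaleC a x \<in> T ` V" if "x \<in> T ` V" for a x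
    using that V by (auto simp: bclinear_scaleC[OF T, symmetric] closed_csubspaceD)
  show "closed (T ` V)"
  proof (rule closed_sequential_limits[THEN iffD2], intro allI impI)
    fix u l assume ul: "(\<forall>n. u n \<in> T ` V) \<and> u \<longlonglongrightarrow> l"
    then obtain w where w: "\<And>n. w n \<in> V" "\<And>n. u n = T (w n)" by (auto simp: image_iff) metis
    have "Cauchy u" using ul LIMSEQ_imp_Cauchy by blast
    have "Cauchy w"
    proof (rule metric_CauchyI)
      fix e :: real assume "e > 0"
      then obtain M where M: "\<And>m n. m \<ge> M \<Longrightarrow> n \<ge> M \<Longrightarrow> dist (u m) (u n) < c * e"
        using metric_CauchyD[OF \<open>Cauchy u\<close>, of "c * e"] c(1) by (metis mult_pos_pos)
      have "dist (w m) (w n) < e" if "m \<ge> M" "n \<ge> M" for m n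
      proof -
        have "c * norm (w m - w n) \<le> dist (u m) (u n)"
          using c(2)[of "w m - w n"] w V by (simp add: closed_csubspaceD bclinear_diff[OF T] dist_norm)
        also have "\<dots> < c * e" using M that by blast
        finally show ?thesis using c(1) by (simp add: dist_norm)
      qed
      then show "\<exists>M. \<forall>m\<ge>M. \<forall>n\<ge>M. dist (w m) (w n) < e" by blast
    qed
    then obtain q where q: "w \<longlonglongrightarrow> q" using Cauchy_convergent convergent_def by blast
    then have "q \<in> V" using closed_sequentially[OF closed_csubspaceD(6)[OF V]] w by blast
    moreover have "u \<longlonglongrightarrow> T q"
      unfolding w(2)[abs_def] by (rule bounded_linear.tendsto[OF bclinear_bounded_linear[OF T] q])
    ultimately show "l \<in> T ` V" using ul LIMSEQ_unique by blast
  qed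
qed

lemma image_ccspan:
  fixes T :: "'a::complex_hilbert \<Rightarrow> 'a"
  assumes T: "bclinear T" and c: "c > 0" "\<And>f. f \<in> ccspan X \<Longrightarrow> c * norm f \<le> norm (T f)"
  shows "ccspan (T ` X) = T ` ccspan X"
proof (rule ccspan_eq)
  show "closed_csubspace (T ` ccspan X)"
    by (rule closed_csubspace_image[OF T closed_csubspace_ccspan c])
  show "T ` X \<subseteq> T ` ccspan X" by (intro image_mono subset_ccspan)
  have "T x \<in> ccspan (T ` X)" if "x \<in> X" for x using that by (intro in_ccspan imageI)
  then have "T f \<in> ccspan (T ` X)" if "f \<in> ccspan X" for f
    using bclinear_image_ccspan_subset[OF T _ closed_csubspace_ccspan that] by blast
  then show "T ` ccspan X \<subseteq> ccspan (T ` X)" by blast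
qed

text \<open>The lower bound gives closed range. Self-adjointness gives dense range, since an
  \<open>f\<close> in \<open>V\<close> orthogonal to the range satisfies
  \<open>0 = cinner (D (D f)) f = cinner (D f) (D f)\<close>.\<close>

lemma selfadjoint_image_eq:
  fixes D :: "'a::complex_hilbert \<Rightarrow> 'a"
  assumes D: "bclinear D" and sa: "\<And>f h. cinner (D f) h = cinner f (D h)"
    and V: "closed_csubspace V" and DV: "\<And>f. f \<in> V \<Longrightarrow> D f \<in> V"
    and c: "c > 0" "\<And>f. f \<in> V \<Longrightarrow> c * norm f \<le> norm (D f)"
  shows "D ` V = V"
proof -
  have "ccspan (D ` V) = V"
  proof (rule ccspan_eqI_orth[OF V])
    fix f assume f: "f \<in> V" "\<And>s. s \<in> D ` V \<Longrightarrow> cinner s f = 0"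
    then have "cinner (D (D f)) f = 0" using DV by blast
    then have "cinner (D f) (D f) = 0" using sa[of "D f" f] by simp
    then have "D f = 0" by simp
    then show "f = 0" using c(2)[OF f(1)] c(1) by (simp add: mult_le_0_iff)
  qed (use DV in auto)
  moreover have "ccspan (D ` V) = D ` V"
    using ccspan_eq[OF closed_csubspace_image[OF D V c] order_refl subset_ccspan] .
  ultimately show ?thesis by simp
qed

text \<open>Bounds on finite sums only, so that no summability has to be carried along;
  \<open>bessel_summable\<close> passes to square-summable coefficients. Upper and lower bounds are
  separate predicates because the operators below rest on the upper one alone.\<close>

definition bessel_seq :: "real \<Rightarrow> ('i \<Rightarrow> 'a::complex_inner) \<Rightarrow> 'i set \<Rightarrow> bool" where
  "bessel_seq B v J \<longleftrightarrow> B > 0 \<and> (\<forall>F a. finite F \<and> F \<subseteq> J \<longrightarrow>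
     (norm (\<Sum>n\<in>F. scaleC (a n) (v n)))\<^sup>2 \<le> B * (\<Sum>n\<in>F. (cmod (a n))\<^sup>2))"

definition riesz_seq :: "real \<Rightarrow> ('i \<Rightarrow> 'a::complex_inner) \<Rightarrow> 'i set \<Rightarrow> bool" where
  "riesz_seq A v J \<longleftrightarrow> A > 0 \<and> (\<forall>F a. finite F \<and> F \<subseteq> J \<longrightarrow>
     A * (\<Sum>n\<in>F. (cmod (a n))\<^sup>2) \<le> (norm (\<Sum>n\<in>F. scaleC (a n) (v n)))\<^sup>2)"

lemma bessel_seqD:
  "bessel_seq B v J \<Longrightarrow> B > 0"
  "bessel_seq B v J \<Longrightarrow> finite F \<Longrightarrow> F \<subseteq> J \<Longrightarrow>
     (norm (\<Sum>n\<in>F. scaleC (a n) (v n)))\<^sup>2 \<le> B * (\<Sum>n\<in>F. (cmod (a n))\<^sup>2)"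
  by (auto simp: bessel_seq_def)

lemma riesz_seqD:
  "riesz_seq A v J \<Longrightarrow> A > 0"
  "riesz_seq A v J \<Longrightarrow> finite F \<Longrightarrow> F \<subseteq> J \<Longrightarrow>
     A * (\<Sum>n\<in>F. (cmod (a n))\<^sup>2) \<le> (norm (\<Sum>n\<in>F. scaleC (a n) (v n)))\<^sup>2"
  by (auto simp: riesz_seq_def)

lemma bessel_summable:
  fixes v :: "'i \<Rightarrow> 'a::complex_hilbert"
  assumes v: "bessel_seq B v J" and a: "(\<lambda>n. (cmod (a n))\<^sup>2) summable_on J"
  shows "(\<lambda>n. scaleC (a n) (v n)) summable_on J"
proof -
  let ?S = "\<lambda>F. \<Sum>n\<in>F. (cmod (a n))\<^sup>2" and ?f = "\<lambda>n. scaleC (a n) (v n)"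
  have B: "B > 0" using bessel_seqD(1)[OF v] .
  obtain s where "(?S \<longlongrightarrow> s) (finite_subsets_at_top J)"
    using a by (auto simp: summable_on_def has_sum_def)
  then have lim: "\<forall>\<^sub>F F in finite_subsets_at_top J. dist (?S F) s < e" if "e > 0" for e
    using that tendstoD by blast
  have "cauchy_filter (filtermap (sum ?f) (finite_subsets_at_top J))"
    unfolding cauchy_filter_metric_filtermap
  proof (intro allI impI)
    fix e :: real assume e: "e > 0"
    \<comment> \<open>A tail of squared coefficients of mass at most \<open>d\<close> changes the
      vector sum by at most \<open>e / 3\<close>; two such tails stay below
      \<open>e\<close>.\<close>
    define d where "d = e\<^sup>2 / (9 * B)"
    have d: "d > 0" using e B by (simp add: d_def)
    obtain F0 where F0: "finite F0" "F0 \<subseteq> J" "\<And>F. finite F \<Longrightarrow> F0 \<subseteq> F \<Longrightarrow> F \<subseteq> J \<Longrightarrow> dist (?S F) s < d / 2"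
      using lim[of "d / 2"] d unfolding eventually_finite_subsets_at_top by auto
    have near: "norm (sum ?f F - sum ?f F0) \<le> e / 3" if F: "finite F" "F0 \<subseteq> F" "F \<subseteq> J" for F
    proof -
      have "sum ?f F - sum ?f F0 = sum ?f (F - F0)" using F F0 by (simp add: sum_diff)
      moreover have "(norm (sum ?f (F - F0)))\<^sup>2 \<le> B * ?S (F - F0)"
        using F by (intro bessel_seqD(2)[OF v]) auto
      moreover have "?S (F - F0) = ?S F - ?S F0" using F F0 by (simp add: sum_diff)
      moreover have "\<bar>?S F - s\<bar> < d / 2" "\<bar>?S F0 - s\<bar> < d / 2"
        using F0(3)[of F] F0(3)[of F0] F F0 by (auto simp: dist_real_def)
      then have "?S F - ?S F0 \<le> d" by arith
      then have "B * (?S F - ?S F0) \<le> (e / 3)\<^sup>2"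
        using B by (simp add: d_def power_divide field_simps)
      ultimately have "(norm (sum ?f F - sum ?f F0))\<^sup>2 \<le> (e / 3)\<^sup>2" by simp
      then show ?thesis by (rule power2_le_imp_le) (use e in simp)
    qed
    show "\<exists>P. eventually P (finite_subsets_at_top J) \<and> (\<forall>x y. P x \<and> P y \<longrightarrow> dist (sum ?f x) (sum ?f y) < e)"
    proof (intro exI[of _ "\<lambda>F. finite F \<and> F0 \<subseteq> F \<and> F \<subseteq> J"] conjI allI impI)
      show "\<forall>\<^sub>F F in finite_subsets_at_top J. finite F \<and> F0 \<subseteq> F \<and> F \<subseteq> J"
        unfolding eventually_finite_subsets_at_top using F0 by blast
      fix x y assume xy: "(finite x \<and> F0 \<subseteq> x \<and> x \<subseteq> J) \<and> finite y \<and> F0 \<subseteq> y \<and> y \<subseteq> J"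
      have "dist (sum ?f x) (sum ?f y) \<le> norm (sum ?f x - sum ?f F0) + norm (sum ?f y - sum ?f F0)"
        using norm_triangle_ineq4[of "sum ?f x - sum ?f F0" "sum ?f y - sum ?f F0"] by (simp add: dist_norm)
      also have "\<dots> < e" using near[of x] near[of y] xy e by simp
      finally show "dist (sum ?f x) (sum ?f y) < e" .
    qed
  qed
  moreover have "complete (UNIV :: 'a set)" by (rule complete_UNIV)
  ultimately obtain x where "filtermap (sum ?f) (finite_subsets_at_top J) \<le> nhds x"
    using cauchy_filter_complete_converges[of "filtermap (sum ?f) (finite_subsets_at_top J)" UNIV]
    by (auto simp: filtermap_bot_iff)
  then show ?thesis by (auto simp: summable_on_def has_sum_def filterlim_def)
qed

lemma bessel_has_sum_bound:
  assumes v: "bessel_seq B v J" and a: "((\<lambda>n. (cmod (a n))\<^sup>2) has_sum s) J"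
    and f: "((\<lambda>n. scaleC (a n) (v n)) has_sum f) J"
  shows "(norm f)\<^sup>2 \<le> B * s"
proof (rule tendsto_le[OF finite_subsets_at_top_neq_bot])
  show "((\<lambda>F. B * (\<Sum>n\<in>F. (cmod (a n))\<^sup>2)) \<longlongrightarrow> B * s) (finite_subsets_at_top J)"
    using a by (intro tendsto_intros) (simp add: has_sum_def)
  show "((\<lambda>F. (norm (\<Sum>n\<in>F. scaleC (a n) (v n)))\<^sup>2) \<longlongrightarrow> (norm f)\<^sup>2) (finite_subsets_at_top J)"
    using f by (intro tendsto_intros) (simp add: has_sum_def)
  show "\<forall>\<^sub>F F in finite_subsets_at_top J. (norm (\<Sum>n\<in>F. scaleC (a n) (v n)))\<^sup>2 \<le> B * (\<Sum>n\<in>F. (cmod (a n))\<^sup>2)"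
    by (rule eventually_finite_subsets_at_top_weakI) (rule bessel_seqD(2)[OF v])
qed

lemma riesz_has_sum_bound:
  assumes v: "riesz_seq A v J" and a: "((\<lambda>n. (cmod (a n))\<^sup>2) has_sum s) J"
    and f: "((\<lambda>n. scaleC (a n) (v n)) has_sum f) J"
  shows "A * s \<le> (norm f)\<^sup>2"
proof (rule tendsto_le[OF finite_subsets_at_top_neq_bot])
  show "((\<lambda>F. A * (\<Sum>n\<in>F. (cmod (a n))\<^sup>2)) \<longlongrightarrow> A * s) (finite_subsets_at_top J)"
    using a by (intro tendsto_intros) (simp add: has_sum_def)
  show "((\<lambda>F. (norm (\<Sum>n\<in>F. scaleC (a n) (v n)))\<^sup>2) \<longlongrightarrow> (norm f)\<^sup>2) (finite_subsets_at_top J)"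
    using f by (intro tendsto_intros) (simp add: has_sum_def)
  show "\<forall>\<^sub>F F in finite_subsets_at_top J. A * (\<Sum>n\<in>F. (cmod (a n))\<^sup>2) \<le> (norm (\<Sum>n\<in>F. scaleC (a n) (v n)))\<^sup>2"
    by (rule eventually_finite_subsets_at_top_weakI) (rule riesz_seqD(2)[OF v])
qed

text \<open>Square summability of \<open>c\<close> is not known here. The lower bound on those
  finite sums that contain \<open>n\<close> keeps their norms away from 0 unless
  \<open>c n = 0\<close>.\<close>

lemma riesz_unique:
  assumes v: "riesz_seq A v J" and f: "((\<lambda>n. scaleC (c n) (v n)) has_sum 0) J" and n: "n \<in> J"
  shows "c n = 0"
proof -
  have "A * (cmod (c n))\<^sup>2 \<le> (norm (0::'b))\<^sup>2"
  proof (rule tendsto_lowerbound[OF _ _ finite_subsets_at_top_neq_bot])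
    show "((\<lambda>F. (norm (\<Sum>n\<in>F. scaleC (c n) (v n)))\<^sup>2) \<longlongrightarrow> (norm (0::'b))\<^sup>2) (finite_subsets_at_top J)"
      using f by (intro tendsto_intros) (simp add: has_sum_def)
    show "\<forall>\<^sub>F F in finite_subsets_at_top J. A * (cmod (c n))\<^sup>2 \<le> (norm (\<Sum>n\<in>F. scaleC (c n) (v n)))\<^sup>2"
      unfolding eventually_finite_subsets_at_top
    proof (intro exI[of _ "{n}"] conjI allI impI)
      fix F assume F: "finite F \<and> {n} \<subseteq> F \<and> F \<subseteq> J"
      have "(cmod (c n))\<^sup>2 \<le> (\<Sum>n\<in>F. (cmod (c n))\<^sup>2)"
        using F by (intro member_le_sum) auto
      then have "A * (cmod (c n))\<^sup>2 \<le> A * (\<Sum>n\<in>F. (cmod (c n))\<^sup>2)"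
        using riesz_seqD(1)[OF v] by simp
      also have "\<dots> \<le> (norm (\<Sum>n\<in>F. scaleC (c n) (v n)))\<^sup>2" using F by (intro riesz_seqD(2)[OF v]) auto
      finally show "A * (cmod (c n))\<^sup>2 \<le> (norm (\<Sum>n\<in>F. scaleC (c n) (v n)))\<^sup>2" .
    qed (use n in auto)
  qed
  then show ?thesis using riesz_seqD(1)[OF v] by (simp add: mult_le_0_iff)
qed

lemma riesz_basis_for_iff:
  fixes v :: "'i \<Rightarrow> 'a::complex_hilbert"
  shows "riesz_basis_for v J V \<longleftrightarrow> ccspan (v ` J) = V \<and> (\<exists>A B. riesz_seq A v J \<and> bessel_seq B v J)"
proof
  assume R: "riesz_basis_for v J V"
  then obtain A B where AB: "0 < A" "A \<le> B" and b: "\<And>a :: 'i \<Rightarrow> complex. (\<lambda>n. (cmod (a n))\<^sup>2) summable_on J \<Longrightarrow>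
            A * (\<Sum>\<^sub>\<infinity>n\<in>J. (cmod (a n))\<^sup>2) \<le> (norm (\<Sum>\<^sub>\<infinity>n\<in>J. scaleC (a n) (v n)))\<^sup>2 \<and>
            (norm (\<Sum>\<^sub>\<infinity>n\<in>J. scaleC (a n) (v n)))\<^sup>2 \<le> B * (\<Sum>\<^sub>\<infinity>n\<in>J. (cmod (a n))\<^sup>2)"
    unfolding riesz_basis_for_def by blast
  have fin: "A * (\<Sum>n\<in>F. (cmod (a n))\<^sup>2) \<le> (norm (\<Sum>n\<in>F. scaleC (a n) (v n)))\<^sup>2 \<and>
      (norm (\<Sum>n\<in>F. scaleC (a n) (v n)))\<^sup>2 \<le> B * (\<Sum>n\<in>F. (cmod (a n))\<^sup>2)"
    if F: "finite F" "F \<subseteq> J" for F and a :: "'i \<Rightarrow> complex"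
  proof -
    let ?a = "\<lambda>n. if n \<in> F then a n else 0"
    have 1: "((\<lambda>n. (cmod (?a n))\<^sup>2) has_sum (\<Sum>n\<in>F. (cmod (a n))\<^sup>2)) J"
      by (rule has_sum_finite_neutralI[OF F]) auto
    have 2: "((\<lambda>n. scaleC (?a n) (v n)) has_sum (\<Sum>n\<in>F. scaleC (a n) (v n))) J"
      by (rule has_sum_finite_neutralI[OF F]) auto
    show ?thesis using b[of ?a] has_sum_imp_summable[OF 1] unfolding infsumI[OF 1] infsumI[OF 2] by blast
  qed
  then have "riesz_seq A v J" "bessel_seq B v J"
    using AB by (auto simp: riesz_seq_def bessel_seq_def)
  then show "ccspan (v ` J) = V \<and> (\<exists>A B. riesz_seq A v J \<and> bessel_seq B v J)"
    using R by (auto simp: riesz_basis_for_def)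
next
  assume R: "ccspan (v ` J) = V \<and> (\<exists>A B. riesz_seq A v J \<and> bessel_seq B v J)"
  then obtain A B0 where A: "riesz_seq A v J" and B0: "bessel_seq B0 v J" by blast
  \<comment> \<open>The maximum secures \<open>A \<le> B\<close>, which the two bounds do not imply
    when \<open>J\<close> is empty.\<close>
  define B where "B = max A B0"
  have B: "(norm f)\<^sup>2 \<le> B * s" if "((\<lambda>n. (cmod (a n))\<^sup>2) has_sum s) J"
    "((\<lambda>n. scaleC (a n) (v n)) has_sum f) J" for a s f
  proof -
    have "0 \<le> s" using that(1) by (rule has_sum_nonneg) simp
    then have "B0 * s \<le> B * s" by (intro mult_right_mono) (simp_all add: B_def)
    then show ?thesis using bessel_has_sum_bound[OF B0 that] by simp
  qed
  show "riesz_basis_for v J V"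
    unfolding riesz_basis_for_def
  proof (rule conjI, use R in blast, rule exI[of _ A], rule exI[of _ B], intro conjI allI impI)
    fix a :: "'i \<Rightarrow> complex" assume a: "(\<lambda>n. (cmod (a n))\<^sup>2) summable_on J"
    then show s: "(\<lambda>n. scaleC (a n) (v n)) summable_on J" by (rule bessel_summable[OF B0])
    show "A * (\<Sum>\<^sub>\<infinity>n\<in>J. (cmod (a n))\<^sup>2) \<le> (norm (\<Sum>\<^sub>\<infinity>n\<in>J. scaleC (a n) (v n)))\<^sup>2"
      by (rule riesz_has_sum_bound[OF A has_sum_infsum[OF a] has_sum_infsum[OF s]])
    show "(norm (\<Sum>\<^sub>\<infinity>n\<in>J. scaleC (a n) (v n)))\<^sup>2 \<le> B * (\<Sum>\<^sub>\<infinity>n\<in>J. (cmod (a n))\<^sup>2)"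
      by (rule B[OF has_sum_infsum[OF a] has_sum_infsum[OF s]])
  qed (use riesz_seqD(1)[OF A] in \<open>auto simp: B_def\<close>)
qed

lemma riesz_basis_closed: "riesz_basis_for v J V \<Longrightarrow> closed_csubspace V"
  unfolding riesz_basis_for_def using closed_csubspace_ccspan by blast

text \<open>Duality: the synthesis bound is applied to the coefficients
  \<open>cinner (v n) f\<close> themselves. For their square sum \<open>s\<close>, Cauchy-Schwarz
  gives \<open>s * s \<le> s * (B * (norm f)\<^sup>2)\<close>, and \<open>s\<close> is
  cancelled.\<close>

lemma bessel_inequality_finite:
  assumes v: "bessel_seq B v J" and F: "finite F" "F \<subseteq> J"
  shows "(\<Sum>n\<in>F. (cmod (cinner (v n) f))\<^sup>2) \<le> B * (norm f)\<^sup>2"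
proof -
  let ?s = "\<Sum>n\<in>F. (cmod (cinner (v n) f))\<^sup>2" and ?g = "\<Sum>n\<in>F. scaleC (cinner (v n) f) (v n)"
  have s0: "?s \<ge> 0" by (simp add: sum_nonneg)
  have "cinner ?g f = (\<Sum>n\<in>F. cnj (cinner (v n) f) * cinner (v n) f)" by (simp add: cinner_sum_left)
  also have "\<dots> = complex_of_real ?s" by (simp add: complex_norm_square mult.commute del: of_real_power)
  finally have "?s = cmod (cinner ?g f)" using s0 by (simp del: of_real_sum)
  also have "\<dots> \<le> norm ?g * norm f" by (rule cauchy_schwarz)
  finally have "?s\<^sup>2 \<le> (norm ?g * norm f)\<^sup>2" using s0 by (rule power_mono)
  also have "\<dots> \<le> (B * ?s) * (norm f)\<^sup>2"
    unfolding power_mult_distrib by (intro mult_right_mono bessel_seqD(2)[OF v F]) simp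
  finally have "?s * ?s \<le> ?s * (B * (norm f)\<^sup>2)" by (simp add: power2_eq_square mult_ac)
  then show ?thesis using s0 bessel_seqD(1)[OF v] by (cases "?s = 0") (auto simp: mult_le_cancel_left)
qed

lemma bessel_coeff_summable:
  assumes "bessel_seq B v J"
  shows "(\<lambda>n. (cmod (cinner (v n) f))\<^sup>2) summable_on J"
proof (rule nonneg_bdd_above_summable_on)
  show "bdd_above (sum (\<lambda>n. (cmod (cinner (v n) f))\<^sup>2) ` {F. F \<subseteq> J \<and> finite F})"
    by (rule bdd_aboveI2[where M = "B * (norm f)\<^sup>2"]) (simp add: bessel_inequality_finite[OF assms])
qed simp

lemma bessel_inequality:
  assumes "bessel_seq B v J"
  shows "(\<Sum>\<^sub>\<infinity>n\<in>J. (cmod (cinner (v n) f))\<^sup>2) \<le> B * (norm f)\<^sup>2"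
  by (rule infsum_le_finite_sums[OF bessel_coeff_summable[OF assms]])
    (rule bessel_inequality_finite[OF assms])

text \<open>\<open>mixed_op v v J\<close> is the frame operator of \<open>v\<close>.\<close>
definition mixed_op :: "('i \<Rightarrow> 'a::complex_hilbert) \<Rightarrow> ('i \<Rightarrow> 'a) \<Rightarrow> 'i set \<Rightarrow> 'a \<Rightarrow> 'a" where
  "mixed_op v w J f = (\<Sum>\<^sub>\<infinity>n\<in>J. scaleC (cinner (v n) f) (w n))"

context
  fixes v w :: "'i \<Rightarrow> 'a::complex_hilbert" and J B B'
  assumes v: "bessel_seq B v J" and w: "bessel_seq B' w J"
begin

lemma mixed_op_has_sum: "((\<lambda>n. scaleC (cinner (v n) f) (w n)) has_sum mixed_op v w J f) J"
  unfolding mixed_op_def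
  by (rule has_sum_infsum[OF bessel_summable[OF w bessel_coeff_summable[OF v]]])

lemma norm_mixed_op_le: "(norm (mixed_op v w J f))\<^sup>2 \<le> B' * (\<Sum>\<^sub>\<infinity>n\<in>J. (cmod (cinner (v n) f))\<^sup>2)"
  by (rule bessel_has_sum_bound[OF w has_sum_infsum[OF bessel_coeff_summable[OF v]] mixed_op_has_sum])

lemma bclinear_mixed_op: "bclinear (mixed_op v w J)"
proof (rule bclinearI[where C = "sqrt (B' * B)"])
  show "mixed_op v w J (x + y) = mixed_op v w J x + mixed_op v w J y" for x y
    using has_sum_add[OF mixed_op_has_sum[of x] mixed_op_has_sum[of y]] mixed_op_has_sum[of "x + y"]
    by (intro has_sum_unique) (auto simp: cinner_add_right scaleC_add_left)
  show "mixed_op v w J (scaleC a x) = scaleC a (mixed_op v w J x)" for a x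
    using has_sum_bounded_linear[OF bounded_linear_scaleC[of a] mixed_op_has_sum[of x]] mixed_op_has_sum[of "scaleC a x"]
    by (intro has_sum_unique) (auto simp: scaleC_scaleC)
  show "norm (mixed_op v w J f) \<le> sqrt (B' * B) * norm f" for f
  proof (rule power2_le_imp_le)
    have "(norm (mixed_op v w J f))\<^sup>2 \<le> B' * (B * (norm f)\<^sup>2)"
      using bessel_seqD(1)[OF w]
      by (intro order_trans[OF norm_mixed_op_le] mult_left_mono bessel_inequality[OF v]) simp
    then show "(norm (mixed_op v w J f))\<^sup>2 \<le> (sqrt (B' * B) * norm f)\<^sup>2"
      using bessel_seqD(1)[OF w] bessel_seqD(1)[OF v] by (simp add: power_mult_distrib)
  qed (use bessel_seqD(1)[OF w] bessel_seqD(1)[OF v] in simp)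
qed

lemma cinner_mixed_op_has_sum:
  "((\<lambda>n. cinner (v n) f * cinner h (w n)) has_sum cinner h (mixed_op v w J f)) J"
  using has_sum_bounded_linear[OF bounded_linear_cinner_right[of h] mixed_op_has_sum[of f]] by simp

lemma mixed_op_in:
  assumes V: "closed_csubspace V" and n: "\<And>n. n \<in> J \<Longrightarrow> scaleC (cinner (v n) f) (w n) \<in> V"
  shows "mixed_op v w J f \<in> V"
proof -
  have "\<forall>\<^sub>F F in finite_subsets_at_top J. (\<Sum>n\<in>F. scaleC (cinner (v n) f) (w n)) \<in> V"
    by (intro eventually_finite_subsets_at_top_weakI closed_csubspace_sum[OF V] n) auto
  then show ?thesis
    using mixed_op_has_sum[of f] closed_csubspaceD(6)[OF V] unfolding has_sum_def
    by (intro Lim_in_closed_set[where F = "finite_subsets_at_top J"]) auto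
qed

lemma mixed_op_in_ccspan: "mixed_op v w J f \<in> ccspan (w ` J)"
  by (intro mixed_op_in closed_csubspace_ccspan closed_csubspaceD(4) in_ccspan imageI)

text \<open>For a biorthogonal pair, \<open>mixed_op v w J\<close> is the projection onto the closed
  span of \<open>w\<close> along the orthogonal complement of \<open>v\<close>; this lemma and
  \<open>mixed_op_id\<close> express the two halves of that.\<close>

lemma cinner_mixed_op_biorthogonal:
  assumes "biorthogonal v w J" "m \<in> J"
  shows "cinner (v m) (mixed_op v w J f) = cinner (v m) f"
proof (rule has_sum_unique[OF cinner_mixed_op_has_sum])
  show "((\<lambda>n. cinner (v n) f * cinner (v m) (w n)) has_sum cinner (v m) f) J"
    by (rule has_sum_finite_neutralI[where B = "{m}"])
      (use assms in \<open>auto simp: biorthogonal_def\<close>)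
qed

lemma mixed_op_eq_0:
  assumes "\<And>n. n \<in> J \<Longrightarrow> cinner (v n) f = 0"
  shows "mixed_op v w J f = 0"
  unfolding mixed_op_def by (rule infsum_0) (simp add: assms)

lemma mixed_op_biorthogonal:
  assumes "biorthogonal v w J" "m \<in> J"
  shows "mixed_op v w J (w m) = w m"
proof (rule has_sum_unique[OF mixed_op_has_sum])
  show "((\<lambda>n. scaleC (cinner (v n) (w m)) (w n)) has_sum w m) J"
    by (rule has_sum_finite_neutralI[where B = "{m}"])
      (use assms in \<open>auto simp: biorthogonal_def scaleC_one\<close>)
qed

lemma mixed_op_id:
  assumes "biorthogonal v w J" "f \<in> ccspan (w ` J)"
  shows "mixed_op v w J f = f"
  using bclinear_eq_on_ccspan[OF bclinear_mixed_op bclinear_id _ assms(2)] mixed_op_biorthogonal[OF assms(1)]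
  by auto

end

lemma mixed_op_adjoint:
  assumes v: "bessel_seq B v J" and w: "bessel_seq B' w J"
  shows "cinner (mixed_op v w J f) h = cinner f (mixed_op w v J h)"
proof (rule has_sum_unique)
  show "((\<lambda>n. cinner f (v n) * cinner (w n) h) has_sum cinner (mixed_op v w J f) h) J"
    using has_sum_bounded_linear[OF bounded_linear_cnj cinner_mixed_op_has_sum[OF v w, of f h]]
    by (simp flip: cinner_commute)
  show "((\<lambda>n. cinner f (v n) * cinner (w n) h) has_sum cinner f (mixed_op w v J h)) J"
    using cinner_mixed_op_has_sum[OF w v, of h f] by (simp add: mult.commute)
qed

lemma cinner_frame_op:
  assumes v: "bessel_seq B v J"
  shows "cinner f (mixed_op v v J f) = complex_of_real (\<Sum>\<^sub>\<infinity>n\<in>J. (cmod (cinner (v n) f))\<^sup>2)"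
proof (rule has_sum_unique[OF cinner_mixed_op_has_sum[OF v v]])
  have "cinner (v n) f * cinner f (v n) = complex_of_real ((cmod (cinner (v n) f))\<^sup>2)" for n
    unfolding complex_norm_square by (simp flip: cinner_commute)
  then show "((\<lambda>n. cinner (v n) f * cinner f (v n)) has_sum
      complex_of_real (\<Sum>\<^sub>\<infinity>n\<in>J. (cmod (cinner (v n) f))\<^sup>2)) J"
    using has_sum_of_real[OF has_sum_infsum[OF bessel_coeff_summable[OF v, of f]]] by simp
qed

lemma norm_frame_op_le:
  assumes v: "bessel_seq B v J"
  shows "(norm (mixed_op v v J f))\<^sup>2 \<le> B * Re (cinner f (mixed_op v v J f))"
  using norm_mixed_op_le[OF v v, of f] by (simp add: cinner_frame_op[OF v])

lemma cspan_image_finite_sum: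
  assumes "f \<in> cspan (v ` J)"
  shows "\<exists>F a. finite F \<and> F \<subseteq> J \<and> f = (\<Sum>n\<in>F. scaleC (a n) (v n))"
  using assms
proof (induction rule: cvs.span_induct_alt)
  case base
  show ?case by (rule exI[of _ "{}"]) simp
next
  case (step c x y)
  then obtain F a n where F: "finite F" "F \<subseteq> J" "y = (\<Sum>n\<in>F. scaleC (a n) (v n))" and n: "n \<in> J" "x = v n"
    by auto
  \<comment> \<open>The index \<open>n\<close> may already occur in \<open>F\<close>, so
    \<open>c\<close> is added to its old coefficient.\<close>
  define b where "b = (\<lambda>m. (if m \<in> F then a m else 0) + (if m = n then c else 0))"
  have "(\<Sum>m\<in>insert n F. scaleC (b m) (v m)) =
      (\<Sum>m\<in>insert n F. (if m \<in> F then scaleC (a m) (v m) else 0)) +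
      (\<Sum>m\<in>insert n F. (if m = n then scaleC c (v m) else 0))"
    unfolding sum.distrib[symmetric] by (rule sum.cong) (auto simp: b_def scaleC_add_left)
  also have "(\<Sum>m\<in>insert n F. (if m \<in> F then scaleC (a m) (v m) else 0)) = y"
    unfolding F(3) by (rule sum.mono_neutral_cong_right) (use F in auto)
  also have "(\<Sum>m\<in>insert n F. (if m = n then scaleC c (v m) else 0)) = scaleC c x"
    using F n by simp
  finally have "scaleC c x + y = (\<Sum>m\<in>insert n F. scaleC (b m) (v m))" by simp
  then show ?case using F n by (intro exI[of _ "insert n F"] exI[of _ b]) auto
qed

text \<open>A lower Riesz bound is a lower frame bound with the same constant. For a finite sum
  \<open>f\<close> with coefficients \<open>a\<close>, Cauchy-Schwarz bounds the fourth power of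
  \<open>norm f\<close> by the product of the square sums of \<open>a\<close> and of
  \<open>cinner (v n) f\<close>; the Riesz bound absorbs the former. Density does the rest.\<close>

lemma riesz_frame_lower:
  fixes v :: "'i \<Rightarrow> 'a::complex_hilbert"
  assumes A: "riesz_seq A v J" and v: "bessel_seq B v J" and f: "f \<in> ccspan (v ` J)"
  shows "A * (norm f)\<^sup>2 \<le> Re (cinner f (mixed_op v v J f))"
proof -
  let ?D = "mixed_op v v J"
  have A0: "A > 0" using riesz_seqD(1)[OF A] .
  let ?P = "\<lambda>f. A * (norm f)\<^sup>2 \<le> Re (cinner f (?D f))"
  have span: "?P f" if fs: "f \<in> cspan (v ` J)" for f
  proof -
    obtain F a where F: "finite F" "F \<subseteq> J" "f = (\<Sum>n\<in>F. scaleC (a n) (v n))"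
      using cspan_image_finite_sum[OF fs] by blast
    let ?s = "\<Sum>n\<in>F. (cmod (a n))\<^sup>2" and ?t = "\<Sum>n\<in>F. (cmod (cinner (v n) f))\<^sup>2"
    have "complex_of_real ((norm f)\<^sup>2) = cinner f (\<Sum>n\<in>F. scaleC (a n) (v n))"
      using F(3) cinner_self_norm by metis
    also have "\<dots> = (\<Sum>n\<in>F. a n * cinner f (v n))" by (simp add: cinner_sum_right)
    finally have "(norm f)\<^sup>2 = cmod (\<Sum>n\<in>F. a n * cinner f (v n))"
      by (metis abs_of_nonneg norm_of_real zero_le_power2)
    also have "\<dots> \<le> (\<Sum>n\<in>F. cmod (a n) * cmod (cinner (v n) f))"
      by (rule order_trans[OF norm_sum]) (simp add: norm_mult cmod_cinner_commute)
    finally have "((norm f)\<^sup>2)\<^sup>2 \<le> (\<Sum>n\<in>F. cmod (a n) * cmod (cinner (v n) f))\<^sup>2"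
      by (rule power_mono) simp
    also have "\<dots> \<le> ?s * ?t" by (rule Cauchy_Schwarz_ineq_sum)
    finally have "A * ((norm f)\<^sup>2)\<^sup>2 \<le> (A * ?s) * ?t" using A0 by simp
    also have "\<dots> \<le> (norm f)\<^sup>2 * ?t"
      using riesz_seqD(2)[OF A F(1,2), of a] F(3) by (intro mult_right_mono) (auto intro: sum_nonneg)
    finally have "(norm f)\<^sup>2 * (A * (norm f)\<^sup>2) \<le> (norm f)\<^sup>2 * ?t" by (simp add: power2_eq_square mult_ac)
    then have "A * (norm f)\<^sup>2 \<le> ?t" 
      by (cases "f = 0") (auto simp: mult_le_cancel_left intro: sum_nonneg)
    also have "\<dots> \<le> (\<Sum>\<^sub>\<infinity>n\<in>J. (cmod (cinner (v n) f))\<^sup>2)"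
      by (rule finite_sum_le_infsum) (use F bessel_coeff_summable[OF v] in auto)
    finally show ?thesis by (simp add: cinner_frame_op[OF v])
  qed
  obtain u where u: "\<And>n. u n \<in> cspan (v ` J)" "u \<longlonglongrightarrow> f"
    using f unfolding ccspan_def closure_sequential by blast
  have "(\<lambda>n. ?D (u n)) \<longlonglongrightarrow> ?D f"
    by (rule bounded_linear.tendsto[OF bclinear_bounded_linear[OF bclinear_mixed_op[OF v v]] u(2)])
  then have "(\<lambda>n. Re (cinner (u n) (?D (u n)))) \<longlonglongrightarrow> Re (cinner f (?D f))"
    using u(2) by (intro tendsto_intros)
  moreover have "(\<lambda>n. A * (norm (u n))\<^sup>2) \<longlonglongrightarrow> A * (norm f)\<^sup>2" using u(2) by (intro tendsto_intros)
  ultimately show ?thesis using span u(1) by (intro LIMSEQ_le) auto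
qed

lemma riesz_seq_compare:
  assumes A: "riesz_seq A v J" and c: "c > 0" and le: "\<And>F a. finite F \<Longrightarrow> F \<subseteq> J \<Longrightarrow>
    c * norm (\<Sum>n\<in>F. scaleC (a n) (v n)) \<le> norm (\<Sum>n\<in>F. scaleC (a n) (w n))"
  shows "riesz_seq (c\<^sup>2 * A) w J"
  unfolding riesz_seq_def
proof (intro conjI allI impI)
  fix F and a :: "_ \<Rightarrow> complex" assume F: "finite F \<and> F \<subseteq> J"
  let ?f = "\<Sum>n\<in>F. scaleC (a n) (v n)"
  have "c\<^sup>2 * (A * (\<Sum>n\<in>F. (cmod (a n))\<^sup>2)) \<le> c\<^sup>2 * (norm ?f)\<^sup>2"
    using F by (intro mult_left_mono riesz_seqD(2)[OF A]) auto
  also have "\<dots> = (c * norm ?f)\<^sup>2" by (simp add: power_mult_distrib)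
  also have "\<dots> \<le> (norm (\<Sum>n\<in>F. scaleC (a n) (w n)))\<^sup>2" using c le F by (intro power_mono) auto
  finally show "c\<^sup>2 * A * (\<Sum>n\<in>F. (cmod (a n))\<^sup>2) \<le> (norm (\<Sum>n\<in>F. scaleC (a n) (w n)))\<^sup>2"
    by (simp add: mult.assoc)
qed (use c riesz_seqD(1)[OF A] in simp)

lemma bessel_seq_compare:
  assumes B: "bessel_seq B v J" and c: "c > 0" and le: "\<And>F a. finite F \<Longrightarrow> F \<subseteq> J \<Longrightarrow>
    norm (\<Sum>n\<in>F. scaleC (a n) (w n)) \<le> c * norm (\<Sum>n\<in>F. scaleC (a n) (v n))"
  shows "bessel_seq (c\<^sup>2 * B) w J"
  unfolding bessel_seq_def
proof (intro conjI allI impI)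
  fix F and a :: "_ \<Rightarrow> complex" assume F: "finite F \<and> F \<subseteq> J"
  let ?f = "\<Sum>n\<in>F. scaleC (a n) (v n)"
  have "(norm (\<Sum>n\<in>F. scaleC (a n) (w n)))\<^sup>2 \<le> (c * norm ?f)\<^sup>2" using le F by (intro power_mono) auto
  also have "\<dots> = c\<^sup>2 * (norm ?f)\<^sup>2" by (simp add: power_mult_distrib)
  also have "\<dots> \<le> c\<^sup>2 * (B * (\<Sum>n\<in>F. (cmod (a n))\<^sup>2))"
    using F by (intro mult_left_mono bessel_seqD(2)[OF B]) auto
  finally show "(norm (\<Sum>n\<in>F. scaleC (a n) (w n)))\<^sup>2 \<le> c\<^sup>2 * B * (\<Sum>n\<in>F. (cmod (a n))\<^sup>2)"
    by (simp add: mult.assoc)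
qed (use c bessel_seqD(1)[OF B] in simp)

lemma riesz_basis_transfer:
  fixes v :: "'i \<Rightarrow> 'a::complex_hilbert"
  assumes R: "riesz_basis_for v J V" and T: "bclinear T"
    and c: "c > 0" "\<And>f. f \<in> V \<Longrightarrow> c * norm f \<le> norm (T f)"
  shows "riesz_basis_for (\<lambda>n. T (v n)) J (T ` V)"
proof -
  obtain A B where A: "riesz_seq A v J" and B: "bessel_seq B v J" and V: "ccspan (v ` J) = V"
    using R unfolding riesz_basis_for_iff by blast
  obtain C where C: "C > 0" "\<And>f. norm (T f) \<le> C * norm f" using bclinear_bounded[OF T] by blast
  have Tsum: "(\<Sum>n\<in>F. scaleC (a n) (T (v n))) = T (\<Sum>n\<in>F. scaleC (a n) (v n))" for F a
    by (simp add: bclinear_sum[OF T] bclinear_scaleC[OF T])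
  have in_V: "(\<Sum>n\<in>F. scaleC (a n) (v n)) \<in> V" if F: "F \<subseteq> J" for F a
    unfolding V[symmetric]
    by (intro closed_csubspace_sum closed_csubspaceD(4) closed_csubspace_ccspan in_ccspan imageI) (use F in auto)
  have "riesz_seq (c\<^sup>2 * A) (\<lambda>n. T (v n)) J"
    by (rule riesz_seq_compare[OF A c(1)]) (simp add: Tsum c(2) in_V)
  moreover have "bessel_seq (C\<^sup>2 * B) (\<lambda>n. T (v n)) J"
    by (rule bessel_seq_compare[OF B C(1)]) (simp add: Tsum C(2))
  moreover have "ccspan ((\<lambda>n. T (v n)) ` J) = T ` V"
    using image_ccspan[OF T c(1), of "v ` J"] c(2) V by (simp add: image_image)
  ultimately show ?thesis unfolding riesz_basis_for_iff by blast
qed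

section \<open>Biorthogonal and orthonormal families, Parseval's identity and dual bases\<close>

lemma biorthogonalD:
  "biorthogonal v w J \<Longrightarrow> n \<in> J \<Longrightarrow> m \<in> J \<Longrightarrow> cinner (v n) (w m) = (if n = m then 1 else 0)"
  by (simp add: biorthogonal_def)

lemma biorthogonal_sym:
  assumes "biorthogonal v w J" shows "biorthogonal w v J"
  unfolding biorthogonal_def
proof (intro ballI)
  fix n m assume "n \<in> J" "m \<in> J"
  then show "cinner (w n) (v m) = (if n = m then 1 else 0)"
    using biorthogonalD[OF assms, of m n] cinner_commute[of "w n" "v m"] by auto
qed

lemma riesz_seq_reindex:
  assumes v: "riesz_seq A v J" and \<phi>: "inj_on \<phi> J'" "\<phi> ` J' \<subseteq> J"
  shows "riesz_seq A (\<lambda>n. v (\<phi> n)) J'"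
  unfolding riesz_seq_def
proof (intro conjI allI impI)
  fix F and a :: "_ \<Rightarrow> complex" assume F: "finite F \<and> F \<subseteq> J'"
  have inj: "inj_on \<phi> F" using \<phi>(1) F inj_on_subset by blast
  let ?b = "\<lambda>m. a (the_inv_into F \<phi> m)"
  have "A * (\<Sum>n\<in>\<phi> ` F. (cmod (?b n))\<^sup>2) \<le> (norm (\<Sum>n\<in>\<phi> ` F. scaleC (?b n) (v n)))\<^sup>2"
    using F \<phi>(2) by (intro riesz_seqD(2)[OF v]) auto
  then show "A * (\<Sum>n\<in>F. (cmod (a n))\<^sup>2) \<le> (norm (\<Sum>n\<in>F. scaleC (a n) (v (\<phi> n))))\<^sup>2"
    by (simp add: sum.reindex[OF inj] the_inv_into_f_f[OF inj])
qed (rule riesz_seqD(1)[OF v])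

lemma bessel_seq_reindex:
  assumes v: "bessel_seq B v J" and \<phi>: "inj_on \<phi> J'" "\<phi> ` J' \<subseteq> J"
  shows "bessel_seq B (\<lambda>n. v (\<phi> n)) J'"
  unfolding bessel_seq_def
proof (intro conjI allI impI)
  fix F and a :: "_ \<Rightarrow> complex" assume F: "finite F \<and> F \<subseteq> J'"
  have inj: "inj_on \<phi> F" using \<phi>(1) F inj_on_subset by blast
  let ?b = "\<lambda>m. a (the_inv_into F \<phi> m)"
  have "(norm (\<Sum>n\<in>\<phi> ` F. scaleC (?b n) (v n)))\<^sup>2 \<le> B * (\<Sum>n\<in>\<phi> ` F. (cmod (?b n))\<^sup>2)"
    using F \<phi>(2) by (intro bessel_seqD(2)[OF v]) auto
  then show "(norm (\<Sum>n\<in>F. scaleC (a n) (v (\<phi> n))))\<^sup>2 \<le> B * (\<Sum>n\<in>F. (cmod (a n))\<^sup>2)"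
    by (simp add: sum.reindex[OF inj] the_inv_into_f_f[OF inj])
qed (rule bessel_seqD(1)[OF v])

lemma orthonormal_norm_sum:
  assumes o: "biorthogonal v v J" and F: "finite F" "F \<subseteq> J"
  shows "(norm (\<Sum>n\<in>F. scaleC (a n) (v n)))\<^sup>2 = (\<Sum>n\<in>F. (cmod (a n))\<^sup>2)"
proof -
  let ?f = "\<Sum>n\<in>F. scaleC (a n) (v n)"
  have inn: "cinner (v m) ?f = a m" if m: "m \<in> F" for m
  proof -
    have "cinner (v m) ?f = (\<Sum>n\<in>F. if n = m then a n else 0)"
      unfolding cinner_sum_right
      by (rule sum.cong) (use m F in \<open>auto simp: biorthogonalD[OF o] subset_iff\<close>)
    then show ?thesis using m F by simp
  qed
  have "cinner ?f ?f = (\<Sum>n\<in>F. cnj (a n) * cinner (v n) ?f)"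
    using cinner_sum_left[of "\<lambda>n. scaleC (a n) (v n)" F ?f] by simp
  also have "\<dots> = (\<Sum>n\<in>F. complex_of_real ((cmod (a n))\<^sup>2))"
    by (rule sum.cong) (simp_all add: inn complex_norm_square mult.commute del: of_real_power)
  finally have "complex_of_real ((norm ?f)\<^sup>2) = complex_of_real (\<Sum>n\<in>F. (cmod (a n))\<^sup>2)"
    by (simp add: cinner_self_norm)
  then show ?thesis by (simp only: of_real_eq_iff)
qed

lemma orthonormal_bessel: "biorthogonal v v J \<Longrightarrow> bessel_seq 1 v J"
  and orthonormal_riesz: "biorthogonal v v J \<Longrightarrow> riesz_seq 1 v J"
  by (simp_all add: bessel_seq_def riesz_seq_def orthonormal_norm_sum)

lemma parseval:
  fixes v :: "'i \<Rightarrow> 'a::complex_hilbert"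
  assumes o: "biorthogonal v v J" and f: "f \<in> ccspan (v ` J)"
  shows "((\<lambda>n. (cmod (cinner (v n) f))\<^sup>2) has_sum (norm f)\<^sup>2) J"
proof -
  note b = orthonormal_bessel[OF o]
  have "complex_of_real ((norm f)\<^sup>2) = cinner f (mixed_op v v J f)"
    by (simp add: mixed_op_id[OF b b o f] cinner_self_norm)
  also have "\<dots> = complex_of_real (\<Sum>\<^sub>\<infinity>n\<in>J. (cmod (cinner (v n) f))\<^sup>2)"
    by (rule cinner_frame_op[OF b])
  finally have "(norm f)\<^sup>2 = (\<Sum>\<^sub>\<infinity>n\<in>J. (cmod (cinner (v n) f))\<^sup>2)" by (simp only: of_real_eq_iff)
  then show ?thesis using has_sum_infsum[OF bessel_coeff_summable[OF b]] by metis
qed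

text \<open>The frame operator is invertible on \<open>V\<close>, so \<open>u\<close> is the
  canonical dual family. Biorthogonality holds because the frame operator at \<open>u m\<close>
  expands \<open>v m\<close> with coefficients \<open>cinner (v k) (u m)\<close>, and coefficients
  in a Riesz sequence are unique.\<close>

lemma
  fixes v :: "'i \<Rightarrow> 'a::complex_hilbert"
  assumes R: "riesz_basis_for v J V"
  shows frame_op_lower: "\<exists>c>0. \<forall>f\<in>V. c * norm f \<le> norm (mixed_op v v J f)"
    and frame_op_image: "mixed_op v v J ` V = V"
    and dual_riesz_basis: "(\<And>n. n \<in> J \<Longrightarrow> u n \<in> V \<and> mixed_op v v J (u n) = v n) \<Longrightarrow>
      biorthogonal v u J \<and> riesz_basis_for u J V"
proof -
  define D where "D = mixed_op v v J"
  obtain A B where A: "riesz_seq A v J" and B: "bessel_seq B v J" and Vs: "ccspan (v ` J) = V"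
    using R unfolding riesz_basis_for_iff by blast
  have V: "closed_csubspace V" using closed_csubspace_ccspan Vs by blast
  have A0: "A > 0" using riesz_seqD(1)[OF A] .
  have bD: "bclinear D" unfolding D_def by (rule bclinear_mixed_op[OF B B])
  have sa: "cinner (D f) h = cinner f (D h)" for f h unfolding D_def by (rule mixed_op_adjoint[OF B B])
  have DV: "D f \<in> V" for f unfolding D_def Vs[symmetric] by (rule mixed_op_in_ccspan[OF B B])
  have low: "A * norm f \<le> norm (D f)" if "f \<in> V" for f
  proof -
    have "A * (norm f)\<^sup>2 \<le> Re (cinner f (D f))" using riesz_frame_lower[OF A B] that Vs unfolding D_def by blast
    also have "\<dots> \<le> norm f * norm (D f)" using cauchy_schwarz complex_Re_le_cmod order_trans by blast
    finally have "norm f * (A * norm f) \<le> norm f * norm (D f)" by (simp add: power2_eq_square mult_ac)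
    then show ?thesis by (cases "f = 0") (auto simp: mult_le_cancel_left)
  qed
  have DVV: "D ` V = V" by (rule selfadjoint_image_eq[OF bD sa V DV A0 low])
  show "\<exists>c>0. \<forall>f\<in>V. c * norm f \<le> norm (mixed_op v v J f)" "mixed_op v v J ` V = V"
    using A0 low DVV unfolding D_def by blast+
  show "biorthogonal v u J \<and> riesz_basis_for u J V" if "\<And>n. n \<in> J \<Longrightarrow> u n \<in> V \<and> mixed_op v v J (u n) = v n"
  proof -
    have u: "u n \<in> V \<and> D (u n) = v n" if "n \<in> J" for n
      using \<open>\<And>n. n \<in> J \<Longrightarrow> u n \<in> V \<and> mixed_op v v J (u n) = v n\<close>[OF that] by (simp add: D_def)
    show ?thesis
    proof
      show "biorthogonal v u J"
        unfolding biorthogonal_def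
      proof (intro ballI)
        fix n m assume n: "n \<in> J" and m: "m \<in> J"
        have 1: "((\<lambda>k. scaleC (cinner (v k) (u m)) (v k)) has_sum v m) J"
          using mixed_op_has_sum[OF B B, of "u m"] u[OF m] by (simp add: D_def)
        have 2: "((\<lambda>k. scaleC (- (if k = m then 1 else 0)) (v k)) has_sum - v m) J"
          by (rule has_sum_finite_neutralI[where B = "{m}"]) (use m in \<open>auto simp: scaleC_one\<close>)
        have "((\<lambda>k. scaleC (cinner (v k) (u m) - (if k = m then 1 else 0)) (v k)) has_sum 0) J"
          using has_sum_add[OF 1 2] by (simp add: cvs.scale_left_diff_distrib)
        from riesz_unique[OF A this n] show "cinner (v n) (u m) = (if n = m then 1 else 0)" by simp
      qed
      have uV: "(\<Sum>n\<in>F. scaleC (a n) (u n)) \<in> V" if "F \<subseteq> J" for F a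
        using that u by (intro closed_csubspace_sum[OF V] closed_csubspaceD(4)[OF V]) auto
      have Dsum: "D (\<Sum>n\<in>F. scaleC (a n) (u n)) = (\<Sum>n\<in>F. scaleC (a n) (v n))" if "F \<subseteq> J" for F a
        using that u by (auto simp: bclinear_sum[OF bD] bclinear_scaleC[OF bD] intro!: sum.cong)
      obtain C where C: "C > 0" "\<And>f. norm (D f) \<le> C * norm f" using bclinear_bounded[OF bD] by blast
      \<comment> \<open>\<open>D\<close> maps finite sums of \<open>u\<close> to the same sums of
        \<open>v\<close>: its upper bound yields the lower bound for \<open>u\<close>, and its lower
        bound the upper one.\<close>
      have "riesz_seq ((1 / C)\<^sup>2 * A) u J"
      proof (rule riesz_seq_compare[OF A])
        show "1 / C * norm (\<Sum>n\<in>F. scaleC (a n) (v n)) \<le> norm (\<Sum>n\<in>F. scaleC (a n) (u n))" if "F \<subseteq> J" for F a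
          using C(2)[of "\<Sum>n\<in>F. scaleC (a n) (u n)"] C(1) Dsum[OF that] by (simp add: divide_le_eq mult.commute)
      qed (use C(1) in simp)
      moreover have "bessel_seq ((1 / A)\<^sup>2 * B) u J"
      proof (rule bessel_seq_compare[OF B])
        show "norm (\<Sum>n\<in>F. scaleC (a n) (u n)) \<le> 1 / A * norm (\<Sum>n\<in>F. scaleC (a n) (v n))" if "F \<subseteq> J" for F a
          using low[OF uV[OF that]] A0 by (simp add: Dsum[OF that] le_divide_eq mult.commute)
      qed (use A0 in simp)
      moreover have "ccspan (u ` J) = V"
      proof (rule ccspan_eqI_orth[OF V])
        fix f assume f: "f \<in> V" "\<And>s. s \<in> u ` J \<Longrightarrow> cinner s f = 0"
        obtain e where e: "e \<in> V" "f = D e" using f(1) DVV by blast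
        have "cinner (v n) e = 0" if "n \<in> J" for n
          using f(2)[of "u n"] u[OF that] that e(2) by (metis imageI sa)
        then have "e \<in> orth_compl (ccspan (v ` J))" by (simp add: orth_compl_ccspan) (auto simp: orth_compl_def)
        then have "cinner e e = 0" using e Vs orth_complD by blast
        then show "f = 0" using e bD by simp
      qed (use u in auto)
      ultimately show "riesz_basis_for u J V" unfolding riesz_basis_for_iff by blast
    qed
  qed
qed

section \<open>Groups of unitary operators\<close>

definition G_invariant :: "('a \<Rightarrow> 'a) set \<Rightarrow> 'a set \<Rightarrow> bool" where
  "G_invariant G V \<longleftrightarrow> (\<forall>g\<in>G. \<forall>f\<in>V. g f \<in> V)"

definition G_commutes :: "('a \<Rightarrow> 'a) set \<Rightarrow> ('a \<Rightarrow> 'a) \<Rightarrow> bool" where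
  "G_commutes G T \<longleftrightarrow> (\<forall>g\<in>G. \<forall>f. T (g f) = g (T f))"

text \<open>The operator is carried together with its adjoint, so that closure of the commutant
  under adjoints is just \<open>commutant_pair_sym\<close>.\<close>

definition commutant_pair :: "('a::complex_inner \<Rightarrow> 'a) set \<Rightarrow> ('a \<Rightarrow> 'a) \<Rightarrow> ('a \<Rightarrow> 'a) \<Rightarrow> bool" where
  "commutant_pair G T T' \<longleftrightarrow> bclinear T \<and> bclinear T' \<and> G_commutes G T \<and> G_commutes G T' \<and>
     (\<forall>f h. cinner (T f) h = cinner f (T' h))"

lemma commutant_pairD:
  assumes "commutant_pair G T T'"
  shows "bclinear T" "bclinear T'" "G_commutes G T" "G_commutes G T'"
    "cinner (T f) h = cinner f (T' h)" "cinner (T' f) h = cinner f (T h)"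
proof -
  show "cinner (T' f) h = cinner f (T h)"
    using assms cinner_commute[of "T' f" h] cinner_commute[of f "T h"] by (simp add: commutant_pair_def)
qed (use assms in \<open>auto simp: commutant_pair_def\<close>)

lemma commutant_pair_sym: "commutant_pair G T T' \<Longrightarrow> commutant_pair G T' T"
  unfolding commutant_pair_def[of G T' T] using commutant_pairD(1-4,6)[of G T T'] by blast

lemma commutant_pair_compose:
  assumes "commutant_pair G S S'" "commutant_pair G T T'"
  shows "commutant_pair G (\<lambda>f. S (T f)) (\<lambda>f. T' (S' f))"
  using assms unfolding commutant_pair_def G_commutes_def by (auto intro: bclinear_compose)

lemma commutant_pair_id: "commutant_pair G (\<lambda>f. f) (\<lambda>f. f)"
  by (simp add: commutant_pair_def bclinear_id G_commutes_def)

lemma G_commutesD: "G_commutes G T \<Longrightarrow> g \<in> G \<Longrightarrow> T (g f) = g (T f)"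
  by (simp add: G_commutes_def)

lemma G_invariantD: "G_invariant G V \<Longrightarrow> g \<in> G \<Longrightarrow> f \<in> V \<Longrightarrow> g f \<in> V"
  by (simp add: G_invariant_def)

context
  fixes G :: "('a::complex_hilbert \<Rightarrow> 'a) set"
  assumes G: "unitary_group G"
begin

lemma G_id: "id \<in> G" and G_comp: "g \<in> G \<Longrightarrow> h \<in> G \<Longrightarrow> g \<circ> h \<in> G"
  and G_inv: "g \<in> G \<Longrightarrow> inv g \<in> G" and G_unitary: "g \<in> G \<Longrightarrow> unitary g"
  using G by (auto simp: unitary_group_def)

lemma G_cinner: "g \<in> G \<Longrightarrow> cinner (g x) (g y) = cinner x y"
  using G_unitary by (auto simp: unitary_def)

lemma G_norm: "g \<in> G \<Longrightarrow> norm (g x) = norm x"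
  using G_cinner[of g x x] by (metis Re_cinner_self norm_ge_zero power2_eq_iff_nonneg)

lemma G_bclinear: "g \<in> G \<Longrightarrow> bclinear g"
  using G_unitary[of g] G_norm[of g] unfolding bclinear_def unitary_def
  by (intro conjI exI[of _ 1]) auto

lemma G_bij: "g \<in> G \<Longrightarrow> bij g"
proof -
  assume g: "g \<in> G"
  have "inj g"
  proof (rule injI)
    fix x y assume "g x = g y"
    then have "norm (g (x - y)) = 0" using bclinear_diff[OF G_bclinear[OF g]] by simp
    then show "x = y" by (simp add: G_norm[OF g])
  qed
  then show ?thesis using G_unitary[OF g] by (simp add: unitary_def bij_def)
qed

lemma G_inv_apply [simp]: "g \<in> G \<Longrightarrow> g (inv g x) = x" "g \<in> G \<Longrightarrow> inv g (g x) = x"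
  using G_bij[of g] by (simp_all add: bij_def surj_f_inv_f)

lemma G_cinner_left: "g \<in> G \<Longrightarrow> cinner (g x) y = cinner x (inv g y)"
  using G_cinner[of g x "inv g y"] by simp

lemma G_cinner_right: "g \<in> G \<Longrightarrow> cinner x (g y) = cinner (inv g x) y"
  using G_cinner[of g "inv g x" y] by simp

lemma G_inv_inv: "g \<in> G \<Longrightarrow> inv (inv g) = g"
  by (simp add: G_bij inv_inv_eq)

lemma G_invariant_orth_compl:
  assumes "G_invariant G V"
  shows "G_invariant G (orth_compl V)"
  unfolding G_invariant_def orth_compl_def
  using assms G_inv by (auto simp: G_cinner_right G_invariant_def)

lemma G_invariant_Int: "G_invariant G V \<Longrightarrow> G_invariant G W \<Longrightarrow> G_invariant G (V \<inter> W)"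
  by (auto simp: G_invariant_def)

lemma G_invariant_ccspan:
  assumes "\<And>g x. g \<in> G \<Longrightarrow> x \<in> X \<Longrightarrow> g x \<in> X"
  shows "G_invariant G (ccspan X)"
  unfolding G_invariant_def
proof (intro ballI)
  fix g f assume g: "g \<in> G" and f: "f \<in> ccspan X"
  show "g f \<in> ccspan X"
    by (rule bclinear_image_ccspan_subset[OF G_bclinear[OF g] _ closed_csubspace_ccspan f])
      (rule in_ccspan[OF assms[OF g]])
qed

lemma gfam_G:
  assumes "g \<in> G" "n \<in> G \<times> J"
  shows "g (gfam x n) \<in> gfam x ` (G \<times> J)"
proof -
  obtain h j where n: "n = (h, j)" "h \<in> G" "j \<in> J" using assms(2) by auto
  then have "g (gfam x n) = gfam x (g \<circ> h, j)" by (simp add: gfam_def)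
  then show ?thesis using n assms(1) G_comp by blast
qed

lemma G_invariant_gfam: "G_invariant G (ccspan (gfam x ` (G \<times> J)))"
  by (rule G_invariant_ccspan) (auto intro: gfam_G)

lemma riesz_basis_G_invariant: "riesz_basis_for (gfam x) (G \<times> J) V \<Longrightarrow> G_invariant G V"
  unfolding riesz_basis_for_def using G_invariant_gfam by blast

lemma gfam_in: "j \<in> J \<Longrightarrow> x j \<in> gfam x ` (G \<times> J)"
  using G_id by (intro image_eqI[of _ _ "(id, j)"]) (auto simp: gfam_def)

lemma gfam_subset:
  assumes "G_invariant G V" "\<And>j. j \<in> J \<Longrightarrow> x j \<in> V"
  shows "gfam x ` (G \<times> J) \<subseteq> V"
  using assms by (auto simp: gfam_def G_invariant_def)

lemma proj_commutes:
  assumes V: "closed_csubspace V" "G_invariant G V"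
  shows "G_commutes G (proj V)"
  unfolding G_commutes_def
proof (intro ballI allI)
  fix g f assume g: "g \<in> G"
  show "proj V (g f) = g (proj V f)"
  proof (rule proj_eqI[OF V(1)])
    show "g (proj V f) \<in> V" using V g proj_in by (auto simp: G_invariant_def)
    have "g (f - proj V f) \<in> orth_compl V"
      using G_invariant_orth_compl[OF V(2)] proj_orth[OF V(1)] g by (auto simp: G_invariant_def)
    then show "g f - g (proj V f) \<in> orth_compl V" by (simp add: bclinear_diff[OF G_bclinear[OF g]])
  qed
qed

lemma commutant_pair_proj:
  assumes "closed_csubspace V" "G_invariant G V"
  shows "commutant_pair G (proj V) (proj V)"
  using assms by (simp add: commutant_pair_def bclinear_proj proj_commutes cinner_proj)

lemma gfam_comp_reindex:
  assumes "g \<in> G"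
  shows "bij_betw (\<lambda>(h, j). (g \<circ> h, j)) (G \<times> J) (G \<times> J)"
proof (rule bij_betw_byWitness[where f' = "\<lambda>(h, j). (inv g \<circ> h, j)"])
  show "\<forall>a\<in>G \<times> J. (\<lambda>(h, j). (inv g \<circ> h, j)) ((\<lambda>(h, j). (g \<circ> h, j)) a) = a"
    "\<forall>a\<in>G \<times> J. (\<lambda>(h, j). (g \<circ> h, j)) ((\<lambda>(h, j). (inv g \<circ> h, j)) a) = a"
    using assms by (auto simp: fun_eq_iff)
qed (use assms G_comp G_inv in auto)

text \<open>Left translation by \<open>g\<close> permutes \<open>G \<times> J\<close>, and unitarity
  absorbs it in the coefficients.\<close>

lemma mixed_op_commutes:
  assumes v: "bessel_seq B (gfam x) (G \<times> J)" and w: "bessel_seq B' (gfam y) (G \<times> J)"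
  shows "G_commutes G (mixed_op (gfam x) (gfam y) (G \<times> J))"
  unfolding G_commutes_def
proof (intro ballI allI)
  fix g f assume g: "g \<in> G"
  let ?R = "mixed_op (gfam x) (gfam y) (G \<times> J)" and ?c = "\<lambda>(h, j). (g \<circ> h, j)"
  have "((\<lambda>n. g (scaleC (cinner (gfam x n) f) (gfam y n))) has_sum g (?R f)) (G \<times> J)"
    by (rule has_sum_bounded_linear[OF bclinear_bounded_linear[OF G_bclinear[OF g]] mixed_op_has_sum[OF v w]])
  also have "?this \<longleftrightarrow> ((\<lambda>n. scaleC (cinner (gfam x (?c n)) (g f)) (gfam y (?c n))) has_sum g (?R f)) (G \<times> J)"
    by (rule has_sum_cong) (auto simp: gfam_def G_cinner[OF g] bclinear_scaleC[OF G_bclinear[OF g]])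
  also have "\<dots> \<longleftrightarrow> ((\<lambda>n. scaleC (cinner (gfam x n) (g f)) (gfam y n)) has_sum g (?R f)) (G \<times> J)"
    by (rule has_sum_reindex_bij_betw[OF gfam_comp_reindex[OF g], of "\<lambda>n. scaleC (cinner (gfam x n) (g f)) (gfam y n)"])
  finally show "?R (g f) = g (?R f)" by (rule has_sum_unique[OF mixed_op_has_sum[OF v w]])
qed

text \<open>Unitarity moves both group elements to one side, so only the untranslated
  \<open>x i\<close> has to be tested against translates of \<open>y j\<close>.\<close>

lemma biorthogonal_gfamI:
  assumes "\<And>g i j. g \<in> G \<Longrightarrow> i \<in> J \<Longrightarrow> j \<in> J \<Longrightarrow> cinner (x i) (g (y j)) = (if g = id \<and> i = j then 1 else 0)"
  shows "biorthogonal (gfam x) (gfam y) (G \<times> J)"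
  unfolding biorthogonal_def
proof (intro ballI)
  fix n m assume "n \<in> G \<times> J" "m \<in> G \<times> J"
  then obtain g i h j where n: "n = (g, i)" "g \<in> G" "i \<in> J" and m: "m = (h, j)" "h \<in> G" "j \<in> J" by auto
  have "inv g \<circ> h = id \<longleftrightarrow> g = h" using n m by (metis G_inv_apply(1) comp_apply ext id_apply G_inv_apply(2))
  then show "cinner (gfam x n) (gfam y m) = (if n = m then 1 else 0)"
    using assms[of "inv g \<circ> h" i j] n m G_inv G_comp by (simp add: gfam_def G_cinner_left)
qed

lemma biorthogonal_gfamD:
  assumes "biorthogonal (gfam x) (gfam y) (G \<times> J)" "g \<in> G" "i \<in> J" "j \<in> J"
  shows "cinner (x i) (g (y j)) = (if g = id \<and> i = j then 1 else 0)"
  using biorthogonalD[OF assms(1), of "(id, i)" "(g, j)"] assms(2-) G_id by (auto simp: gfam_def)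

section \<open>The trace identity\<close>

text \<open>Substituting \<open>inv g\<close> for \<open>g\<close> moves the group element from one
  vector to the other. This symmetry is the source of the trace property.\<close>

lemma infsum_orbit_swap:
  "(\<Sum>\<^sub>\<infinity>g\<in>G. (cmod (cinner (g a) b))\<^sup>2) = (\<Sum>\<^sub>\<infinity>g\<in>G. (cmod (cinner (g b) a))\<^sup>2)"
proof (rule infsum_reindex_bij_witness[where i = inv and j = inv])
  show "(cmod (cinner (inv g b) a))\<^sup>2 = (cmod (cinner (g a) b))\<^sup>2" if "g \<in> G" for g
    using that by (simp add: G_cinner_left cmod_cinner_commute[of "inv g b"])
qed (auto simp: G_inv G_inv_inv)

lemma orbit_sum_finite_index:
  fixes f :: "('a \<Rightarrow> 'a) \<times> nat \<Rightarrow> real"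
  assumes "f summable_on G \<times> {..<s}"
  shows "infsum f (G \<times> {..<s}) = (\<Sum>j<s. \<Sum>\<^sub>\<infinity>g\<in>G. f (g, j))"
proof -
  have "(\<lambda>(j, g). f (g, j)) summable_on {..<s} \<times> G"
    using assms summable_on_reindex_bij_witness[where S = "G \<times> {..<s}" and T = "{..<s} \<times> G"
        and i = prod.swap and j = prod.swap and g = f and h = "\<lambda>(j, g). f (g, j)"] by auto
  from infsum_Sigma'_banach[OF this]
  have "infsum (\<lambda>(j, g). f (g, j)) ({..<s} \<times> G) = (\<Sum>j<s. \<Sum>\<^sub>\<infinity>g\<in>G. f (g, j))" by simp
  moreover have "infsum f (G \<times> {..<s}) = infsum (\<lambda>(j, g). f (g, j)) ({..<s} \<times> G)"
    by (rule infsum_reindex_bij_witness[where i = prod.swap and j = prod.swap]) auto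
  ultimately show ?thesis by simp
qed

context
  fixes y :: "nat \<Rightarrow> 'a" and s :: nat and K :: "'a set"
  assumes y: "biorthogonal (gfam y) (gfam y) (G \<times> {..<s})"
    and K: "K = ccspan (gfam y ` (G \<times> {..<s}))"
begin

lemma parseval_orbit:
  assumes "f \<in> K"
  shows "(norm f)\<^sup>2 = (\<Sum>j<s. \<Sum>\<^sub>\<infinity>g\<in>G. (cmod (cinner (g (y j)) f))\<^sup>2)"
proof -
  note p = parseval[OF y, of f] 
  have "(norm f)\<^sup>2 = infsum (\<lambda>n. (cmod (cinner (gfam y n) f))\<^sup>2) (G \<times> {..<s})"
    using p assms by (simp add: K infsumI)
  also have "\<dots> = (\<Sum>j<s. \<Sum>\<^sub>\<infinity>g\<in>G. (cmod (cinner (gfam y (g, j)) f))\<^sup>2)"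
    by (rule orbit_sum_finite_index[OF bessel_coeff_summable[OF orthonormal_bessel[OF y]]])
  finally show ?thesis by (simp add: gfam_def)
qed

text \<open>The traces of \<open>T' T\<close> and \<open>T T'\<close> agree: when
  \<open>T (y j)\<close> is expanded over the orbit of \<open>y\<close>, the matrix entries of
  \<open>T\<close> and \<open>T'\<close> correspond under inversion of \<open>g\<close> and exchange
  of \<open>i\<close> and \<open>j\<close>.\<close>

lemma trace_identity:
  assumes adj: "\<And>f h. cinner (T f) h = cinner f (T' h)" and T': "G_commutes G T'"
    and TK: "\<And>j. j < s \<Longrightarrow> T (y j) \<in> K" "\<And>j. j < s \<Longrightarrow> T' (y j) \<in> K"
  shows "(\<Sum>j<s. (norm (T (y j)))\<^sup>2) = (\<Sum>j<s. (norm (T' (y j)))\<^sup>2)"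
proof -
  have sw: "cinner (T' f) h = cinner f (T h)" for f h
    using adj cinner_commute[of "T' f" h] cinner_commute[of f "T h"] by simp
  have "(\<Sum>j<s. (norm (T (y j)))\<^sup>2) = (\<Sum>j<s. \<Sum>i<s. \<Sum>\<^sub>\<infinity>g\<in>G. (cmod (cinner (g (y i)) (T (y j))))\<^sup>2)"
    by (rule sum.cong) (simp_all add: parseval_orbit TK)
  also have "\<dots> = (\<Sum>j<s. \<Sum>i<s. \<Sum>\<^sub>\<infinity>g\<in>G. (cmod (cinner (g (T' (y i))) (y j)))\<^sup>2)"
    by (intro sum.cong infsum_cong refl) (simp add: sw[symmetric] G_commutesD[OF T'])
  also have "\<dots> = (\<Sum>j<s. \<Sum>i<s. \<Sum>\<^sub>\<infinity>g\<in>G. (cmod (cinner (g (y j)) (T' (y i))))\<^sup>2)"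
    by (subst infsum_orbit_swap) simp
  also have "\<dots> = (\<Sum>i<s. \<Sum>j<s. \<Sum>\<^sub>\<infinity>g\<in>G. (cmod (cinner (g (y j)) (T' (y i))))\<^sup>2)"
    by (rule sum.swap)
  also have "\<dots> = (\<Sum>i<s. (norm (T' (y i)))\<^sup>2)"
    by (rule sum.cong) (simp_all add: parseval_orbit TK)
  finally show ?thesis .
qed

text \<open>Double counting of the squared moduli of \<open>cinner (g (y j)) (x i)\<close>: Parseval
  for the orbit of \<open>y\<close> sums them to \<open>r\<close>, while after the swap Bessel for
  the orbit of \<open>x\<close> bounds the sum by \<open>s\<close>.\<close>

lemma orthonormal_orbit_le:
  assumes x: "biorthogonal (gfam x) (gfam x) (G \<times> {..<r})" and xK: "\<And>i. i < r \<Longrightarrow> x i \<in> K"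
  shows "r \<le> s"
proof -
  have nx: "norm (x i) = 1" if "i < r" for i
    using biorthogonal_gfamD[OF x G_id, of i i] that by (simp add: cinner_self_norm flip: of_real_power)
      (metis norm_ge_zero of_real_eq_1_iff power2_eq_1_iff neg_0_le_iff_le not_one_le_zero)
  have ny: "norm (y i) = 1" if "i < s" for i
    using biorthogonal_gfamD[OF y G_id, of i i] that by (simp add: cinner_self_norm flip: of_real_power)
      (metis norm_ge_zero of_real_eq_1_iff power2_eq_1_iff neg_0_le_iff_le not_one_le_zero)
  have "real r = (\<Sum>i<r. (norm (x i))\<^sup>2)" by (simp add: nx)
  also have "\<dots> = (\<Sum>i<r. \<Sum>j<s. \<Sum>\<^sub>\<infinity>g\<in>G. (cmod (cinner (g (y j)) (x i)))\<^sup>2)"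
    by (rule sum.cong) (simp_all add: parseval_orbit xK)
  also have "\<dots> = (\<Sum>i<r. \<Sum>j<s. \<Sum>\<^sub>\<infinity>g\<in>G. (cmod (cinner (g (x i)) (y j)))\<^sup>2)"
    by (subst infsum_orbit_swap) simp
  also have "\<dots> = (\<Sum>j<s. \<Sum>i<r. \<Sum>\<^sub>\<infinity>g\<in>G. (cmod (cinner (gfam x (g, i)) (y j)))\<^sup>2)"
    by (subst sum.swap) (simp add: gfam_def)
  also have "\<dots> \<le> (\<Sum>j<s. (norm (y j))\<^sup>2)"
  proof (rule sum_mono)
    fix j
    note b = orthonormal_bessel[OF x]
    show "(\<Sum>i<r. \<Sum>\<^sub>\<infinity>g\<in>G. (cmod (cinner (gfam x (g, i)) (y j)))\<^sup>2) \<le> (norm (y j))\<^sup>2"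
      using bessel_inequality[OF b, of "y j"] orbit_sum_finite_index[OF bessel_coeff_summable[OF b, of "y j"]]
      by simp
  qed
  also have "\<dots> = real s" by (simp add: ny)
  finally show ?thesis by simp
qed

end

end

section \<open>Matched pairs of vectors and complements\<close>

text \<open>\<open>matched G F\<close> says that the pairs in \<open>F\<close> span the graph of an isometry commuting with \<open>G\<close>.\<close>
definition matched :: "('a::complex_inner \<Rightarrow> 'a) set \<Rightarrow> ('a \<times> 'a) set \<Rightarrow> bool" where
  "matched G F \<longleftrightarrow> (\<forall>(a, b)\<in>F. \<forall>(a', b')\<in>F. \<forall>g\<in>G. cinner a (g a') = cinner b (g b'))"

text \<open>Maximality is stated for single pairs: a pair compatible with itself and with
  \<open>F\<close> already belongs to \<open>F\<close>. Linearity, closedness and invariance of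
  \<open>F\<close> then reduce to checking compatibility.\<close>

definition max_matched :: "('a::complex_inner \<Rightarrow> 'a) set \<Rightarrow> 'a set \<Rightarrow> 'a set \<Rightarrow> ('a \<times> 'a) set \<Rightarrow> bool" where
  "max_matched G A B F \<longleftrightarrow> F \<subseteq> A \<times> B \<and> matched G F \<and>
     (\<forall>p\<in>A \<times> B. matched G (insert p F) \<longrightarrow> p \<in> F)"

lemma closed_csubspace_INT:
  assumes "\<And>i. i \<in> I \<Longrightarrow> closed_csubspace (V i)"
  shows "closed_csubspace (\<Inter>i\<in>I. V i)"
  by (rule closed_csubspaceI) (use assms in \<open>auto simp: closed_csubspaceD\<close>)

text \<open>As adjoints are included, the projection onto such a closed subspace commutes with the
  whole commutant; see \<open>proj_commutant\<close>.\<close>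

definition commutant_invariant :: "('a::complex_inner \<Rightarrow> 'a) set \<Rightarrow> 'a set \<Rightarrow> bool" where
  "commutant_invariant G Z \<longleftrightarrow> (\<forall>T T'. commutant_pair G T T' \<longrightarrow> (\<forall>f\<in>Z. T f \<in> Z))"

lemma commutant_invariantD: "commutant_invariant G Z \<Longrightarrow> commutant_pair G T T' \<Longrightarrow> f \<in> Z \<Longrightarrow> T f \<in> Z"
  unfolding commutant_invariant_def by blast

lemma matchedD: "matched G F \<Longrightarrow> (a, b) \<in> F \<Longrightarrow> (a', b') \<in> F \<Longrightarrow> g \<in> G \<Longrightarrow> cinner a (g a') = cinner b (g b')"
  unfolding matched_def by (drule (1) bspec[of F _ "(a, b)"], simp) (drule (1) bspec[of F _ "(a', b')"], simp)

lemma matchedI: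
  "(\<And>a b a' b' g. (a, b) \<in> F \<Longrightarrow> (a', b') \<in> F \<Longrightarrow> g \<in> G \<Longrightarrow> cinner a (g a') = cinner b (g b')) \<Longrightarrow> matched G F"
  unfolding matched_def by blast

text \<open>The seed \<open>F0\<close> lets the result extend a prescribed isometry; with the empty
  seed it produces some maximal one.\<close>

lemma max_matched_exists:
  assumes F0: "F0 \<subseteq> A \<times> B" "matched G F0"
  shows "\<exists>F. F0 \<subseteq> F \<and> max_matched G A B F"
proof -
  let ?\<F> = "{F. F0 \<subseteq> F \<and> F \<subseteq> A \<times> B \<and> matched G F}"
  have "\<exists>M\<in>?\<F>. \<forall>X\<in>?\<F>. M \<subseteq> X \<longrightarrow> X = M"
  proof (rule subset_Zorn_nonempty)
    show "?\<F> \<noteq> {}" using F0 by blast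
    fix \<C> assume C: "\<C> \<noteq> {}" "subset.chain ?\<F> \<C>"
    have "matched G (\<Union>\<C>)"
    proof (rule matchedI)
      fix a b a' b' g assume ab: "(a, b) \<in> \<Union>\<C>" "(a', b') \<in> \<Union>\<C>" and g: "g \<in> G"
      then obtain X Y where X: "X \<in> \<C>" "(a, b) \<in> X" and Y: "Y \<in> \<C>" "(a', b') \<in> Y" by blast
      then have "X \<subseteq> Y \<or> Y \<subseteq> X" using C by (auto simp: subset_chain_def)
      then obtain Z where Z: "Z \<in> \<C>" "(a, b) \<in> Z" "(a', b') \<in> Z" using X Y by blast
      then have "matched G Z" using C by (auto simp: subset_chain_def)
      then show "cinner a (g a') = cinner b (g b')" by (rule matchedD[OF _ Z(2,3) g])
    qed
    moreover have "F0 \<subseteq> \<Union>\<C>" "\<Union>\<C> \<subseteq> A \<times> B" using C unfolding subset_chain_def by blast+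
    ultimately show "\<Union>\<C> \<in> ?\<F>" by blast
  qed
  then obtain F where F: "F \<in> ?\<F>" and max: "\<forall>X\<in>?\<F>. F \<subseteq> X \<longrightarrow> X = F" by (rule bexE)
  have "p \<in> F" if p: "p \<in> A \<times> B" "matched G (insert p F)" for p
  proof -
    have "insert p F \<in> ?\<F>" using F p by auto
    then have "insert p F = F" using max by (auto dest: bspec)
    then show ?thesis by blast
  qed
  then show ?thesis using F unfolding max_matched_def by blast
qed

lemma matched_converse: "matched G F \<Longrightarrow> matched G (F\<inverse>)"
  by (rule matchedI, rule sym, rule matchedD) auto

lemma max_matched_converse: 
  assumes "max_matched G A B F" shows "max_matched G B A (F\<inverse>)"
  unfolding max_matched_def
proof (intro conjI ballI impI)
  show "F\<inverse> \<subseteq> B \<times> A" "matched G (F\<inverse>)" using assms by (auto simp: max_matched_def intro: matched_converse)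
  fix p assume p: "p \<in> B \<times> A" "matched G (insert p (F\<inverse>))"
  obtain b a where ba: "p = (b, a)" by (cases p)
  have "(insert p (F\<inverse>))\<inverse> = insert (a, b) F" using ba by auto
  then have "matched G (insert (a, b) F)" using matched_converse[OF p(2)] by simp
  then show "p \<in> F\<inverse>" using assms p(1) ba by (auto simp: max_matched_def)
qed

context
  fixes G :: "('a::complex_hilbert \<Rightarrow> 'a) set"
  assumes G: "unitary_group G"
begin

text \<open>The relation with the old and the new pair exchanged is \<open>cross\<close> at
  \<open>inv g\<close>, conjugated.\<close>

lemma matched_insertI:
  assumes F: "matched G F" and self: "\<And>g. g \<in> G \<Longrightarrow> cinner a (g a) = cinner b (g b)"
    and cross: "\<And>a' b' g. (a', b') \<in> F \<Longrightarrow> g \<in> G \<Longrightarrow> cinner a' (g a) = cinner b' (g b)"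
  shows "matched G (insert (a, b) F)"
proof -
  have cross': "cinner a (g a') = cinner b (g b')" if "(a', b') \<in> F" "g \<in> G" for a' b' g
    using cross[OF that(1) G_inv[OF G that(2)]]
    by (simp add: G_cinner_right[OF G that(2)]) (metis cinner_commute)
  show ?thesis
    unfolding matched_def using matchedD[OF F] self cross cross' by auto
qed

lemma max_matchedI:
  assumes "max_matched G A B F" "a \<in> A" "b \<in> B" "\<And>g. g \<in> G \<Longrightarrow> cinner a (g a) = cinner b (g b)"
    "\<And>a' b' g. (a', b') \<in> F \<Longrightarrow> g \<in> G \<Longrightarrow> cinner a' (g a) = cinner b' (g b)"
  shows "(a, b) \<in> F"
  using assms matched_insertI[of F a b] unfolding max_matched_def by blast

context
  fixes A B :: "'a set" and F
  assumes A: "closed_csubspace A" "G_invariant G A" and B: "closed_csubspace B" "G_invariant G B"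
    and F: "max_matched G A B F"
begin

lemma max_matched_rel: "(a, b) \<in> F \<Longrightarrow> (a', b') \<in> F \<Longrightarrow> g \<in> G \<Longrightarrow> cinner a (g a') = cinner b (g b')"
  using F matchedD unfolding max_matched_def by blast

lemma max_matched_cinner: "(a, b) \<in> F \<Longrightarrow> (a', b') \<in> F \<Longrightarrow> cinner a a' = cinner b b'"
  using max_matched_rel[OF _ _ G_id[OF G]] by simp

lemma max_matched_norm: "(a, b) \<in> F \<Longrightarrow> norm a = norm b"
  using max_matched_cinner[of a b a b] by (metis Re_cinner_self norm_ge_zero power2_eq_iff_nonneg)

lemma max_matched_in: "(a, b) \<in> F \<Longrightarrow> a \<in> A" "(a, b) \<in> F \<Longrightarrow> b \<in> B"
  using F by (auto simp: max_matched_def)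

lemma max_matched_zero: "(0, 0) \<in> F"
  by (rule max_matchedI[OF F])
    (auto simp: closed_csubspaceD(1)[OF A(1)] closed_csubspaceD(1)[OF B(1)] bclinear_zero[OF G_bclinear[OF G]])

lemma max_matched_add: 
  assumes "(a, b) \<in> F" "(c, d) \<in> F"
  shows "(a + c, b + d) \<in> F"
  by (rule max_matchedI[OF F])
    (auto simp: closed_csubspaceD(2)[OF A(1)] closed_csubspaceD(2)[OF B(1)] max_matched_in[OF assms(1)]
      max_matched_in[OF assms(2)] bclinear_add[OF G_bclinear[OF G]] cinner_add_left cinner_add_right
      max_matched_rel[OF assms(1) assms(1)] max_matched_rel[OF assms(1) assms(2)]
      max_matched_rel[OF assms(2) assms(1)] max_matched_rel[OF assms(2) assms(2)]
      max_matched_rel[OF _ assms(1)] max_matched_rel[OF _ assms(2)])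

lemma max_matched_scaleC: 
  assumes "(a, b) \<in> F"
  shows "(scaleC r a, scaleC r b) \<in> F"
  by (rule max_matchedI[OF F])
    (auto simp: closed_csubspaceD(4)[OF A(1)] closed_csubspaceD(4)[OF B(1)] max_matched_in[OF assms(1)]
      bclinear_scaleC[OF G_bclinear[OF G]] max_matched_rel[OF assms(1) assms(1)] max_matched_rel[OF _ assms(1)])

lemma max_matched_diff: 
  assumes "(a, b) \<in> F" "(c, d) \<in> F"
  shows "(a - c, b - d) \<in> F"
  using max_matched_add[OF assms(1) max_matched_scaleC[OF assms(2), of "-1"]]
  by (simp add: cvs.scale_minus_left scaleC_one)

lemma max_matched_G: 
  assumes "(a, b) \<in> F" "g \<in> G"
  shows "(g a, g b) \<in> F"
proof (rule max_matchedI[OF F])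
  show "g a \<in> A" "g b \<in> B" using A B assms max_matched_in[OF assms(1)] by (auto simp: G_invariant_def)
  fix h assume h: "h \<in> G"
  have "inv g \<circ> (h \<circ> g) \<in> G" by (intro G_comp[OF G] G_inv[OF G] h assms(2))
  from max_matched_rel[OF assms(1) assms(1) this]
  show "cinner (g a) (h (g a)) = cinner (g b) (h (g b))" by (simp add: G_cinner_left[OF G assms(2)])
  fix a' b' assume "(a', b') \<in> F"
  from max_matched_rel[OF this assms(1) G_comp[OF G h assms(2)]]
  show "cinner a' (h (g a)) = cinner b' (h (g b))" by simp
qed

lemma max_matched_closed:
  assumes ab: "\<And>n. (a n, b n) \<in> F" and lim: "a \<longlonglongrightarrow> l" "b \<longlonglongrightarrow> m"
  shows "(l, m) \<in> F"
proof (rule max_matchedI[OF F])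
  show "l \<in> A" using closed_sequentially[OF closed_csubspaceD(6)[OF A(1)] _ lim(1)] max_matched_in[OF ab] by blast
  show "m \<in> B" using closed_sequentially[OF closed_csubspaceD(6)[OF B(1)] _ lim(2)] max_matched_in[OF ab] by blast
  fix g assume g: "g \<in> G"
  note [tendsto_intros] = bounded_linear.tendsto[OF bclinear_bounded_linear[OF G_bclinear[OF G g]]]
  have "(\<lambda>n. cinner (a n) (g (a n))) \<longlonglongrightarrow> cinner l (g l)" by (intro tendsto_intros lim)
  moreover have "(\<lambda>n. cinner (b n) (g (b n))) \<longlonglongrightarrow> cinner m (g m)" by (intro tendsto_intros lim)
  ultimately show "cinner l (g l) = cinner m (g m)"
    using max_matched_rel[OF ab ab g] LIMSEQ_unique by simp
  fix a' b' assume "(a', b') \<in> F"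
  then have eq: "cinner a' (g (a n)) = cinner b' (g (b n))" for n using max_matched_rel[OF _ ab g] by blast
  have "(\<lambda>n. cinner a' (g (a n))) \<longlonglongrightarrow> cinner a' (g l)" by (intro tendsto_intros lim)
  moreover have "(\<lambda>n. cinner b' (g (b n))) \<longlonglongrightarrow> cinner b' (g m)" by (intro tendsto_intros lim)
  ultimately show "cinner a' (g l) = cinner b' (g m)" using eq LIMSEQ_unique by simp
qed

text \<open>For closedness: when first coordinates converge, the second ones form a Cauchy sequence,
  because differences of pairs in \<open>F\<close> are again in \<open>F\<close> and have equal
  norms.\<close>

lemma closed_csubspace_matched_dom: "closed_csubspace (fst ` F)"
proof (rule closed_csubspaceI)
  show "0 \<in> fst ` F" using max_matched_zero by force
  show "x + y \<in> fst ` F" if "x \<in> fst ` F" "y \<in> fst ` F" for x y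
    using that max_matched_add by force
  show "scaleC r x \<in> fst ` F" if "x \<in> fst ` F" for r x
    using that max_matched_scaleC by force
  show "closed (fst ` F)"
  proof (rule closed_sequential_limits[THEN iffD2], intro allI impI)
    fix u l assume ul: "(\<forall>n. u n \<in> fst ` F) \<and> u \<longlonglongrightarrow> l"
    then have "\<forall>n. \<exists>b. (u n, b) \<in> F" by force
    then obtain b where b: "\<And>n. (u n, b n) \<in> F" by metis
    have "dist (b m) (b n) = dist (u m) (u n)" for m n
      unfolding dist_norm using max_matched_norm[OF max_matched_diff[OF b b]] by simp
    then have "Cauchy b" using LIMSEQ_imp_Cauchy[of u l] ul by (simp add: Cauchy_def)
    then obtain m where "b \<longlonglongrightarrow> m" using Cauchy_convergent convergent_def by blast
    then have "(l, m) \<in> F" using max_matched_closed[of u b l m, OF b] ul by blast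
    then show "l \<in> fst ` F" by force
  qed
qed

lemma G_invariant_matched_dom: "G_invariant G (fst ` F)"
  unfolding G_invariant_def using max_matched_G by force

text \<open>The partial isometry with graph \<open>F\<close>, extended by 0 to the orthogonal
  complement of the domain. Its value is unique because two partners of one vector differ by a
  vector of norm 0.\<close>

definition matched_op :: "'a \<Rightarrow> 'a" where
  "matched_op f = (THE b. (proj (fst ` F) f, b) \<in> F)"

lemma matched_op_eqI: 
  assumes "(a, b) \<in> F" "proj (fst ` F) f = a"
  shows "matched_op f = b"
  unfolding matched_op_def
proof (rule the_equality)
  show "(proj (fst ` F) f, b) \<in> F" using assms by simp
  fix b' assume "(proj (fst ` F) f, b') \<in> F"
  then show "b' = b" using max_matched_norm[OF max_matched_diff[OF _ assms(1)]] assms(2) by fastforce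
qed

lemma matched_op_in: "(proj (fst ` F) f, matched_op f) \<in> F"
proof -
  obtain b where "(proj (fst ` F) f, b) \<in> F"
    using proj_in[OF closed_csubspace_matched_dom, of f] by force
  then show ?thesis using matched_op_eqI by blast
qed

lemma matched_op_apply: "(a, b) \<in> F \<Longrightarrow> matched_op a = b"
  using proj_id[OF closed_csubspace_matched_dom] by (intro matched_op_eqI) force+

lemma norm_matched_op: "norm (matched_op f) = norm (proj (fst ` F) f)"
  using max_matched_norm[OF matched_op_in] by simp

lemma bclinear_matched_op: "bclinear matched_op"
proof (rule bclinearI[where C = 1])
  note D = closed_csubspace_matched_dom
  show "matched_op (x + y) = matched_op x + matched_op y" for x y
    by (rule matched_op_eqI[OF max_matched_add[OF matched_op_in matched_op_in]]) (simp add: proj_add[OF D])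
  show "matched_op (scaleC a x) = scaleC a (matched_op x)" for a x
    by (rule matched_op_eqI[OF max_matched_scaleC[OF matched_op_in]]) (simp add: proj_scaleC[OF D])
  show "norm (matched_op f) \<le> 1 * norm f" for f
    by (simp add: norm_matched_op norm_proj_le[OF D])
qed

lemma G_commutes_matched_op: "G_commutes G matched_op"
  unfolding G_commutes_def
  using matched_op_eqI[OF max_matched_G[OF matched_op_in]]
    G_commutesD[OF proj_commutes[OF G closed_csubspace_matched_dom G_invariant_matched_dom]] by blast

end

text \<open>The converse of \<open>F\<close> is maximal as well and has its own partial isometry
  \<open>V'\<close>; it is the adjoint of \<open>V\<close> because \<open>F\<close> preserves inner
  products.\<close>

lemma max_matched_operators:
  assumes A: "closed_csubspace A" "G_invariant G A" and B: "closed_csubspace B" "G_invariant G B"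
    and F: "max_matched G A B F"
  shows "\<exists>V V'. commutant_pair G V V' \<and> (\<forall>f. norm (V f) = norm (proj (fst ` F) f)) \<and>
    (\<forall>f. norm (V' f) = norm (proj (snd ` F) f)) \<and> (\<forall>f. (proj (fst ` F) f, V f) \<in> F) \<and>
    (\<forall>f. (V' f, proj (snd ` F) f) \<in> F) \<and> (\<forall>a b. (a, b) \<in> F \<longrightarrow> V' b = a)"
proof -
  let ?F' = "F\<inverse>"
  have F': "max_matched G B A ?F'" using max_matched_converse[OF F] .
  have fst': "fst ` ?F' = snd ` F" by force
  define V where "V = matched_op F"
  define V' where "V' = matched_op ?F'"
  have in1: "(proj (fst ` F) f, V f) \<in> F" for f unfolding V_def by (rule matched_op_in[OF A B F])
  have in2: "(V' f, proj (snd ` F) f) \<in> F" for f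
    using matched_op_in[OF B A F', of f] by (simp add: V'_def fst')
  note D = closed_csubspace_matched_dom[OF A B F] closed_csubspace_matched_dom[OF B A F', unfolded fst']
  have "cinner (V f) h = cinner f (V' h)" for f h
  proof -
    have "V f \<in> snd ` F" "V' h \<in> fst ` F" using in1 in2 by force+
    then have "cinner (V f) h = cinner (V f) (proj (snd ` F) h)" "cinner f (V' h) = cinner (proj (fst ` F) f) (V' h)"
      using cinner_proj_left[OF D(2)] cinner_proj[OF D(1)] proj_id[OF D(1)] by metis+
    moreover have "cinner (proj (fst ` F) f) (V' h) = cinner (V f) (proj (snd ` F) h)"
      by (rule max_matched_cinner[OF A B F in1 in2])
    ultimately show ?thesis by simp
  qed
  then have "commutant_pair G V V'"
    unfolding commutant_pair_def V_def V'_def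
    using bclinear_matched_op[OF A B F] bclinear_matched_op[OF B A F']
      G_commutes_matched_op[OF A B F] G_commutes_matched_op[OF B A F'] by blast
  moreover have "V' b = a" if "(a, b) \<in> F" for a b
    unfolding V'_def using matched_op_apply[OF B A F'] that by blast
  ultimately show ?thesis
    using norm_matched_op[OF A B F] norm_matched_op[OF B A F', unfolded fst'] in1 in2
    unfolding V_def[symmetric] V'_def[symmetric] by (intro exI[of _ V] exI[of _ V']) simp
qed

text \<open>Polar decomposition: if \<open>R\<close> maps into \<open>B\<close>, the vectors \<open>|R| f\<close> and \<open>R f\<close> match.\<close>
lemma no_matching_imp_disjoint:
  assumes A: "closed_csubspace A" "G_invariant G A" and B: "closed_csubspace B" "G_invariant G B"
    and no: "\<forall>a\<in>A. \<forall>b\<in>B. (\<forall>g\<in>G. cinner a (g a) = cinner b (g b)) \<longrightarrow> b = 0"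
    and T: "commutant_pair G T T'" and f: "f \<in> A"
  shows "proj B (T f) = 0"
proof -
  define R where "R = (\<lambda>x. proj B (T (proj A x)))"
  define R' where "R' = (\<lambda>x. proj A (T' (proj B x)))"
  have R: "commutant_pair G R R'"
    unfolding R_def R'_def
    using commutant_pair_compose[OF commutant_pair_proj[OF G B] commutant_pair_compose[OF T commutant_pair_proj[OF G A]]] .
  define D where "D = (\<lambda>x. R' (R x))"
  note RD = commutant_pairD[OF R]
  have bD: "bclinear D" unfolding D_def by (rule bclinear_compose[OF RD(2) RD(1)])
  have sa: "cinner (D x) z = cinner x (D z)" for x z unfolding D_def by (simp only: RD(6) RD(5)[symmetric])
  have pos: "cinner x (D x) = cinner (R x) (R x)" for x unfolding D_def by (simp only: RD(5))
  obtain C where C: "C > 0" "\<And>x. norm (R' x) \<le> C * norm x" using bclinear_bounded[OF RD(2)] by blast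
  \<comment> \<open>\<open>C\<close> bounds \<open>R'\<close>, and \<open>cinner x (D x)\<close> is
    the square of \<open>norm (R x)\<close>; hence the constant \<open>C\<^sup>2\<close> for
    \<open>sqrt_operator\<close>.\<close>
  have le: "(norm (D x))\<^sup>2 \<le> C\<^sup>2 * Re (cinner x (D x))" for x
  proof -
    have "(norm (D x))\<^sup>2 \<le> (C * norm (R x))\<^sup>2" unfolding D_def by (intro power_mono C) simp
    then show ?thesis by (simp add: pos Re_cinner_self power_mult_distrib)
  qed
  have C2: "C\<^sup>2 > 0" using C(1) by simp
  obtain S where S: "bclinear S" "\<forall>x z. cinner (S x) z = cinner x (S z)" "\<forall>x. S (S x) = D x"
    "\<forall>T. bclinear T \<and> (\<forall>x. D (T x) = T (D x)) \<longrightarrow> (\<forall>x. S (T x) = T (S x))"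
    using sqrt_operator[OF bD sa C2 le] by blast
  note Ssa = S(2)[rule_format] and SS = S(3)[rule_format]
  \<comment> \<open>\<open>R\<close> kills the orthogonal complement of \<open>A\<close>, hence so
    do \<open>D\<close> and \<open>S\<close>; self-adjointness then puts the range of
    \<open>S\<close> into \<open>A\<close>.\<close>
  have "S f \<in> A"
  proof (rule in_closed_csubspaceI[OF A(1)])
    fix z assume z: "z \<in> orth_compl A"
    then have "proj A z = 0" using proj_zero_iff[OF A(1)] by blast
    then have "D z = 0" using commutant_pairD(1)[OF T] RD(2) B(1)
      by (simp add: D_def R_def bclinear_zero bclinear_proj)
    then have "cinner (S z) (S z) = 0" by (simp only: Ssa SS cinner_zero_right)
    then have "S z = 0" by simp
    then show "cinner z (S f) = 0" using Ssa[of z f] by simp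
  qed
  moreover have "R f \<in> B" unfolding R_def by (rule proj_in[OF B(1)])
  \<comment> \<open>\<open>g\<close> commutes with \<open>D\<close>, hence with \<open>S\<close>, so
    both sides equal \<open>cinner f (D (g f))\<close>.\<close>
  moreover have "cinner (S f) (g (S f)) = cinner (R f) (g (R f))" if g: "g \<in> G" for g
  proof -
    have "D (g x) = g (D x)" for x unfolding D_def
      using G_commutesD[OF RD(3) g] G_commutesD[OF RD(4) g] by simp
    then have "g (S f) = S (g f)" using S(4) G_bclinear[OF G g] by simp
    then have "cinner (S f) (g (S f)) = cinner f (D (g f))" by (simp only: Ssa SS)
    also have "\<dots> = cinner (R f) (R (g f))" unfolding D_def by (simp only: RD(5))
    finally show ?thesis using G_commutesD[OF RD(3) g] by simp
  qed
  ultimately have "R f = 0" using no by blast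
  then show ?thesis using f by (simp add: R_def proj_id[OF A(1)])
qed

text \<open>Invariance of \<open>Z\<close> under the adjoint \<open>T'\<close> makes the orthogonal
  complement of \<open>Z\<close> invariant under \<open>T\<close>.\<close>

lemma proj_commutant:
  assumes Z: "closed_csubspace Z" and inv: "commutant_invariant G Z"
    and T: "commutant_pair G T T'"
  shows "proj Z (T f) = T (proj Z f)"
proof (rule proj_eqI[OF Z])
  show "T (proj Z f) \<in> Z" by (rule commutant_invariantD[OF inv T proj_in[OF Z]])
  have "cinner z (T (f - proj Z f)) = 0" if "z \<in> Z" for z
    using orth_complD(1)[OF proj_orth[OF Z] commutant_invariantD[OF inv commutant_pair_sym[OF T] that]]
    by (simp add: commutant_pairD(6)[OF T])
  then show "T f - T (proj Z f) \<in> orth_compl Z"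
    by (simp add: orth_compl_def bclinear_diff[OF commutant_pairD(1)[OF T]])
qed

text \<open>Pythagoras inside \<open>K\<close>; summed over the generators, the second equation
  makes the trace additive on orthogonal summands.\<close>

lemma proj_complement:
  assumes K: "closed_csubspace K" and N: "closed_csubspace N" "N \<subseteq> K"
  shows "proj (K \<inter> orth_compl N) f = proj K f - proj N f"
    "(norm (proj K f))\<^sup>2 = (norm (proj N f))\<^sup>2 + (norm (proj (K \<inter> orth_compl N) f))\<^sup>2"
proof -
  let ?p = "proj K f - proj N f"
  have 1: "?p \<in> K" using proj_in[OF K] proj_in[OF N(1)] N(2) by (intro closed_csubspaceD(3)[OF K]) auto
  have "cinner n ?p = 0" if n: "n \<in> N" for n
    using cinner_proj_left[OF N(1) n] cinner_proj_left[OF K, of n] n N(2) by (auto simp: cinner_diff_right)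
  then have 2: "?p \<in> orth_compl N" by (simp add: orth_compl_def)
  have "f - ?p \<in> orth_compl (K \<inter> orth_compl N)"
    unfolding orth_compl_def
  proof (intro CollectI ballI)
    fix v assume v: "v \<in> K \<inter> {x. \<forall>v\<in>N. cinner v x = 0}"
    then have "cinner v (f - proj K f) = 0" using orth_complD(1)[OF proj_orth[OF K]] by blast
    moreover have "cinner v (proj N f) = 0" using v proj_in[OF N(1), of f] cinner_eq_0_commute by blast
    ultimately show "cinner v (f - ?p) = 0" by (simp add: cinner_diff_right)
  qed
  then show eq: "proj (K \<inter> orth_compl N) f = ?p"
    using 1 2 by (intro proj_eqI closed_csubspace_Int[OF K closed_csubspace_orth_compl]) auto
  show "(norm (proj K f))\<^sup>2 = (norm (proj N f))\<^sup>2 + (norm (proj (K \<inter> orth_compl N) f))\<^sup>2"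
    using norm_add_sq_orth[of "proj N f" ?p] orth_complD(1)[OF 2 proj_in[OF N(1)]] by (simp add: eq)
qed

section \<open>Comparison of traces and the orthogonal complement of an orbit\<close>

context
  fixes y :: "nat \<Rightarrow> 'a" and s :: nat and K :: "'a set"
  assumes y: "biorthogonal (gfam y) (gfam y) (G \<times> {..<s})"
    and K_def: "K = ccspan (gfam y ` (G \<times> {..<s}))"
begin

text \<open>The trace identity for \<open>V (proj Z f)\<close>, where \<open>V\<close> is the
  partial isometry of \<open>F\<close>. Its adjoint \<open>proj Z (V' f)\<close> equals
  \<open>V' (proj Z f)\<close> by invariance of \<open>Z\<close>, so both sides become cut-down
  traces, of the domain and of the range of \<open>F\<close>.\<close>

lemma trace_max_matched:
  assumes A: "closed_csubspace A" "G_invariant G A" "A \<subseteq> K" and B: "closed_csubspace B" "G_invariant G B" "B \<subseteq> K"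
    and F: "max_matched G A B F"
    and Z: "closed_csubspace Z" and inv: "commutant_invariant G Z"
    and ZG: "G_invariant G Z"
  shows "(\<Sum>j<s. (norm (proj (fst ` F) (proj Z (y j))))\<^sup>2) = (\<Sum>j<s. (norm (proj (snd ` F) (proj Z (y j))))\<^sup>2)"
proof -
  obtain V V' where V: "commutant_pair G V V'" and n: "\<forall>f. norm (V f) = norm (proj (fst ` F) f)"
    "\<forall>f. norm (V' f) = norm (proj (snd ` F) f)" and in1: "\<forall>f. (proj (fst ` F) f, V f) \<in> F"
    and in2: "\<forall>f. (V' f, proj (snd ` F) f) \<in> F"
    using max_matched_operators[OF A(1,2) B(1,2) F] by blast
  have FK: "F \<subseteq> A \<times> B" using F by (simp add: max_matched_def)
  have VK: "V f \<in> K" "V' f \<in> K" for f using in1[rule_format, of f] in2[rule_format, of f] FK A(3) B(3) by blast+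
  have T: "commutant_pair G (\<lambda>f. V (proj Z f)) (\<lambda>f. proj Z (V' f))"
    by (rule commutant_pair_compose[OF V commutant_pair_proj[OF G Z ZG]])
  have eq: "proj Z (V' f) = V' (proj Z f)" for f
    by (rule proj_commutant[OF Z inv commutant_pair_sym[OF V]])
  have "(\<Sum>j<s. (norm (V (proj Z (y j))))\<^sup>2) = (\<Sum>j<s. (norm (proj Z (V' (y j))))\<^sup>2)"
    by (rule trace_identity[OF G y K_def commutant_pairD(5)[OF T] commutant_pairD(4)[OF T]])
      (simp_all add: VK eq)
  then show ?thesis by (simp add: eq n)
qed

lemma orthonormal_orbit_complement:
  assumes x: "biorthogonal (gfam x) (gfam x) (G \<times> {..<r})" and xK: "\<And>i. i < r \<Longrightarrow> x i \<in> K"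
  shows "r \<le> s" "\<exists>x'. biorthogonal (gfam x') (gfam x') (G \<times> {..<s - r}) \<and>
    ccspan (gfam x' ` (G \<times> {..<s - r})) = K \<inter> orth_compl (ccspan (gfam x ` (G \<times> {..<r})))"
proof -
  show rs: "r \<le> s" by (rule orthonormal_orbit_le[OF G y K_def x xK])
  define X where "X = ccspan (gfam x ` (G \<times> {..<r}))"
  define Y where "Y = ccspan (gfam y ` (G \<times> {..<r}))"
  have K: "closed_csubspace K" "G_invariant G K"
    unfolding K_def by (rule closed_csubspace_ccspan, rule G_invariant_gfam[OF G])
  have X: "closed_csubspace X" "G_invariant G X"
    unfolding X_def by (rule closed_csubspace_ccspan, rule G_invariant_gfam[OF G])
  have Y: "closed_csubspace Y" "G_invariant G Y"
    unfolding Y_def by (rule closed_csubspace_ccspan, rule G_invariant_gfam[OF G])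
  have XK: "X \<subseteq> K" unfolding X_def
    by (rule ccspan_least[OF gfam_subset[OF G K(2)] K(1)]) (use xK in auto)
  have yK: "y j \<in> K" if "j < s" for j unfolding K_def using that by (intro in_ccspan gfam_in[OF G]) auto
  have YK: "Y \<subseteq> K" unfolding Y_def
    by (rule ccspan_least[OF gfam_subset[OF G K(2)] K(1)]) (use yK rs in auto)
  define A where "A = K \<inter> orth_compl X"
  define B where "B = K \<inter> orth_compl Y"
  have A: "closed_csubspace A" "G_invariant G A" "A \<subseteq> K" unfolding A_def
    using closed_csubspace_Int[OF K(1) closed_csubspace_orth_compl]
      G_invariant_Int[OF G K(2) G_invariant_orth_compl[OF G X(2)]] by auto
  have B: "closed_csubspace B" "G_invariant G B" "B \<subseteq> K" unfolding B_def
    using closed_csubspace_Int[OF K(1) closed_csubspace_orth_compl]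
      G_invariant_Int[OF G K(2) G_invariant_orth_compl[OF G Y(2)]] by auto

  \<comment> \<open>The prescribed isometry \<open>y i \<mapsto> x i\<close> is to show that
    \<open>Y\<close> and \<open>X\<close> have equal traces. Its maximal extension within
    \<open>Y \<times> X\<close> covers both, as its domain and range are closed, invariant and
    contain the generators.\<close>
  let ?F0 = "(\<lambda>i. (y i, x i)) ` {..<r}"
  have "matched G ?F0"
    unfolding matched_def using biorthogonal_gfamD[OF G x] biorthogonal_gfamD[OF G y] rs by auto
  moreover have "?F0 \<subseteq> Y \<times> X"
    unfolding X_def Y_def by (auto intro!: in_ccspan gfam_in[OF G])
  ultimately obtain F1 where F1: "?F0 \<subseteq> F1" "max_matched G Y X F1"
    using max_matched_exists[of ?F0 Y X G] by blast
  have "Y \<subseteq> fst ` F1" unfolding Y_def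
  proof (rule ccspan_least[OF gfam_subset[OF G]])
    show "G_invariant G (fst ` F1)" by (rule G_invariant_matched_dom[OF Y X F1(2)])
    show "closed_csubspace (fst ` F1)" by (rule closed_csubspace_matched_dom[OF Y X F1(2)])
    show "y j \<in> fst ` F1" if "j \<in> {..<r}" for j using F1(1) that by force
  qed
  moreover note F1' = max_matched_converse[OF F1(2)]
  have "X \<subseteq> fst ` (F1\<inverse>)" unfolding X_def
  proof (rule ccspan_least[OF gfam_subset[OF G]])
    show "G_invariant G (fst ` (F1\<inverse>))" by (rule G_invariant_matched_dom[OF X Y F1'])
    show "closed_csubspace (fst ` (F1\<inverse>))" by (rule closed_csubspace_matched_dom[OF X Y F1'])
    show "x j \<in> fst ` (F1\<inverse>)" if "j \<in> {..<r}" for j using F1(1) that by force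
  qed
  moreover have "F1 \<subseteq> Y \<times> X" using F1(2) by (simp add: max_matched_def)
  ultimately have domF1: "fst ` F1 = Y" "snd ` F1 = X" by force+

  obtain F where F: "max_matched G A B F" using max_matched_exists[of "{}" A B G] by (auto simp: matched_def)
  note F' = max_matched_converse[OF F]
  have fst': "fst ` (F\<inverse>) = snd ` F" by force
  have FAB: "F \<subseteq> A \<times> B" using F by (simp add: max_matched_def)
  define A' where "A' = fst ` F"
  define B' where "B' = snd ` F"
  have A': "closed_csubspace A'" "G_invariant G A'" "A' \<subseteq> A" unfolding A'_def
    using closed_csubspace_matched_dom[OF A(1,2) B(1,2) F] G_invariant_matched_dom[OF A(1,2) B(1,2) F] FAB by auto
  have B': "closed_csubspace B'" "G_invariant G B'" "B' \<subseteq> B" unfolding B'_def fst'[symmetric]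
    using closed_csubspace_matched_dom[OF B(1,2) A(1,2) F'] G_invariant_matched_dom[OF B(1,2) A(1,2) F'] FAB by auto
  define A'' where "A'' = A \<inter> orth_compl A'"
  define B'' where "B'' = B \<inter> orth_compl B'"
  have A'': "closed_csubspace A''" "G_invariant G A''" "A'' \<subseteq> K" unfolding A''_def
    using closed_csubspace_Int[OF A(1) closed_csubspace_orth_compl]
      G_invariant_Int[OF G A(2) G_invariant_orth_compl[OF G A'(2)]] A(3) by auto
  have B'': "closed_csubspace B''" "G_invariant G B''" "B'' \<subseteq> K" unfolding B''_def
    using closed_csubspace_Int[OF B(1) closed_csubspace_orth_compl]
      G_invariant_Int[OF G B(2) G_invariant_orth_compl[OF G B'(2)]] B(3) by auto

  \<comment> \<open>A matching pair of leftovers could be added to \<open>F\<close>: leftovers are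
    orthogonal to all vectors already matched, so the cross conditions read
    \<open>0 = 0\<close>.\<close>
  have "b = 0" if a: "a \<in> A''" and b: "b \<in> B''" and ab: "\<forall>g\<in>G. cinner a (g a) = cinner b (g b)" for a b
  proof -
    have "(a, b) \<in> F"
    proof (rule max_matchedI[OF F])
      fix a' b' g assume ab': "(a', b') \<in> F" and g: "g \<in> G"
      have "g a \<in> A''" "g b \<in> B''" using a b g A''(2) B''(2) by (auto simp: G_invariant_def)
      moreover have "a' \<in> A'" "b' \<in> B'" using ab' unfolding A'_def B'_def by force+
      ultimately show "cinner a' (g a) = cinner b' (g b)"
        unfolding A''_def B''_def by (metis IntD2 orth_complD(1))
    qed (use a b ab in \<open>auto simp: A''_def B''_def\<close>)
    then have "b \<in> B'" unfolding B'_def by force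
    then have "cinner b b = 0" using b unfolding B''_def using orth_complD(1) by blast
    then show "b = 0" by simp
  qed
  then have no: "\<forall>a\<in>A''. \<forall>b\<in>B''. (\<forall>g\<in>G. cinner a (g a) = cinner b (g b)) \<longrightarrow> b = 0" by blast
  have disj: "proj B'' (T f) = 0" if "commutant_pair G T T'" "f \<in> A''" for T T' f
    using no_matching_imp_disjoint[OF A''(1,2) B''(1,2) no that] .

  \<comment> \<open>\<open>K\<close> splits into \<open>X\<close>, \<open>A'\<close>,
    \<open>A''\<close> and also into \<open>Y\<close>, \<open>B'\<close>, \<open>B''\<close>. The
    cut-down traces of the first two parts agree in pairs and, being finite, cancel.\<close>
  have trace: "(\<Sum>j<s. (norm (proj A'' (proj Z (y j))))\<^sup>2) = (\<Sum>j<s. (norm (proj B'' (proj Z (y j))))\<^sup>2)"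
    if Z: "closed_csubspace Z" "G_invariant G Z" and inv: "commutant_invariant G Z" for Z
  proof -
    let ?t = "\<lambda>N. \<Sum>j<s. (norm (proj N (proj Z (y j))))\<^sup>2"
    have split: "?t N = ?t N1 + ?t (N \<inter> orth_compl N1)" if "closed_csubspace N" "closed_csubspace N1" "N1 \<subseteq> N" for N N1
      by (simp add: proj_complement(2)[OF that] sum.distrib)
    have "?t Y = ?t X" using trace_max_matched[OF Y YK X XK F1(2) Z(1) inv Z(2)] by (simp add: domF1)
    moreover have "?t A' = ?t B'"
      using trace_max_matched[OF A B F Z(1) inv Z(2)] by (simp add: A'_def B'_def)
    moreover have "?t K = ?t X + ?t A" unfolding A_def by (rule split[OF K(1) X(1) XK])
    moreover have "?t K = ?t Y + ?t B" unfolding B_def by (rule split[OF K(1) Y(1) YK])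
    moreover have "?t A = ?t A' + ?t A''" unfolding A''_def by (rule split[OF A(1) A'(1) A'(3)])
    moreover have "?t B = ?t B' + ?t B''" unfolding B''_def by (rule split[OF B(1) B'(1) B'(3)])
    ultimately show ?thesis by simp
  qed
  \<comment> \<open>Faithfulness of the trace: if all generators project to 0, then \<open>N\<close>
    is orthogonal to the closed invariant subspace that they generate, which contains
    \<open>N\<close>.\<close>
  have trivial: "N = {0}" if N: "closed_csubspace N" "G_invariant G N" "N \<subseteq> K" and z: "\<And>j. j < s \<Longrightarrow> proj N (y j) = 0" for N
  proof -
    have "gfam y ` (G \<times> {..<s}) \<subseteq> orth_compl N"
      by (rule gfam_subset[OF G G_invariant_orth_compl[OF G N(2)]]) (use z proj_zero_iff[OF N(1)] in auto)
    then have "K \<subseteq> orth_compl N" unfolding K_def by (rule ccspan_least[OF _ closed_csubspace_orth_compl])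
    then have "cinner n n = 0" if "n \<in> N" for n using that N(3) orth_complD(1) by blast
    then show ?thesis using closed_csubspaceD(1)[OF N(1)] by auto
  qed

  define Z where "Z = {f. \<forall>T T'. commutant_pair G T T' \<longrightarrow> proj B'' (T f) = 0}"
  have Z: "closed_csubspace Z"
  proof -
    have c: "closed_csubspace {f. proj B'' (T f) \<in> {0}}" if "commutant_pair G T T'" for T T'
      by (rule closed_csubspace_vimage[OF bclinear_compose[OF bclinear_proj[OF B''(1)] commutant_pairD(1)[OF that]]
            closed_csubspace_zero])
    have Zeq: "Z = (\<Inter>T\<in>{T. \<exists>T'. commutant_pair G T T'}. {f. proj B'' (T f) \<in> {0}})"
      unfolding Z_def by auto
    show ?thesis unfolding Zeq by (rule closed_csubspace_INT) (use c in blast)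
  qed
  have ZG: "G_invariant G Z"
    unfolding G_invariant_def
  proof (intro ballI)
    fix g f assume g: "g \<in> G" and f: "f \<in> Z"
    show "g f \<in> Z" unfolding Z_def
    proof (intro CollectI allI impI)
      fix T T' assume T: "commutant_pair G T T'"
      have "proj B'' (T (g f)) = g (proj B'' (T f))"
        using G_commutesD[OF commutant_pairD(3)[OF T] g] G_commutesD[OF proj_commutes[OF G B''(1,2)] g] by simp
      then show "proj B'' (T (g f)) = 0" using f T g by (auto simp: Z_def bclinear_zero[OF G_bclinear[OF G]])
    qed
  qed
  have Zinv: "commutant_invariant G Z"
    unfolding commutant_invariant_def
  proof (intro allI impI ballI)
    fix T T' f assume T: "commutant_pair G T T'" and f: "f \<in> Z"
    show "T f \<in> Z" unfolding Z_def
    proof (intro CollectI allI impI)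
      fix S S' assume "commutant_pair G S S'"
      from commutant_pair_compose[OF this T] show "proj B'' (S (T f)) = 0"
        using f unfolding Z_def by blast
    qed
  qed
  have "A'' \<subseteq> Z" unfolding Z_def using disj by blast
  have "proj B'' f = 0" if "f \<in> Z" for f using that commutant_pair_id unfolding Z_def by blast
  then have "(\<Sum>j<s. (norm (proj A'' (proj Z (y j))))\<^sup>2) = 0"
    using trace[OF Z ZG Zinv] by (simp add: proj_in[OF Z])
  then have "proj A'' (proj Z (y j)) = 0" if "j < s" for j
    using that by (simp add: sum_nonneg_eq_0_iff)
  \<comment> \<open>Since \<open>A''\<close> lies in \<open>Z\<close>, cutting down to
    \<open>Z\<close> does not change the projection onto \<open>A''\<close>; the vanishing cut-down
    trace is its full trace.\<close>
  moreover have "proj A'' (proj Z f) = proj A'' f" for f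
  proof (rule proj_eqI[OF A''(1), symmetric, OF proj_in[OF A''(1)]])
    have "f - proj Z f \<in> orth_compl A''"
      using proj_orth[OF Z, of f] \<open>A'' \<subseteq> Z\<close> by (auto simp: orth_compl_def)
    from closed_csubspaceD(2)[OF closed_csubspace_orth_compl this proj_orth[OF A''(1), of "proj Z f"]]
    show "f - proj A'' (proj Z f) \<in> orth_compl A''" by simp
  qed
  ultimately have A''0: "A'' = {0}" by (intro trivial[OF A'']) auto
  then have "proj A'' f = 0" for f using proj_in[OF A''(1), of f] by simp
  \<comment> \<open>The same comparison, now with the whole space in place of
    \<open>Z\<close>.\<close>
  then have "(\<Sum>j<s. (norm (proj B'' (y j)))\<^sup>2) = 0"
    using trace[OF closed_csubspace_UNIV, unfolded proj_id[OF closed_csubspace_UNIV UNIV_I]]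
    by (simp add: G_invariant_def commutant_invariant_def)
  then have "proj B'' (y j) = 0" if "j < s" for j using that by (simp add: sum_nonneg_eq_0_iff)
  then have B''0: "B'' = {0}" by (rule trivial[OF B''])
  have full: "N' = N" if "closed_csubspace N" "closed_csubspace N'" "N' \<subseteq> N" "N \<inter> orth_compl N' = {0}" for N N' :: "'a set"
  proof -
    have "ccspan N' = N" by (rule ccspan_eqI_orth[OF that(1,3)]) (use that(4) in \<open>auto simp: orth_compl_def\<close>)
    then show ?thesis using ccspan_eq[OF that(2) order_refl subset_ccspan] by simp
  qed
  have AA': "A' = A" using full[OF A(1) A'(1) A'(3)] A''0 by (simp add: A''_def)
  have BB': "B' = B" using full[OF B(1) B'(1) B'(3)] B''0 by (simp add: B''_def)

  have projB: "snd ` F = B" using BB' by (simp add: B'_def)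
  obtain V V' where V: "commutant_pair G V V'" and nV': "\<forall>f. norm (V' f) = norm (proj B f)"
    and in2: "\<forall>f. (V' f, proj B f) \<in> F" and V'b: "\<forall>a b. (a, b) \<in> F \<longrightarrow> V' b = a"
    using max_matched_operators[OF A(1,2) B(1,2) F] unfolding projB by blast
  \<comment> \<open>The orbit of the last \<open>s - r\<close> generators spans \<open>B\<close>;
    the isometry \<open>V'\<close> of \<open>B\<close> onto \<open>A\<close> carries them to the
    wanted \<open>x'\<close>.\<close>
  define y' where "y' i = y (r + i)" for i
  have y'B: "y' i \<in> B" if i: "i < s - r" for i
  proof -
    have "y' i \<in> orth_compl (gfam y ` (G \<times> {..<r}))"
      unfolding orth_compl_def
    proof (intro CollectI ballI)
      fix v assume "v \<in> gfam y ` (G \<times> {..<r})"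
      then obtain g j where "g \<in> G" "j < r" "v = g (y j)" by (auto simp: gfam_def)
      then show "cinner v (y' i) = 0"
        using biorthogonal_gfamD[OF G y, of g "r + i" j] i by (simp add: y'_def cinner_eq_0_commute)
    qed
    then show ?thesis using yK i unfolding B_def Y_def orth_compl_ccspan by (auto simp: y'_def)
  qed
  have spanB: "ccspan (gfam y' ` (G \<times> {..<s - r})) = B"
  proof (rule ccspan_eqI_orth[OF B(1) gfam_subset[OF G B(2)]])
    fix f assume f: "f \<in> B" and o: "\<And>v. v \<in> gfam y' ` (G \<times> {..<s - r}) \<Longrightarrow> cinner v f = 0"
    have "f \<in> orth_compl (gfam y ` (G \<times> {..<s}))"
      unfolding orth_compl_def
    proof (intro CollectI ballI)
      fix v assume "v \<in> gfam y ` (G \<times> {..<s})"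
      then obtain g j where g: "g \<in> G" "j < s" "v = g (y j)" by (auto simp: gfam_def)
      show "cinner v f = 0"
      proof (cases "j < r")
        case True
        then have "v \<in> Y" unfolding Y_def using g by (intro in_ccspan image_eqI[of _ _ "(g, j)"]) (auto simp: gfam_def)
        then show ?thesis using f orth_complD(1) unfolding B_def by blast
      next
        case False
        then show ?thesis using g
          by (intro o image_eqI[of _ _ "(g, j - r)"]) (auto simp: gfam_def y'_def)
      qed
    qed
    then have "f \<in> orth_compl K" by (simp add: K_def orth_compl_ccspan)
    then have "cinner f f = 0" using f B(3) orth_complD(1) by blast
    then show "f = 0" by simp
  qed (use y'B in auto)
  define x' where "x' i = V' (y' i)" for i
  have gV: "gfam x' n = V' (gfam y' n)" if "n \<in> G \<times> {..<s - r}" for n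
    using that G_commutesD[OF commutant_pairD(4)[OF V]] by (auto simp: gfam_def x'_def)
  have "biorthogonal (gfam x') (gfam x') (G \<times> {..<s - r})"
  proof (rule biorthogonal_gfamI[OF G])
    fix g i j assume g: "g \<in> G" and ij: "i \<in> {..<s - r}" "j \<in> {..<s - r}"
    have "(V' (y' i), y' i) \<in> F" if "i < s - r" for i
      using in2[rule_format, of "y' i"] proj_id[OF B(1) y'B[OF that]] by simp
    then have "cinner (x' i) (g (x' j)) = cinner (y' i) (g (y' j))"
      unfolding x'_def using ij g by (intro max_matched_rel[OF A(1,2) B(1,2) F]) auto
    also have "\<dots> = (if g = id \<and> i = j then 1 else 0)"
      unfolding y'_def using biorthogonal_gfamD[OF G y g, of "r + i" "r + j"] ij by auto
    finally show "cinner (x' i) (g (x' j)) = (if g = id \<and> i = j then 1 else 0)" .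
  qed
  moreover have "ccspan (gfam x' ` (G \<times> {..<s - r})) = A"
  proof -
    have "gfam x' ` (G \<times> {..<s - r}) = V' ` (gfam y' ` (G \<times> {..<s - r}))"
      using gV by (auto simp: image_image)
    moreover have "ccspan (V' ` (gfam y' ` (G \<times> {..<s - r}))) = V' ` B"
      using image_ccspan[OF commutant_pairD(2)[OF V], of 1 "gfam y' ` (G \<times> {..<s - r})"]
      unfolding spanB by (simp add: nV' proj_id[OF B(1)])
    moreover have "V' ` B = A"
    proof
      show "V' ` B \<subseteq> A" using in2 FAB by blast
      show "A \<subseteq> V' ` B"
      proof
        fix a assume "a \<in> A"
        then obtain b where "(a, b) \<in> F" using AA' unfolding A'_def by force
        then show "a \<in> V' ` B" using V'b FAB by blast
      qed
    qed
    ultimately show ?thesis by simp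
  qed
  ultimately show "\<exists>x'. biorthogonal (gfam x') (gfam x') (G \<times> {..<s - r}) \<and>
    ccspan (gfam x' ` (G \<times> {..<s - r})) = K \<inter> orth_compl (ccspan (gfam x ` (G \<times> {..<r})))"
    unfolding A_def X_def by blast
qed

end

end

section \<open>Oblique projections\<close>

text \<open>The open mapping argument, specialised to the addition map of \<open>V0 \<times> W0\<close> onto \<open>V1\<close>.\<close>

context
  fixes V0 W0 V1 :: "'a::complex_hilbert set"
  assumes V0: "closed_csubspace V0" and W0: "closed_csubspace W0" and V1: "closed_csubspace V1"
    and int: "V0 \<inter> W0 = {0}" and sum: "{a + b | a b. a \<in> V0 \<and> b \<in> W0} = V1"
begin

text \<open>Only the component in \<open>W0\<close> is controlled. The one in \<open>V0\<close>
  stays free, hence the conclusion merely asks that \<open>h - w - h'\<close> lie in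
  \<open>V0\<close>.\<close>

lemma decomposition_approx:
  "\<exists>M. \<forall>h\<in>V1. \<exists>w\<in>W0. \<exists>h'\<in>V1. h - w - h' \<in> V0 \<and> norm h' \<le> norm h / 2 \<and> norm w \<le> M * norm h"
proof -
  define S where "S c = {v + w | v w. v \<in> V0 \<and> w \<in> W0 \<and> norm w \<le> c}" for c :: real
  have SV1: "S c \<subseteq> V1" for c unfolding S_def sum[symmetric] by blast
  have cl: "closure (S c) \<subseteq> V1" for c
    by (rule closure_minimal[OF SV1 closed_csubspaceD(6)[OF V1]])
  have "V1 \<subseteq> (\<Union>n. closure (S (real n)))"
  proof
    fix f assume "f \<in> V1"
    then obtain v w where f: "f = v + w" "v \<in> V0" "w \<in> W0" using sum by blast
    obtain n where "norm w \<le> real n" using real_arch_simple by blast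
    then have "f \<in> S (real n)" unfolding S_def using f by blast
    then show "f \<in> (\<Union>n. closure (S (real n)))" using closure_subset by blast
  qed
  then have U: "(\<Union>n. closure (S (real n))) = V1" using cl by blast
  have "\<exists>n. top_of_set V1 interior_of closure (S (real n)) \<noteq> {}"
  proof (rule ccontr)
    assume no: "\<nexists>n. top_of_set V1 interior_of closure (S (real n)) \<noteq> {}"
    have "top_of_set V1 interior_of \<Union>(range (\<lambda>n. closure (S (real n)))) = {}"
    proof (rule Baire_category_alt)
      have "completely_metrizable_space (top_of_set V1)"
        by (rule completely_metrizable_space_closedin[OF completely_metrizable_space_euclidean
              closed_closedin[THEN iffD1, OF closed_csubspaceD(6)[OF V1]]])
      then show "completely_metrizable_space (top_of_set V1) \<or>
          locally_compact_space (top_of_set V1) \<and> regular_space (top_of_set V1)" ..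
      show "countable (range (\<lambda>n. closure (S (real n))))" by simp
      fix T assume "T \<in> range (\<lambda>n. closure (S (real n)))"
      then obtain n where T: "T = closure (S (real n))" by blast
      have "closedin (top_of_set V1) (closure (S (real n)))"
        by (rule closed_subset[OF cl closed_closure])
      then show "closedin (top_of_set V1) T \<and> top_of_set V1 interior_of T = {}" using no T by blast
    qed
    moreover have "top_of_set V1 interior_of V1 = V1"
      using interior_of_topspace[of "top_of_set V1"] by simp
    ultimately show False using U closed_csubspaceD(1)[OF V1] by auto
  qed
  then obtain n f0 where f0: "f0 \<in> top_of_set V1 interior_of closure (S (real n))" by blast
  let ?n = "real n"
  from f0 obtain e where e: "e > 0" "f0 \<in> V1" "\<And>f. f \<in> V1 \<Longrightarrow> dist f f0 < e \<Longrightarrow> f \<in> closure (S ?n)"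
  proof -
    obtain T where T: "openin (top_of_set V1) T" "f0 \<in> T" "T \<subseteq> closure (S ?n)"
      using f0 unfolding interior_of_def by blast
    obtain e where "e > 0" "\<forall>x'\<in>V1. dist x' f0 < e \<longrightarrow> x' \<in> T"
      using T(1,2) unfolding openin_euclidean_subtopology_iff by blast
    then show ?thesis using T cl that by blast
  qed
  \<comment> \<open>Differences of approximants to \<open>f0 + h\<close> and to \<open>f0\<close>
    move the ball to the origin; this doubles the bound on the \<open>W0\<close> component.\<close>
  have small: "h \<in> closure (S (2 * ?n))" if h: "h \<in> V1" "norm h < e" for h
  proof -
    have 1: "f0 + h \<in> closure (S ?n)" using e h V1 by (intro e(3)) (auto simp: closed_csubspaceD dist_norm)
    have 2: "f0 \<in> closure (S ?n)" using e by (intro e(3)) auto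
    obtain a b where ab: "\<And>k. a k \<in> S ?n" "a \<longlonglongrightarrow> f0 + h" "\<And>k. b k \<in> S ?n" "b \<longlonglongrightarrow> f0"
      using 1 2 unfolding closure_sequential by blast
    have "a k - b k \<in> S (2 * ?n)" for k
    proof -
      obtain v w where v: "a k = v + w" "v \<in> V0" "w \<in> W0" "norm w \<le> ?n" using ab(1)[of k] unfolding S_def by blast
      obtain v' w' where v': "b k = v' + w'" "v' \<in> V0" "w' \<in> W0" "norm w' \<le> ?n" using ab(3)[of k] unfolding S_def by blast
      have "a k - b k = (v - v') + (w - w')" using v v' by simp
      moreover have "v - v' \<in> V0" "w - w' \<in> W0" using v v' V0 W0 by (auto simp: closed_csubspaceD)
      moreover have "norm (w - w') \<le> 2 * ?n" using norm_triangle_ineq4[of w w'] v v' by simp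
      ultimately show ?thesis unfolding S_def by blast
    qed
    moreover have "(\<lambda>k. a k - b k) \<longlonglongrightarrow> f0 + h - f0" using ab by (intro tendsto_intros)
    ultimately show ?thesis unfolding closure_sequential by (intro exI[of _ "\<lambda>k. a k - b k"]) simp
  qed
  have "\<exists>w\<in>W0. \<exists>h'\<in>V1. h - w - h' \<in> V0 \<and> norm h' \<le> norm h / 2 \<and> norm w \<le> (4 * ?n / e) * norm h"
    if h: "h \<in> V1" for h
  proof (cases "h = 0")
    case True
    then show ?thesis using V0 V1 W0 by (intro bexI[of _ 0]) (auto simp: closed_csubspaceD(1))
  next
    case False
    \<comment> \<open>Scaling \<open>h\<close> to norm \<open>e / 2\<close> keeps it inside the
      ball, and an approximation within \<open>e / 4\<close> becomes one within
      \<open>norm h / 2\<close> after scaling back.\<close>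
    define r where "r = e / (2 * norm h)"
    have r: "r > 0" using False e by (simp add: r_def)
    have "norm (r *\<^sub>R h) < e" using False e r by (simp add: r_def)
    then have "r *\<^sub>R h \<in> closure (S (2 * ?n))" using V1 h by (intro small) (simp_all add: closed_csubspaceD)
    then obtain k where k: "k \<in> S (2 * ?n)" "dist k (r *\<^sub>R h) < e / 4"
      unfolding closure_approachable using e(1) by (meson zero_less_divide_iff zero_less_numeral)
    then obtain v w where vw: "k = v + w" "v \<in> V0" "w \<in> W0" "norm w \<le> 2 * ?n" unfolding S_def by blast
    define h' where "h' = h - (1 / r) *\<^sub>R k"
    have kV: "k \<in> V1" using k SV1 by blast
    have "h' \<in> V1" unfolding h'_def using h kV V1 by (simp add: closed_csubspaceD)
    moreover have "(1 / r) *\<^sub>R w \<in> W0" using vw W0 by (simp add: closed_csubspaceD)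
    moreover have "h - (1 / r) *\<^sub>R w - h' = (1 / r) *\<^sub>R v" by (simp add: h'_def vw scaleR_add_right)
    moreover have "(1 / r) *\<^sub>R v \<in> V0" using vw V0 by (simp add: closed_csubspaceD)
    moreover have "norm h' \<le> norm h / 2"
    proof -
      have "h' = - ((1 / r) *\<^sub>R (k - r *\<^sub>R h))" using r by (simp add: h'_def scaleR_diff_right)
      then have "norm h' = dist k (r *\<^sub>R h) / r" using r by (simp add: dist_norm)
      also have "\<dots> \<le> (e / 4) / r" using k r by (intro divide_right_mono) auto
      also have "\<dots> = norm h / 2" using False e by (simp add: r_def)
      finally show ?thesis .
    qed
    moreover have "norm ((1 / r) *\<^sub>R w) \<le> (4 * ?n / e) * norm h"
    proof -
      have "norm ((1 / r) *\<^sub>R w) \<le> (2 * ?n) / r" using r vw(4) by (simp add: divide_right_mono)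
      also have "\<dots> = (4 * ?n / e) * norm h" using False e by (simp add: r_def)
      finally show ?thesis .
    qed
    ultimately show ?thesis by (intro bexI[of _ "(1 / r) *\<^sub>R w"] bexI[of _ h']) auto
  qed
  then show ?thesis by blast
qed

text \<open>Successive approximation: the remainders halve at each stage, so the corrections in
  \<open>W0\<close> are dominated by a geometric series. Their sum is the \<open>W0\<close>
  component because the decomposition is unique; the constant is
  \<open>2 * \<bar>M\<bar>\<close>.\<close>

lemma decomposition_bound: "\<exists>C. \<forall>v\<in>V0. \<forall>w\<in>W0. norm w \<le> C * norm (v + w)"
proof -
  obtain M where M: "\<forall>h\<in>V1. \<exists>w\<in>W0. \<exists>h'\<in>V1. h - w - h' \<in> V0 \<and> norm h' \<le> norm h / 2 \<and> norm w \<le> M * norm h"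
    using decomposition_approx by blast
  then obtain W N where WN: "\<And>h. h \<in> V1 \<Longrightarrow> W h \<in> W0 \<and> N h \<in> V1 \<and> h - W h - N h \<in> V0 \<and>
      norm (N h) \<le> norm h / 2 \<and> norm (W h) \<le> M * norm h" by metis
  have "norm w \<le> (2 * \<bar>M\<bar>) * norm (v + w)" if v: "v \<in> V0" and w: "w \<in> W0" for v w
  proof -
    define h where "h = v + w"
    have h: "h \<in> V1" unfolding h_def using v w sum by blast
    have H: "(N ^^ k) h \<in> V1 \<and> norm ((N ^^ k) h) \<le> norm h * (1 / 2) ^ k" for k
    proof (induction k)
      case (Suc k)
      then show ?case using WN[of "(N ^^ k) h"] by auto
    qed (use h in simp)
    define u where "u k = W ((N ^^ k) h)" for k
    have u: "u k \<in> W0" "norm (u k) \<le> \<bar>M\<bar> * norm h * (1 / 2) ^ k" for k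
    proof -
      show "u k \<in> W0" unfolding u_def using WN H by blast
      have "norm (u k) \<le> M * norm ((N ^^ k) h)" unfolding u_def using WN H by blast
      also have "\<dots> \<le> \<bar>M\<bar> * (norm h * (1 / 2) ^ k)" using H by (intro mult_mono) auto
      finally show "norm (u k) \<le> \<bar>M\<bar> * norm h * (1 / 2) ^ k" by (simp add: mult.assoc)
    qed
    have geo: "(\<lambda>k. \<bar>M\<bar> * norm h * (1 / 2) ^ k) sums (\<bar>M\<bar> * norm h * 2)"
      using sums_mult[OF geometric_sums[of "1 / 2 :: real"], of "\<bar>M\<bar> * norm h"] by simp
    then have sgeo: "summable (\<lambda>k. \<bar>M\<bar> * norm h * (1 / 2) ^ k)" by (rule sums_summable)
    have su: "summable (\<lambda>k. norm (u k))" by (rule summable_comparison_test'[OF sgeo]) (simp add: u)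
    define w' where "w' = suminf u"
    have w'lim: "(\<lambda>n. \<Sum>k<n. u k) \<longlonglongrightarrow> w'"
      unfolding w'_def by (rule summable_LIMSEQ[OF summable_norm_cancel[OF su]])
    have w'W: "w' \<in> W0"
      by (rule closed_sequentially[OF closed_csubspaceD(6)[OF W0] _ w'lim])
        (intro closed_csubspace_sum[OF W0] u)
    have part: "h - (\<Sum>k<n. u k) - (N ^^ n) h \<in> V0" for n
    proof (induction n)
      case 0
      then show ?case using V0 by (simp add: closed_csubspaceD)
    next
      case (Suc n)
      have "(N ^^ n) h - W ((N ^^ n) h) - N ((N ^^ n) h) \<in> V0" using WN H by blast
      from closed_csubspaceD(2)[OF V0 Suc this] show ?case by (simp add: u_def algebra_simps)
    qed
    have "(\<lambda>n. norm h * (1 / 2) ^ n) \<longlonglongrightarrow> norm h * 0" by (intro tendsto_intros LIMSEQ_realpow_zero) auto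
    then have "(\<lambda>n. norm h * (1 / 2) ^ n) \<longlonglongrightarrow> 0" by simp
    then have "(\<lambda>n. (N ^^ n) h) \<longlonglongrightarrow> 0"
      by (rule Lim_null_comparison[rotated]) (use H in \<open>auto intro: always_eventually\<close>)
    then have lim: "(\<lambda>n. h - (\<Sum>k<n. u k) - (N ^^ n) h) \<longlonglongrightarrow> h - w' - 0" by (intro tendsto_intros w'lim)
    have "h - w' - 0 \<in> V0" by (rule closed_sequentially[OF closed_csubspaceD(6)[OF V0] part lim])
    then have "(h - w') - v \<in> V0" using v V0 by (simp add: closed_csubspaceD)
    then have "w - w' \<in> V0" by (simp add: h_def)
    moreover have "w - w' \<in> W0" using w w'W W0 by (simp add: closed_csubspaceD)
    ultimately have "w - w' \<in> V0 \<inter> W0" by (rule IntI)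
    then have "w - w' = 0" unfolding int by simp
    then have "w = w'" by simp
    moreover have "norm w' \<le> \<bar>M\<bar> * norm h * 2"
    proof -
      have "norm w' \<le> (\<Sum>k. norm (u k))" unfolding w'_def by (rule summable_norm[OF su])
      also have "\<dots> \<le> (\<Sum>k. \<bar>M\<bar> * norm h * (1 / 2) ^ k)" by (rule suminf_le[OF u(2) su sgeo])
      finally show ?thesis using sums_unique[OF geo] by simp
    qed
    ultimately show ?thesis by (simp add: h_def mult_ac)
  qed
  then show ?thesis by blast
qed

lemma decomposition_unique:
  assumes "v \<in> V0" "w \<in> W0" "v' \<in> V0" "w' \<in> W0" "v + w = v' + w'"
  shows "w = w'"
proof -
  have "w - w' = v' - v" using assms(5) by (metis add_diff_cancel_left' add_diff_eq diff_add_eq diff_diff_eq2)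
  then have "w - w' \<in> V0" using assms V0 by (metis closed_csubspaceD(3))
  moreover have "w - w' \<in> W0" using assms W0 by (simp add: closed_csubspaceD)
  ultimately have "w - w' \<in> V0 \<inter> W0" by (rule IntI)
  then have "w - w' = 0" unfolding int by simp
  then show ?thesis by simp
qed

text \<open>The decomposition is applied after the orthogonal projection onto \<open>V1\<close>,
  which makes \<open>P\<close> a bounded operator on the whole space.\<close>

lemma oblique_projection_exists:
  "\<exists>P. bclinear P \<and> (\<forall>v\<in>V0. P v = 0) \<and> (\<forall>w\<in>W0. P w = w) \<and> (\<forall>f. P f \<in> W0) \<and> (\<forall>f\<in>V1. f - P f \<in> V0)"
proof -
  have "\<exists>w\<in>W0. f - w \<in> V0" if f: "f \<in> V1" for f
  proof -
    obtain a b where "f = a + b" "a \<in> V0" "b \<in> W0" using f sum by blast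
    then show ?thesis by (intro bexI[of _ b]) auto
  qed
  then have "\<forall>f. \<exists>w\<in>W0. proj V1 f - w \<in> V0" using proj_in[OF V1] by blast
  then obtain P where P: "\<And>f. P f \<in> W0" "\<And>f. proj V1 f - P f \<in> V0" by metis
  have eqI: "P f = w" if "w \<in> W0" "proj V1 f - w \<in> V0" for f w
    by (rule decomposition_unique[OF P(2)[of f] P(1)[of f] that(2,1)]) simp
  have sub: "V0 \<subseteq> V1" "W0 \<subseteq> V1" unfolding sum[symmetric]
    using closed_csubspaceD(1)[OF V0] closed_csubspaceD(1)[OF W0] by force+
  obtain C where C: "\<forall>v\<in>V0. \<forall>w\<in>W0. norm w \<le> C * norm (v + w)" using decomposition_bound by blast
  have "bclinear P"
  proof (rule bclinearI[where C = "\<bar>C\<bar>"])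
    fix x y
    have "(proj V1 x - P x) + (proj V1 y - P y) \<in> V0" by (intro closed_csubspaceD(2)[OF V0] P)
    then show "P (x + y) = P x + P y"
      by (intro eqI) (simp_all add: closed_csubspaceD(2)[OF W0] P proj_add[OF V1] algebra_simps)
  next
    fix a x
    have "scaleC a (proj V1 x - P x) \<in> V0" by (intro closed_csubspaceD(4)[OF V0] P)
    then show "P (scaleC a x) = scaleC a (P x)"
      by (intro eqI) (simp_all add: closed_csubspaceD(4)[OF W0] P proj_scaleC[OF V1] cvs.scale_right_diff_distrib)
  next
    fix f
    have "norm (P f) \<le> C * norm (proj V1 f)" using C P(1)[of f] P(2)[of f] by fastforce
    also have "\<dots> \<le> \<bar>C\<bar> * norm f" by (intro mult_mono norm_proj_le[OF V1]) auto
    finally show "norm (P f) \<le> \<bar>C\<bar> * norm f" .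
  qed
  moreover have "P v = 0" if "v \<in> V0" for v
    using that sub closed_csubspaceD(1)[OF W0] by (intro eqI) (auto simp: proj_id[OF V1])
  moreover have "P w = w" if "w \<in> W0" for w
    using that sub closed_csubspaceD(1)[OF V0] by (intro eqI) (auto simp: proj_id[OF V1])
  moreover have "f - P f \<in> V0" if "f \<in> V1" for f using P(2)[of f] by (simp add: proj_id[OF V1 that])
  ultimately show ?thesis using P(1) by blast
qed

end

section \<open>Riesz bases and frames generated by orbits in complements\<close>

lemma riesz_basis_for_cong:
  assumes "\<And>n. n \<in> J \<Longrightarrow> v n = w n"
  shows "riesz_basis_for v J V \<longleftrightarrow> riesz_basis_for w J V"
proof -
  have "v ` J = w ` J" using assms by (rule image_cong[OF refl])
  moreover have "(\<lambda>n. scaleC (a n) (v n)) summable_on J \<longleftrightarrow> (\<lambda>n. scaleC (a n) (w n)) summable_on J" for a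
    by (rule summable_on_cong) (simp add: assms)
  moreover have "(\<Sum>\<^sub>\<infinity>n\<in>J. scaleC (a n) (v n)) = (\<Sum>\<^sub>\<infinity>n\<in>J. scaleC (a n) (w n))" for a
    by (rule infsum_cong) (simp add: assms)
  ultimately show ?thesis unfolding riesz_basis_for_def by simp
qed

lemma orthonormal_riesz_basis:
  fixes v :: "'i \<Rightarrow> 'a::complex_hilbert"
  shows "biorthogonal v v J \<Longrightarrow> riesz_basis_for v J (ccspan (v ` J))"
  unfolding riesz_basis_for_iff using orthonormal_riesz orthonormal_bessel by blast

context
  fixes G :: "('a::complex_hilbert \<Rightarrow> 'a) set"
  assumes G: "unitary_group G"
begin

text \<open>The frame operator commutes with \<open>G\<close>, so the preimages of the generators
  alone generate the dual basis as an orbit.\<close>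

lemma dual_riesz_orbit:
  assumes R: "riesz_basis_for (gfam x) (G \<times> {..<r}) V"
  shows "\<exists>d. (\<forall>j<r. d j \<in> V \<and> mixed_op (gfam x) (gfam x) (G \<times> {..<r}) (d j) = x j) \<and>
    biorthogonal (gfam x) (gfam d) (G \<times> {..<r}) \<and> riesz_basis_for (gfam d) (G \<times> {..<r}) V"
proof -
  let ?J = "G \<times> {..<r}" and ?D = "mixed_op (gfam x) (gfam x) (G \<times> {..<r})"
  obtain B where B: "bessel_seq B (gfam x) ?J" and Vs: "ccspan (gfam x ` ?J) = V"
    using R unfolding riesz_basis_for_iff by blast
  have VG: "G_invariant G V" by (rule riesz_basis_G_invariant[OF G R])
  have DG: "G_commutes G ?D" by (rule mixed_op_commutes[OF G B B])
  have xV: "x j \<in> V" if "j < r" for j unfolding Vs[symmetric] using that by (intro in_ccspan gfam_in[OF G]) auto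
  have "\<forall>j\<in>{..<r}. \<exists>d. d \<in> V \<and> ?D d = x j" using frame_op_image[OF R] xV by (metis imageE lessThan_iff)
  then obtain d where d: "\<And>j. j < r \<Longrightarrow> d j \<in> V" "\<And>j. j < r \<Longrightarrow> ?D (d j) = x j" by (metis lessThan_iff)
  have "gfam d n \<in> V \<and> ?D (gfam d n) = gfam x n" if "n \<in> ?J" for n
    using that d VG G_commutesD[OF DG] by (auto simp: gfam_def G_invariant_def)
  from dual_riesz_basis[OF R this] d show ?thesis by blast
qed

text \<open>With \<open>S\<close> the square root of the frame operator \<open>D\<close> and
  \<open>d j\<close> the preimage of \<open>x j\<close> in \<open>V\<close>, the vector
  \<open>S (d j)\<close> is the inverse root applied to \<open>x j\<close>, obtained without
  inverting \<open>S\<close>. Its inner products reduce to \<open>cinner (x i) (g (d j))\<close>,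
  where biorthogonality decides.\<close>

lemma orthonormalize_orbit:
  assumes R: "riesz_basis_for (gfam x) (G \<times> {..<r}) V"
  shows "\<exists>u. biorthogonal (gfam u) (gfam u) (G \<times> {..<r}) \<and> ccspan (gfam u ` (G \<times> {..<r})) = V"
proof -
  let ?J = "G \<times> {..<r}"
  obtain B where B: "bessel_seq B (gfam x) ?J" and Vs: "ccspan (gfam x ` ?J) = V"
    using R unfolding riesz_basis_for_iff by blast
  have V: "closed_csubspace V" "G_invariant G V"
    using R riesz_basis_closed riesz_basis_G_invariant[OF G] by blast+
  define D where "D = mixed_op (gfam x) (gfam x) ?J"
  have bD: "bclinear D" unfolding D_def by (rule bclinear_mixed_op[OF B B])
  have sa: "cinner (D f) h = cinner f (D h)" for f h unfolding D_def by (rule mixed_op_adjoint[OF B B])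
  have DG: "G_commutes G D" unfolding D_def by (rule mixed_op_commutes[OF G B B])
  have DV: "D f \<in> V" for f unfolding D_def Vs[symmetric] by (rule mixed_op_in_ccspan[OF B B])
  have DVV: "D ` V = V" unfolding D_def by (rule frame_op_image[OF R])
  obtain c where c: "c > 0" "\<forall>f\<in>V. c * norm f \<le> norm (D f)" using frame_op_lower[OF R] unfolding D_def by blast
  have Dinj: "f = 0" if "f \<in> V" "D f = 0" for f using c that by (auto simp: mult_le_0_iff)
  have le: "(norm (D f))\<^sup>2 \<le> B * Re (cinner f (D f))" for f unfolding D_def by (rule norm_frame_op_le[OF B])
  obtain S where S: "bclinear S" "\<forall>x z. cinner (S x) z = cinner x (S z)" "\<forall>x. S (S x) = D x"
    "\<forall>T. bclinear T \<and> (\<forall>x. D (T x) = T (D x)) \<longrightarrow> (\<forall>x. S (T x) = T (S x))"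
    using sqrt_operator[OF bD sa bessel_seqD(1)[OF B] le] by blast
  note Ssa = S(2)[rule_format] and SS = S(3)[rule_format]
  have SG: "S (g f) = g (S f)" if "g \<in> G" for g f
    using S(4) G_bclinear[OF G that] G_commutesD[OF DG that] by blast
  have SV: "S f \<in> V" if f: "f \<in> V" for f
  proof (rule in_closed_csubspaceI[OF V(1)])
    fix z assume z: "z \<in> orth_compl V"
    have "cinner (D z) (D z) = cinner z (D (D z))" by (simp only: sa)
    also have "\<dots> = 0" by (rule orth_complD(2)[OF z DV])
    finally have "D z = 0" by simp
    then have "cinner (S z) (S z) = 0" by (simp only: Ssa SS cinner_zero_right)
    then have "S z = 0" by simp
    then show "cinner z (S f) = 0" using Ssa[of z f] by simp
  qed
  obtain d where d: "\<And>j. j < r \<Longrightarrow> d j \<in> V" "\<And>j. j < r \<Longrightarrow> D (d j) = x j"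
    and bio: "biorthogonal (gfam x) (gfam d) ?J"
    using dual_riesz_orbit[OF R] unfolding D_def by blast
  define u where "u j = S (d j)" for j
  have "biorthogonal (gfam u) (gfam u) ?J"
  proof (rule biorthogonal_gfamI[OF G])
    fix g i j assume g: "g \<in> G" and ij: "i \<in> {..<r}" "j \<in> {..<r}"
    have "cinner (u i) (g (u j)) = cinner (S (S (d i))) (g (d j))"
      unfolding u_def SG[OF g, symmetric] by (simp only: Ssa)
    also have "\<dots> = cinner (x i) (g (d j))" using d ij by (simp add: SS)
    also have "\<dots> = (if g = id \<and> i = j then 1 else 0)" by (rule biorthogonal_gfamD[OF G bio g ij])
    finally show "cinner (u i) (g (u j)) = (if g = id \<and> i = j then 1 else 0)" .
  qed
  moreover have "ccspan (gfam u ` ?J) = V"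
  proof (rule ccspan_eqI_orth[OF V(1) gfam_subset[OF G V(2)]])
    show "u j \<in> V" if "j \<in> {..<r}" for j using that d SV by (auto simp: u_def)
    fix f assume f: "f \<in> V" and o: "\<And>v. v \<in> gfam u ` ?J \<Longrightarrow> cinner v f = 0"
    \<comment> \<open>Writing \<open>S f = D e\<close> turns orthogonality of \<open>f\<close> to
      the orbit of \<open>u\<close> into orthogonality of \<open>e\<close> to the orbit of
      \<open>x\<close>.\<close>
    obtain e where e: "e \<in> V" "S f = D e" using SV[OF f] DVV by blast
    have "cinner (gfam x n) e = 0" if n: "n \<in> ?J" for n
    proof -
      obtain g j where gj: "n = (g, j)" "g \<in> G" "j < r" using n by auto
      have "gfam x n = D (g (d j))" using gj d G_commutesD[OF DG] by (simp add: gfam_def)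
      then have "cinner (gfam x n) e = cinner (g (d j)) (S f)" by (simp add: sa e)
      also have "\<dots> = cinner (gfam u n) f" using gj by (simp add: gfam_def u_def SG flip: Ssa)
      also have "\<dots> = 0" using o n by blast
      finally show ?thesis .
    qed
    then have "e \<in> orth_compl (gfam x ` ?J)" unfolding orth_compl_def by blast
    then have "e \<in> orth_compl V" unfolding Vs[symmetric] orth_compl_ccspan .
    then have "cinner e e = 0" using e(1) orth_complD(1) by blast
    then have "S f = 0" using e(2) bclinear_zero[OF bD] by simp
    then have "D f = 0" using SS[of f] bclinear_zero[OF S(1)] by simp
    then show "f = 0" by (rule Dinj[OF f])
  qed
  ultimately show ?thesis by blast
qed

text \<open>Applying \<open>g\<close> to the decomposition of \<open>f\<close> keeps both summands
  in their subspaces, so it is the decomposition of \<open>g f\<close>.\<close>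

lemma oblique_commutes:
  assumes P: "bclinear P" "\<forall>v\<in>V0. P v = 0" "\<forall>w\<in>W0. P w = w" "\<forall>f. P f \<in> W0" "\<forall>f\<in>V1. f - P f \<in> V0"
    and V0: "G_invariant G V0" and W0: "G_invariant G W0"
    and g: "g \<in> G" and f: "f \<in> V1"
  shows "P (g f) = g (P f)"
proof -
  have "g (f - P f) \<in> V0" using V0 P(5) f g by (auto simp: G_invariant_def)
  then have "P (g f - g (P f)) = 0" using P(2) bclinear_diff[OF G_bclinear[OF G g]] by simp
  moreover have "P (g (P f)) = g (P f)" using P(3,4) W0 g by (auto simp: G_invariant_def)
  ultimately show ?thesis by (simp add: bclinear_diff[OF P(1)])
qed

lemma riesz_orbit_complement:
  assumes X: "riesz_basis_for (gfam x) (G \<times> {..<r}) V0" and Y: "riesz_basis_for (gfam y) (G \<times> {..<s}) V1"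
    and V01: "V0 \<subseteq> V1" and W0: "closed_csubspace W0"
    and int: "V0 \<inter> W0 = {0}" and sum: "{a + b | a b. a \<in> V0 \<and> b \<in> W0} = V1"
    and W0G: "G_invariant G W0"
  shows "\<exists>z. (\<forall>i<s - r. z i \<in> W0) \<and> riesz_basis_for (gfam z) (G \<times> {..<s - r}) W0"
proof -
  obtain u where u: "biorthogonal (gfam u) (gfam u) (G \<times> {..<r})" "ccspan (gfam u ` (G \<times> {..<r})) = V0"
    using orthonormalize_orbit[OF X] by blast
  obtain w where w: "biorthogonal (gfam w) (gfam w) (G \<times> {..<s})" "ccspan (gfam w ` (G \<times> {..<s})) = V1"
    using orthonormalize_orbit[OF Y] by blast
  have V0: "closed_csubspace V0" "G_invariant G V0" and V1: "closed_csubspace V1" "G_invariant G V1"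
    using X Y riesz_basis_closed riesz_basis_G_invariant[OF G] by blast+
  have uV1: "u i \<in> V1" if "i < r" for i
  proof -
    have "u i \<in> ccspan (gfam u ` (G \<times> {..<r}))" using that by (intro in_ccspan gfam_in[OF G]) auto
    then show ?thesis using u(2) V01 by blast
  qed
  let ?E = "V1 \<inter> orth_compl V0" and ?J = "G \<times> {..<s - r}"
  obtain x' where x': "biorthogonal (gfam x') (gfam x') ?J" "ccspan (gfam x' ` ?J) = ?E"
    using orthonormal_orbit_complement(2)[OF G w(1) w(2)[symmetric] u(1) uV1] u(2) by auto
  obtain P where P: "bclinear P" "\<forall>v\<in>V0. P v = 0" "\<forall>w\<in>W0. P w = w" "\<forall>f. P f \<in> W0" "\<forall>f\<in>V1. f - P f \<in> V0"
    using oblique_projection_exists[OF V0(1) W0 V1(1) int sum] by blast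
  have W01: "W0 \<subseteq> V1" unfolding sum[symmetric] using closed_csubspaceD(1)[OF V0(1)] by force
  have E: "closed_csubspace ?E" by (rule closed_csubspace_Int[OF V1(1) closed_csubspace_orth_compl])
  \<comment> \<open>\<open>f - P f\<close> lies in \<open>V0\<close> and \<open>f\<close> is
    orthogonal to \<open>V0\<close>, so \<open>P\<close> does not decrease the norm of
    \<open>f\<close>.\<close>
  have low: "1 * norm f \<le> norm (P f)" if f: "f \<in> ?E" for f
  proof -
    have "cinner f (f - P f) = 0" using f P(5) orth_complD(2) by blast
    then have "cinner f f = cinner f (P f)" by (simp add: cinner_diff_right)
    from norm_le_of_cinner_self[OF this] show ?thesis by simp
  qed
  have img: "P ` ?E = W0"
  proof
    show "P ` ?E \<subseteq> W0" using P(4) by blast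
    show "W0 \<subseteq> P ` ?E"
    proof
      fix w assume w: "w \<in> W0"
      \<comment> \<open>Subtracting a vector of \<open>V0\<close> leaves the value of
        \<open>P\<close> unchanged, so this is the preimage of \<open>w\<close>.\<close>
      have "w - proj V0 w \<in> ?E"
        using proj_orth[OF V0(1), of w] proj_in[OF V0(1), of w] V01 W01 w
        by (intro IntI closed_csubspaceD(3)[OF V1(1)]) auto
      moreover have "P (w - proj V0 w) = w" using P w proj_in[OF V0(1), of w] by (simp add: bclinear_diff)
      ultimately show "w \<in> P ` ?E" by (metis imageI)
    qed
  qed
  have R: "riesz_basis_for (gfam x') ?J ?E" using orthonormal_riesz_basis[OF x'(1)] x'(2) by simp
  have "x' i \<in> ?E" if "i < s - r" for i
    unfolding x'(2)[symmetric] using that by (intro in_ccspan gfam_in[OF G]) auto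
  then have comm: "P (g (x' i)) = g (P (x' i))" if "g \<in> G" "i < s - r" for g i
    using oblique_commutes[OF P V0(2) W0G that(1)] that(2) by blast
  have eq: "gfam (\<lambda>i. P (x' i)) n = P (gfam x' n)" if "n \<in> ?J" for n
    using that comm by (auto simp: gfam_def)
  have "riesz_basis_for (\<lambda>n. P (gfam x' n)) ?J (P ` ?E)"
    by (rule riesz_basis_transfer[OF R P(1) zero_less_one low])
  then have "riesz_basis_for (gfam (\<lambda>i. P (x' i))) ?J W0"
    using riesz_basis_for_cong[of ?J "gfam (\<lambda>i. P (x' i))" "\<lambda>n. P (gfam x' n)", OF eq] img by simp
  then show ?thesis using P(4) by (intro exI[of _ "\<lambda>i. P (x' i)"]) simp
qed

text \<open>The generators are \<open>P (y i)\<close>. The vector \<open>w\<close> representing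
  \<open>h \<mapsto> cinner f (P h)\<close> on \<open>V1\<close> is the adjoint of \<open>P\<close>
  at \<open>f\<close>: the frame sum of \<open>z\<close> at \<open>f\<close> is that of
  \<open>y\<close> at \<open>w\<close>, and
  \<open>norm f \<le> norm w \<le> C * norm f\<close>.\<close>

lemma frame_orbit_complement:
  assumes Y: "frame_for (gfam y) (G \<times> {..<s}) V1"
    and V0: "closed_csubspace V0" "G_invariant G V0" and W0: "closed_csubspace W0"
    and int: "V0 \<inter> W0 = {0}" and sum: "{a + b | a b. a \<in> V0 \<and> b \<in> W0} = V1"
    and W0G: "G_invariant G W0"
  shows "\<exists>z. (\<forall>i<s. z i \<in> W0) \<and> frame_for (gfam z) (G \<times> {..<s}) W0"
proof -
  let ?J = "G \<times> {..<s}"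
  obtain A B where AB: "0 < A" "A \<le> B" and fr: "\<And>f. f \<in> V1 \<Longrightarrow> (\<lambda>n. (cmod (cinner f (gfam y n)))\<^sup>2) summable_on ?J \<and>
            A * (norm f)\<^sup>2 \<le> (\<Sum>\<^sub>\<infinity>n\<in>?J. (cmod (cinner f (gfam y n)))\<^sup>2) \<and>
            (\<Sum>\<^sub>\<infinity>n\<in>?J. (cmod (cinner f (gfam y n)))\<^sup>2) \<le> B * (norm f)\<^sup>2" and V1s: "ccspan (gfam y ` ?J) = V1"
    using Y unfolding frame_for_def by blast
  have V1: "closed_csubspace V1" using closed_csubspace_ccspan V1s by blast
  obtain P where P: "bclinear P" "\<forall>v\<in>V0. P v = 0" "\<forall>w\<in>W0. P w = w" "\<forall>f. P f \<in> W0" "\<forall>f\<in>V1. f - P f \<in> V0"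
    using oblique_projection_exists[OF V0(1) W0 V1 int sum] by blast
  have W01: "W0 \<subseteq> V1" unfolding sum[symmetric] using closed_csubspaceD(1)[OF V0(1)] by force
  have yV1: "gfam y n \<in> V1" if "n \<in> ?J" for n unfolding V1s[symmetric] using that by (intro in_ccspan imageI)
  have "y i \<in> V1" if "i < s" for i
    unfolding V1s[symmetric] using that by (intro in_ccspan gfam_in[OF G]) auto
  then have comm: "P (g (y i)) = g (P (y i))" if "g \<in> G" "i < s" for g i
    using oblique_commutes[OF P V0(2) W0G that(1)] that(2) by blast
  define z where "z i = P (y i)" for i
  have eq: "gfam z n = P (gfam y n)" if "n \<in> ?J" for n
    using that comm by (auto simp: gfam_def z_def)
  obtain C where C: "C > 0" "\<And>f. norm (P f) \<le> C * norm f" using bclinear_bounded[OF P(1)] by blast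
  have span: "ccspan (gfam z ` ?J) = W0"
  proof (rule ccspan_eq[OF W0])
    have img: "gfam z ` ?J = P ` gfam y ` ?J" unfolding image_image by (rule image_cong[OF refl eq])
    show "gfam z ` ?J \<subseteq> W0" unfolding img using P(4) by blast
    show "W0 \<subseteq> ccspan (gfam z ` ?J)"
    proof
      fix w assume w: "w \<in> W0"
      have "P w \<in> ccspan (gfam z ` ?J)" unfolding img
        by (rule bclinear_image_ccspan_subset[OF P(1) _ closed_csubspace_ccspan, of "gfam y ` ?J"])
          (use w W01 V1s in \<open>auto intro: in_ccspan\<close>)
      then show "w \<in> ccspan (gfam z ` ?J)" using P(3) w by simp
    qed
  qed
  have bounds: "(\<lambda>n. (cmod (cinner f (gfam z n)))\<^sup>2) summable_on ?J \<and>
            A * (norm f)\<^sup>2 \<le> (\<Sum>\<^sub>\<infinity>n\<in>?J. (cmod (cinner f (gfam z n)))\<^sup>2) \<and>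
            (\<Sum>\<^sub>\<infinity>n\<in>?J. (cmod (cinner f (gfam z n)))\<^sup>2) \<le> max A (B * C\<^sup>2) * (norm f)\<^sup>2" if f: "f \<in> W0" for f
  proof -
    have "cmod (cinner f (P h)) \<le> (norm f * C) * norm h" for h
      using order_trans[OF cauchy_schwarz[of f "P h"] mult_left_mono[OF C(2)[of h] norm_ge_zero[of f]]]
      by (simp add: mult.assoc)
    then obtain w where w: "w \<in> V1" "\<forall>h\<in>V1. cinner f (P h) = cinner w h"
      using riesz_representation[OF V1, of "\<lambda>h. cinner f (P h)" "norm f * C"]
      by (auto simp: bclinear_add[OF P(1)] bclinear_scaleC[OF P(1)] cinner_add_right)
    have coeff: "(cmod (cinner f (gfam z n)))\<^sup>2 = (cmod (cinner w (gfam y n)))\<^sup>2" if "n \<in> ?J" for n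
      using w(2) yV1[OF that] eq[OF that] by simp
    have up: "norm w \<le> C * norm f"
    proof -
      have "(norm w)\<^sup>2 \<le> norm f * norm (P w)" using w by (intro cinner_self_le) simp
      also have "\<dots> \<le> norm f * (C * norm w)" by (intro mult_left_mono C(2)) simp
      finally have "norm w * norm w \<le> norm w * (C * norm f)" by (simp add: power2_eq_square mult_ac)
      then show ?thesis using C(1) by (cases "w = 0") auto
    qed
    have lo: "norm f \<le> norm w"
    proof (rule norm_le_of_cinner_self)
      have "f \<in> V1" using f W01 by blast
      then have "cinner w f = cinner f (P f)" using w(2) by simp
      then have "cinner w f = cinner f f" using P(3) f by simp
      then show "cinner f f = cinner f w" using cinner_commute[of f w] cinner_commute[of f f] by simp
    qed
    have sm: "(\<lambda>n. (cmod (cinner f (gfam z n)))\<^sup>2) summable_on ?J"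
      by (rule summable_on_cong[THEN iffD2, of _ _ "\<lambda>n. (cmod (cinner w (gfam y n)))\<^sup>2"])
        (use coeff fr[OF w(1)] in auto)
    have inf: "(\<Sum>\<^sub>\<infinity>n\<in>?J. (cmod (cinner f (gfam z n)))\<^sup>2) = (\<Sum>\<^sub>\<infinity>n\<in>?J. (cmod (cinner w (gfam y n)))\<^sup>2)"
      by (rule infsum_cong) (rule coeff)
    have "A * (norm f)\<^sup>2 \<le> A * (norm w)\<^sup>2" using AB lo by (intro mult_left_mono power_mono) auto
    moreover have "B * (norm w)\<^sup>2 \<le> B * (C * norm f)\<^sup>2" using AB up by (intro mult_left_mono power_mono) auto
    moreover have "B * (C * norm f)\<^sup>2 \<le> max A (B * C\<^sup>2) * (norm f)\<^sup>2"
      unfolding power_mult_distrib mult.assoc[symmetric] by (intro mult_right_mono) auto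
    ultimately show ?thesis using sm inf fr[OF w(1)] by linarith
  qed
  \<comment> \<open>The maximum with \<open>A\<close> keeps the upper bound above the lower one even
    when \<open>W0\<close> is trivial.\<close>
  have "frame_for (gfam z) ?J W0"
    unfolding frame_for_def
    by (rule conjI[OF span], rule exI[of _ A], rule exI[of _ "max A (B * C\<^sup>2)"]) (use AB bounds in auto)
  then show ?thesis using P(4) by (intro exI[of _ z]) (simp add: z_def)
qed

end

section \<open>Orthonormal bases of wandering subspaces\<close>

lemma orthonormal_independent:
  fixes x :: "nat \<Rightarrow> 'a::complex_inner"
  assumes x: "biorthogonal x x {..<m}"
  shows "cvs.independent (x ` {..<m})" "card (x ` {..<m}) = m" "cdim (cspan (x ` {..<m})) = m"
proof -
  have inj: "inj_on x {..<m}"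
  proof (rule inj_onI)
    fix i j assume ij: "i \<in> {..<m}" "j \<in> {..<m}" "x i = x j"
    then show "i = j" using biorthogonalD[OF x ij(1,2)] biorthogonalD[OF x ij(1,1)] by (auto split: if_splits)
  qed
  show card: "card (x ` {..<m}) = m" using card_image[OF inj] by simp
  show ind: "cvs.independent (x ` {..<m})"
  proof (rule cvs.independent_if_scalars_zero)
    fix f v assume z: "(\<Sum>u\<in>x ` {..<m}. scaleC (f u) u) = 0" and "v \<in> x ` {..<m}"
    then obtain i where i: "i < m" "v = x i" by auto
    have "(\<Sum>j<m. scaleC (f (x j)) (x j)) = 0" using z by (simp add: sum.reindex[OF inj])
    then have "0 = cinner (x i) (\<Sum>j<m. scaleC (f (x j)) (x j))" by simp
    also have "\<dots> = (\<Sum>j<m. if j = i then f (x j) else 0)"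
      unfolding cinner_sum_right by (rule sum.cong) (use i biorthogonalD[OF x] in auto)
    finally show "f v = 0" using i by simp
  qed simp
  show "cdim (cspan (x ` {..<m})) = m" using cvs.dim_eq_card_independent[OF ind] card by simp
qed

lemma orthonormal_expansion_orth:
  fixes x :: "nat \<Rightarrow> 'a::complex_inner"
  assumes x: "biorthogonal x x {..<m}" and i: "i < m"
  shows "cinner (x i) (f - (\<Sum>j<m. scaleC (cinner (x j) f) (x j))) = 0"
proof -
  have "cinner (x i) (\<Sum>j<m. scaleC (cinner (x j) f) (x j)) = (\<Sum>j<m. if j = i then cinner (x j) f else 0)"
    unfolding cinner_sum_right by (rule sum.cong) (use i biorthogonalD[OF x] in auto)
  then show ?thesis using i by (simp add: cinner_diff_right)
qed

text \<open>The orthonormal expansion is a finite sum and reproduces every vector of the closure,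
  which therefore lies in the algebraic span.\<close>

lemma closed_csubspace_cspan_orthonormal:
  fixes x :: "nat \<Rightarrow> 'a::complex_hilbert"
  assumes x: "biorthogonal x x {..<m}"
  shows "closed_csubspace (cspan (x ` {..<m}))"
proof -
  let ?T = "\<lambda>f. f - (\<Sum>j<m. scaleC (cinner (x j) f) (x j))" and ?V = "cspan (x ` {..<m})"
  note b = orthonormal_bessel[OF x]
  have mo: "mixed_op x x {..<m} f = (\<Sum>j<m. scaleC (cinner (x j) f) (x j))" for f
    by (simp add: mixed_op_def)
  have "ccspan (x ` {..<m}) \<subseteq> ?V"
  proof
    fix f assume "f \<in> ccspan (x ` {..<m})"
    then have "f = (\<Sum>j<m. scaleC (cinner (x j) f) (x j))" using mixed_op_id[OF b b x] mo by metis
    also have "\<dots> \<in> ?V" by (intro cvs.span_sum cvs.span_scale cvs.span_base imageI)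
    finally show "f \<in> ?V" .
  qed
  moreover have "?V \<subseteq> ccspan (x ` {..<m})" unfolding ccspan_def by (rule closure_subset)
  ultimately have "?V = ccspan (x ` {..<m})" by blast
  then show ?thesis using closed_csubspace_ccspan by metis
qed

text \<open>Finiteness enters as a bound on the length of orthonormal lists, a form available before
  \<open>X\<close> is known to be finite-dimensional. A longest list spans \<open>X\<close>, since
  otherwise a normalised residual would prolong it.\<close>

lemma orthonormal_basis_exists:
  fixes X :: "'a::complex_inner set"
  assumes X: "csubspace X" and bound: "\<forall>m x. biorthogonal x x {..<m::nat} \<and> (\<forall>i<m. x i \<in> X) \<longrightarrow> m \<le> N"
  shows "\<exists>m x. biorthogonal x x {..<m::nat} \<and> cspan (x ` {..<m}) = X"
proof -
  let ?P = "\<lambda>m. \<exists>x. biorthogonal x x {..<m::nat} \<and> (\<forall>i<m. x i \<in> X)"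
  have "?P 0" by (simp add: biorthogonal_def)
  moreover have "\<forall>m. ?P m \<longrightarrow> m \<le> N" using bound by blast
  ultimately obtain m where m: "?P m" "\<forall>k. ?P k \<longrightarrow> k \<le> m" using Nat.ex_has_greatest_nat[of ?P 0 N] by blast
  then obtain x where x: "biorthogonal x x {..<m}" "\<forall>i<m. x i \<in> X" by blast
  have sub: "cspan (x ` {..<m}) \<subseteq> X"
    using X x(2) unfolding csubspace_def by (intro cvs.span_minimal) auto
  moreover have "X \<subseteq> cspan (x ` {..<m})"
  proof
    fix f assume f: "f \<in> X"
    let ?p = "\<Sum>j<m. scaleC (cinner (x j) f) (x j)"
    have p: "?p \<in> cspan (x ` {..<m})" by (intro cvs.span_sum cvs.span_scale cvs.span_base imageI)
    define w where "w = f - ?p"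
    have wX: "w \<in> X" unfolding w_def using f p sub X unfolding csubspace_def by (blast intro: cvs.subspace_diff)
    have o: "cinner (x i) w = 0" if "i < m" for i
      unfolding w_def by (rule orthonormal_expansion_orth[OF x(1) that])
    have "w = 0"
    proof (rule ccontr)
      assume w0: "w \<noteq> 0"
      define e where "e = scaleC (complex_of_real (1 / norm w)) w"
      define x' where "x' = x(m := e)"
      have "norm e = 1" using w0 by (simp add: e_def norm_divide)
      then have ee: "cinner e e = 1" by (simp add: cinner_self_norm)
      have xe: "cinner (x i) e = 0" "cinner e (x i) = 0" if "i < m" for i
        using o[OF that] cinner_eq_0_commute[of w "x i"] by (simp_all add: e_def)
      have "biorthogonal x' x' {..<Suc m}"
        unfolding biorthogonal_def
      proof (intro ballI)
        fix i j assume "i \<in> {..<Suc m}" "j \<in> {..<Suc m}"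
        then show "cinner (x' i) (x' j) = (if i = j then 1 else 0)"
          using ee xe biorthogonalD[OF x(1), of i j] by (auto simp: x'_def less_Suc_eq)
      qed
      moreover have "e \<in> X" unfolding e_def using wX X unfolding csubspace_def by (rule cvs.subspace_scale[rotated])
      then have "\<forall>i<Suc m. x' i \<in> X" using x(2) by (auto simp: x'_def less_Suc_eq)
      ultimately have "Suc m \<le> m" using m(2) by blast
      then show False by simp
    qed
    then have "f = ?p" by (simp add: w_def)
    then show "f \<in> cspan (x ` {..<m})" using p by simp
  qed
  ultimately show ?thesis using x(1) by blast
qed

lemma cinner_cspan_eq_0:
  assumes S: "bclinear S" and T: "bclinear T"
    and o: "\<And>i j. i \<in> I \<Longrightarrow> j \<in> J \<Longrightarrow> cinner (S (u i)) (T (v j)) = 0"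
    and a: "a \<in> cspan (u ` I)" and b: "b \<in> cspan (v ` J)"
  shows "cinner (S a) (T b) = 0"
proof -
  obtain F c where F: "F \<subseteq> I" "a = (\<Sum>n\<in>F. scaleC (c n) (u n))" using cspan_image_finite_sum[OF a] by blast
  obtain F' c' where F': "F' \<subseteq> J" "b = (\<Sum>n\<in>F'. scaleC (c' n) (v n))" using cspan_image_finite_sum[OF b] by blast
  have "cinner (S (u n)) (T (v k)) = 0" if "n \<in> F" "k \<in> F'" for n k using that F F' o by blast
  then show ?thesis
    by (simp add: F F' bclinear_sum[OF S] bclinear_sum[OF T] bclinear_scaleC[OF S] bclinear_scaleC[OF T]
        cinner_sum_left cinner_sum_right)
qed

section \<open>Orbits of wandering subspaces\<close>

context
  fixes G :: "('a::complex_hilbert \<Rightarrow> 'a) set"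
  assumes G: "unitary_group G"
begin

lemma wandering_orthonormal_orbit:
  assumes X: "wandering G X" and x: "biorthogonal x x {..<m}" "\<And>i. i < m \<Longrightarrow> x i \<in> X"
  shows "biorthogonal (gfam x) (gfam x) (G \<times> {..<m})"
proof (rule biorthogonal_gfamI[OF G])
  fix g i j assume g: "g \<in> G" and ij: "i \<in> {..<m}" "j \<in> {..<m}"
  show "cinner (x i) (g (x j)) = (if g = id \<and> i = j then 1 else 0)"
  proof (cases "g = id")
    case True
    then show ?thesis using biorthogonalD[OF x(1) ij] by simp
  next
    case False
    then have "orth (id ` X) (g ` X)" using X g G_id[OF G] unfolding wandering_def by metis
    then show ?thesis using False x(2) ij unfolding orth_def by auto
  qed
qed

lemma orbit_sum_cspan:
  "orbit_sum G (cspan (x ` {..<m})) = ccspan (gfam x ` (G \<times> {..<m}))"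
proof
  let ?V = "ccspan (gfam x ` (G \<times> {..<m}))"
  have "x ` {..<m} \<subseteq> ?V" by (auto intro!: in_ccspan gfam_in[OF G])
  then have "cspan (x ` {..<m}) \<subseteq> ?V"
    using closed_csubspace_ccspan[of "gfam x ` (G \<times> {..<m})"] unfolding closed_csubspace_def csubspace_def
    by (intro cvs.span_minimal) auto
  then have "(\<Union>g\<in>G. g ` cspan (x ` {..<m})) \<subseteq> ?V"
    using G_invariantD[OF G_invariant_gfam[OF G, of x "{..<m}"]] by blast
  then show "orbit_sum G (cspan (x ` {..<m})) \<subseteq> ?V"
    unfolding orbit_sum_def by (rule ccspan_least) (rule closed_csubspace_ccspan)
  have "gfam x ` (G \<times> {..<m}) \<subseteq> (\<Union>g\<in>G. g ` cspan (x ` {..<m}))"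
    by (auto simp: gfam_def intro!: imageI cvs.span_base)
  then show "?V \<subseteq> orbit_sum G (cspan (x ` {..<m}))" unfolding orbit_sum_def by (rule ccspan_mono)
qed

lemma wandering_complement:
  assumes X: "wandering G X" and Y: "wandering G Y" and XY: "orbit_sum G X \<subseteq> orbit_sum G Y" and fin: "cfinite_dim Y"
  shows "\<exists>X'. wandering G X' \<and> (\<forall>g\<in>G. \<forall>h\<in>G. orth (g ` X) (h ` X')) \<and>
         {a + b | a b. a \<in> orbit_sum G X \<and> b \<in> orbit_sum G X'} = orbit_sum G Y \<and>
         cfinite_dim X \<and> cfinite_dim X' \<and> cdim X + cdim X' = cdim Y"
proof -
  have subX: "csubspace X" and subY: "csubspace Y" using X Y by (auto simp: wandering_def closed_csubspace_def)
  obtain T where T: "finite T" "cspan T = Y" using fin by (auto simp: cfinite_dim_def)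
  have boundY: "\<forall>m x. biorthogonal x x {..<m::nat} \<and> (\<forall>i<m. x i \<in> Y) \<longrightarrow> m \<le> card T"
  proof (intro allI impI)
    fix m :: nat and x :: "nat \<Rightarrow> 'a" assume x: "biorthogonal x x {..<m} \<and> (\<forall>i<m. x i \<in> Y)"
    then have "x ` {..<m} \<subseteq> cspan T" using T(2) by auto
    then show "m \<le> card T"
      using cvs.independent_span_bound[OF T(1) orthonormal_independent(1)] x orthonormal_independent(2)[of x m]
      by metis
  qed
  obtain s y where y: "biorthogonal y y {..<s::nat}" "cspan (y ` {..<s}) = Y"
    using orthonormal_basis_exists[OF subY boundY] by blast
  have yY: "y i \<in> Y" if "i < s" for i using that y(2) by (metis cvs.span_base imageI lessThan_iff)
  let ?K = "orbit_sum G Y"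
  have K: "?K = ccspan (gfam y ` (G \<times> {..<s}))" using orbit_sum_cspan[of y s] y(2) by simp
  note gy = wandering_orthonormal_orbit[OF Y y(1) yY]
  have XK: "X \<subseteq> orbit_sum G X"
    unfolding orbit_sum_def using G_id[OF G] by (intro subsetI in_ccspan UN_I[of id]) auto
  \<comment> \<open>Finite dimension of \<open>X\<close> has to be derived: an orthonormal list in
    \<open>X\<close> has an orthonormal orbit inside the orbit sum of \<open>Y\<close>, so its
    length is at most \<open>s\<close>.\<close>
  have boundX: "\<forall>m x. biorthogonal x x {..<m::nat} \<and> (\<forall>i<m. x i \<in> X) \<longrightarrow> m \<le> s"
  proof (intro allI impI)
    fix m :: nat and x :: "nat \<Rightarrow> 'a" assume x: "biorthogonal x x {..<m} \<and> (\<forall>i<m. x i \<in> X)"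
    show "m \<le> s"
      by (rule orthonormal_orbit_le[OF G gy K wandering_orthonormal_orbit[OF X, of x m]]) (use x XK XY in blast)+
  qed
  obtain r x where x: "biorthogonal x x {..<r::nat}" "cspan (x ` {..<r}) = X"
    using orthonormal_basis_exists[OF subX boundX] by blast
  have xX: "x i \<in> X" if "i < r" for i using that x(2) by (metis cvs.span_base imageI lessThan_iff)
  let ?V = "orbit_sum G X"
  have V: "?V = ccspan (gfam x ` (G \<times> {..<r}))" using orbit_sum_cspan[of x r] x(2) by simp
  note gx = wandering_orthonormal_orbit[OF X x(1) xX]
  have xK: "x i \<in> ?K" if "i < r" for i using xX[OF that] XK XY by blast
  have rs: "r \<le> s" using boundX x(1) xX by blast
  obtain x' where x': "biorthogonal (gfam x') (gfam x') (G \<times> {..<s - r})"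
      "ccspan (gfam x' ` (G \<times> {..<s - r})) = ?K \<inter> orth_compl ?V"
    using orthonormal_orbit_complement(2)[OF G gy K gx xK] V by auto
  define X' where "X' = cspan (x' ` {..<s - r})"
  have V': "orbit_sum G X' = ?K \<inter> orth_compl ?V" unfolding X'_def orbit_sum_cspan by (rule x'(2))
  have onx': "biorthogonal x' x' {..<s - r}"
    unfolding biorthogonal_def using biorthogonal_gfamD[OF G x' (1) G_id[OF G]] by auto
  have "wandering G X'"
    unfolding wandering_def
  proof (intro conjI ballI impI)
    show "closed_csubspace X'" unfolding X'_def by (rule closed_csubspace_cspan_orthonormal[OF onx'])
    fix g h assume gh: "g \<in> G" "h \<in> G" "g \<noteq> h"
    have o: "cinner (g (x' i)) (h (x' j)) = 0" if "i \<in> {..<s - r}" "j \<in> {..<s - r}" for i j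
      using biorthogonalD[OF x'(1), of "(g, i)" "(h, j)"] gh that by (simp add: gfam_def)
    have "cinner (g a) (h b) = 0" if "a \<in> X'" "b \<in> X'" for a b
      by (rule cinner_cspan_eq_0[OF G_bclinear[OF G gh(1)] G_bclinear[OF G gh(2)] _ that[unfolded X'_def]])
        (rule o)
    then show "orth (g ` X') (h ` X')" unfolding orth_def by blast
  qed
  moreover have "orth (g ` X) (h ` X')" if gh: "g \<in> G" "h \<in> G" for g h
  proof -
    have "X' \<subseteq> orbit_sum G X'" unfolding orbit_sum_def using G_id[OF G] by (intro subsetI in_ccspan UN_I[of id]) auto
    then have "h b \<in> orth_compl ?V" if "b \<in> X'" for b
      using that V' G_invariant_orth_compl[OF G G_invariant_gfam[OF G, of x "{..<r}"]] gh(2)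
      unfolding V G_invariant_def by blast
    moreover have "g a \<in> ?V" if "a \<in> X" for a
      unfolding orbit_sum_def using that gh(1) by (intro in_ccspan) blast
    ultimately show ?thesis unfolding orth_def using orth_complD(1) by blast
  qed
  moreover have "{a + b | a b. a \<in> ?V \<and> b \<in> orbit_sum G X'} = ?K"
  proof
    have cK: "closed_csubspace ?K" unfolding K by (rule closed_csubspace_ccspan)
    have cV: "closed_csubspace ?V" unfolding V by (rule closed_csubspace_ccspan)
    show "{a + b | a b. a \<in> ?V \<and> b \<in> orbit_sum G X'} \<subseteq> ?K"
      unfolding V' using XY closed_csubspaceD(2)[OF cK] by blast
    show "?K \<subseteq> {a + b | a b. a \<in> ?V \<and> b \<in> orbit_sum G X'}"
    proof
      fix f assume f: "f \<in> ?K"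
      have "f - proj ?V f \<in> ?K \<inter> orth_compl ?V"
        using proj_orth[OF cV, of f] proj_in[OF cV, of f] XY f closed_csubspaceD(3)[OF cK] by blast
      then show "f \<in> {a + b | a b. a \<in> ?V \<and> b \<in> orbit_sum G X'}"
        unfolding V' using proj_in[OF cV, of f]
        by (intro CollectI exI[of _ "proj ?V f"] exI[of _ "f - proj ?V f"]) simp
    qed
  qed
  moreover have "cfinite_dim X" "cfinite_dim X'"
    unfolding cfinite_dim_def X'_def x(2)[symmetric]
    by (rule exI[of _ "x ` {..<r}"], simp, rule exI[of _ "x' ` {..<s - r}"], simp)
  moreover have "cdim X + cdim X' = cdim Y"
    using orthonormal_independent(3)[OF x(1)] orthonormal_independent(3)[OF y(1)]
      orthonormal_independent(3)[OF onx'] rs x(2) y(2) by (simp add: X'_def)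
  ultimately show ?thesis by blast
qed

section \<open>Biorthogonal systems\<close>

text \<open>The components of \<open>p + q\<close> are controlled by
  \<open>norm q \<le> \<bar>C\<bar> * norm (p + q)\<close> and hence
  \<open>norm p \<le> (1 + \<bar>C\<bar>) * norm (p + q)\<close>; the squares of these factors enter
  the lower constant. The parallelogram law gives the upper one.\<close>

lemma riesz_concat:
  assumes X: "riesz_basis_for (gfam x) (G \<times> {..<r}) V0" and Z: "riesz_basis_for (gfam z) (G \<times> {..<s - r}) W0"
    and rs: "r \<le> s" and V1: "closed_csubspace V1"
    and int: "V0 \<inter> W0 = {0}" and sum: "{a + b | a b. a \<in> V0 \<and> b \<in> W0} = V1"
  shows "riesz_basis_for (gfam (concat_fam r x z)) (G \<times> {..<s}) V1"
proof -
  let ?c = "gfam (concat_fam r x z)"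
  obtain A B where A: "riesz_seq A (gfam x) (G \<times> {..<r})" and B: "bessel_seq B (gfam x) (G \<times> {..<r})"
    and V0s: "ccspan (gfam x ` (G \<times> {..<r})) = V0"
    using X unfolding riesz_basis_for_iff by blast
  obtain A' B' where A': "riesz_seq A' (gfam z) (G \<times> {..<s - r})" and B': "bessel_seq B' (gfam z) (G \<times> {..<s - r})"
    and W0s: "ccspan (gfam z ` (G \<times> {..<s - r})) = W0"
    using Z unfolding riesz_basis_for_iff by blast
  have V0: "closed_csubspace V0" and W0: "closed_csubspace W0" using closed_csubspace_ccspan V0s W0s by blast+
  obtain C where C: "\<forall>v\<in>V0. \<forall>w\<in>W0. norm w \<le> C * norm (v + w)"
    using decomposition_bound[OF V0 W0 V1 int sum] by blast
  note pos = riesz_seqD(1)[OF A] riesz_seqD(1)[OF A'] bessel_seqD(1)[OF B] bessel_seqD(1)[OF B']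
  \<comment> \<open>Undoes the offset \<open>r\<close> of the second block in
    \<open>concat_fam\<close>.\<close>
  define \<psi> :: "('a \<Rightarrow> 'a) \<times> nat \<Rightarrow> ('a \<Rightarrow> 'a) \<times> nat" where "\<psi> = (\<lambda>(g, j). (g, j - r))"
  have c1: "?c n = gfam x n" if "n \<in> G \<times> {..<r}" for n
    using that by (auto simp: gfam_def concat_fam_def)
  have c2: "?c n = gfam z (\<psi> n)" if "n \<in> G \<times> {r..<s}" for n
    using that by (auto simp: gfam_def concat_fam_def \<psi>_def)
  have \<psi>: "inj_on \<psi> (G \<times> {r..<s})" "\<psi> ` (G \<times> {r..<s}) \<subseteq> G \<times> {..<s - r}"
    by (auto simp: inj_on_def \<psi>_def)
  note A2 = riesz_seq_reindex[OF A' \<psi>] and B2 = bessel_seq_reindex[OF B' \<psi>]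
  have split: "\<exists>p q S1 S2. p \<in> V0 \<and> q \<in> W0 \<and> (\<Sum>n\<in>F. scaleC (a n) (?c n)) = p + q \<and> (\<Sum>n\<in>F. (cmod (a n))\<^sup>2) = S1 + S2 \<and>
      A * S1 \<le> (norm p)\<^sup>2 \<and> (norm p)\<^sup>2 \<le> B * S1 \<and> A' * S2 \<le> (norm q)\<^sup>2 \<and> (norm q)\<^sup>2 \<le> B' * S2 \<and> 0 \<le> S1 \<and> 0 \<le> S2"
    if F: "finite F" "F \<subseteq> G \<times> {..<s}" for F and a :: "('a \<Rightarrow> 'a) \<times> nat \<Rightarrow> complex"
  proof -
    let ?F1 = "F \<inter> G \<times> {..<r}" and ?F2 = "F \<inter> G \<times> {r..<s}"
    have un: "F = ?F1 \<union> ?F2" "finite ?F1" "finite ?F2" "?F1 \<inter> ?F2 = {}" using F by force+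
    let ?p = "\<Sum>n\<in>?F1. scaleC (a n) (gfam x n)" and ?q = "\<Sum>n\<in>?F2. scaleC (a n) (gfam z (\<psi> n))"
    have "(\<Sum>n\<in>F. scaleC (a n) (?c n)) = (\<Sum>n\<in>?F1. scaleC (a n) (?c n)) + (\<Sum>n\<in>?F2. scaleC (a n) (?c n))"
      by (rule sum.union_disjoint[OF un(2,3,4), folded un(1)])
    also have "(\<Sum>n\<in>?F1. scaleC (a n) (?c n)) = ?p" by (rule sum.cong) (simp_all add: c1)
    also have "(\<Sum>n\<in>?F2. scaleC (a n) (?c n)) = ?q" by (rule sum.cong) (simp_all add: c2)
    finally have 1: "(\<Sum>n\<in>F. scaleC (a n) (?c n)) = ?p + ?q" .
    have 2: "(\<Sum>n\<in>F. (cmod (a n))\<^sup>2) = (\<Sum>n\<in>?F1. (cmod (a n))\<^sup>2) + (\<Sum>n\<in>?F2. (cmod (a n))\<^sup>2)"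
      by (rule sum.union_disjoint[OF un(2,3,4), folded un(1)])
    have 3: "?p \<in> V0" unfolding V0s[symmetric]
      by (intro closed_csubspace_sum[OF closed_csubspace_ccspan] closed_csubspaceD(4)[OF closed_csubspace_ccspan] in_ccspan imageI) auto
    have 4: "?q \<in> W0" unfolding W0s[symmetric]
      by (intro closed_csubspace_sum[OF closed_csubspace_ccspan] closed_csubspaceD(4)[OF closed_csubspace_ccspan] in_ccspan imageI)
        (use \<psi>(2) in auto)
    show ?thesis
      by (rule exI[of _ ?p], rule exI[of _ ?q], rule exI[of _ "\<Sum>n\<in>?F1. (cmod (a n))\<^sup>2"],
          rule exI[of _ "\<Sum>n\<in>?F2. (cmod (a n))\<^sup>2"], intro conjI 1 2 3 4 riesz_seqD(2)[OF A] bessel_seqD(2)[OF B]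
          riesz_seqD(2)[OF A2] bessel_seqD(2)[OF B2] un sum_nonneg) auto
  qed
  have "bessel_seq (2 * (B + B')) ?c (G \<times> {..<s})"
    unfolding bessel_seq_def
  proof (intro conjI allI impI)
    fix F and a :: "('a \<Rightarrow> 'a) \<times> nat \<Rightarrow> complex" assume F: "finite F \<and> F \<subseteq> G \<times> {..<s}"
    obtain p q S1 S2 where pq: "(\<Sum>n\<in>F. scaleC (a n) (?c n)) = p + q" "(\<Sum>n\<in>F. (cmod (a n))\<^sup>2) = S1 + S2"
      "(norm p)\<^sup>2 \<le> B * S1" "(norm q)\<^sup>2 \<le> B' * S2" "0 \<le> S1" "0 \<le> S2"
      using split[of F a] F by blast
    have "(norm (p + q))\<^sup>2 \<le> 2 * (norm p)\<^sup>2 + 2 * (norm q)\<^sup>2"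
      using parallelogram[of p q] zero_le_power2[of "norm (p - q)"] by linarith
    also have "\<dots> \<le> 2 * (B * S1) + 2 * (B' * S2)" using pq by linarith
    also have "\<dots> \<le> 2 * (B + B') * (S1 + S2)"
      using pq(5,6) pos by (simp add: algebra_simps)
    finally show "(norm (\<Sum>n\<in>F. scaleC (a n) (?c n)))\<^sup>2 \<le> 2 * (B + B') * (\<Sum>n\<in>F. (cmod (a n))\<^sup>2)"
      unfolding pq(1,2) .
  qed (use pos in simp)
  moreover have "riesz_seq (min A A' / ((1 + \<bar>C\<bar>)\<^sup>2 + \<bar>C\<bar>\<^sup>2)) ?c (G \<times> {..<s})"
    unfolding riesz_seq_def
  proof (intro conjI allI impI)
    let ?k = "(1 + \<bar>C\<bar>)\<^sup>2 + \<bar>C\<bar>\<^sup>2"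
    have k: "?k > 0" by (intro add_pos_nonneg zero_less_power) auto
    then show "min A A' / ?k > 0" using pos by simp
    fix F and a :: "('a \<Rightarrow> 'a) \<times> nat \<Rightarrow> complex" assume F: "finite F \<and> F \<subseteq> G \<times> {..<s}"
    obtain p q S1 S2 where pq: "(\<Sum>n\<in>F. scaleC (a n) (?c n)) = p + q" "(\<Sum>n\<in>F. (cmod (a n))\<^sup>2) = S1 + S2"
      "A * S1 \<le> (norm p)\<^sup>2" "A' * S2 \<le> (norm q)\<^sup>2" "0 \<le> S1" "0 \<le> S2" "p \<in> V0" "q \<in> W0"
      using split[of F a] F by blast
    have q: "norm q \<le> \<bar>C\<bar> * norm (p + q)"
      using C pq(7,8) mult_right_mono[OF abs_ge_self[of C] norm_ge_zero[of "p + q"]] by fastforce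
    have "norm p \<le> norm (p + q) + norm q" using norm_triangle_ineq4[of "p + q" q] by simp
    then have p: "norm p \<le> (1 + \<bar>C\<bar>) * norm (p + q)" using q by (simp add: distrib_right)
    have "min A A' * (S1 + S2) \<le> A * S1 + A' * S2"
      unfolding distrib_left using pq(5,6) by (intro add_mono mult_right_mono) auto
    also have "\<dots> \<le> (norm p)\<^sup>2 + (norm q)\<^sup>2" using pq by linarith
    also have "\<dots> \<le> ((1 + \<bar>C\<bar>) * norm (p + q))\<^sup>2 + (\<bar>C\<bar> * norm (p + q))\<^sup>2"
      using p q by (intro add_mono power_mono) auto
    also have "\<dots> = ?k * (norm (p + q))\<^sup>2" by (simp only: power_mult_distrib distrib_right[of "(1 + \<bar>C\<bar>)\<^sup>2"])
    finally show "min A A' / ?k * (\<Sum>n\<in>F. (cmod (a n))\<^sup>2) \<le> (norm (\<Sum>n\<in>F. scaleC (a n) (?c n)))\<^sup>2"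
      unfolding pq(1,2) using k by (simp add: pos_divide_le_eq mult.commute)
  qed
  moreover have "ccspan (?c ` (G \<times> {..<s})) = V1"
  proof (rule ccspan_eq[OF V1])
    have sub: "V0 \<subseteq> V1" "W0 \<subseteq> V1" unfolding sum[symmetric]
      using closed_csubspaceD(1)[OF V0] closed_csubspaceD(1)[OF W0] by force+
    have "?c n \<in> V1" if n: "n \<in> G \<times> {..<s}" for n
    proof (cases "n \<in> G \<times> {..<r}")
      case True
      then have "gfam x n \<in> V0" unfolding V0s[symmetric] by (intro in_ccspan imageI)
      then show ?thesis using c1[OF True] sub by auto
    next
      case False
      then have n': "n \<in> G \<times> {r..<s}" using n by auto
      then have "gfam z (\<psi> n) \<in> W0" unfolding W0s[symmetric] using \<psi>(2) by (intro in_ccspan imageI) blast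
      then show ?thesis using c2[OF n'] sub by auto
    qed
    then show "?c ` (G \<times> {..<s}) \<subseteq> V1" by blast
    let ?U = "ccspan (?c ` (G \<times> {..<s}))"
    have "gfam x n \<in> ?U" if "n \<in> G \<times> {..<r}" for n
      using that c1[OF that, symmetric] rs by (intro in_ccspan image_eqI[of _ _ n]) auto
    then have "V0 \<subseteq> ?U" unfolding V0s[symmetric] by (intro ccspan_least closed_csubspace_ccspan) blast
    moreover have "gfam z n \<in> ?U" if n': "n \<in> G \<times> {..<s - r}" for n
    proof -
      obtain g j where n: "n = (g, j)" "g \<in> G" "j < s - r" using n' by auto
      then show ?thesis
        by (intro in_ccspan image_eqI[of _ _ "(g, r + j)"]) (auto simp: gfam_def concat_fam_def)
    qed
    then have "W0 \<subseteq> ?U" unfolding W0s[symmetric] by (intro ccspan_least closed_csubspace_ccspan) blast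
    ultimately show "V1 \<subseteq> ?U" unfolding sum[symmetric]
      using closed_csubspaceD(2)[OF closed_csubspace_ccspan] by blast
  qed
  ultimately show ?thesis unfolding riesz_basis_for_iff by blast
qed

text \<open>\<open>mixed_op w v J\<close> projects onto \<open>V0\<close> along the orthogonal
  complement of \<open>Vt0\<close>. Its range lies in \<open>V1\<close>, so it splits
  \<open>V1\<close>.\<close>

lemma biorthogonal_decomposition:
  fixes v w :: "'i \<Rightarrow> 'a"
  assumes R: "riesz_basis_for v J V0" and Rt: "riesz_basis_for w J Vt0" and bio: "biorthogonal v w J"
    and V1: "closed_csubspace V1" and V01: "V0 \<subseteq> V1"
  shows "V0 \<inter> (V1 \<inter> orth_compl Vt0) = {0}"
    "{a + b | a b. a \<in> V0 \<and> b \<in> V1 \<inter> orth_compl Vt0} = V1"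
proof -
  obtain B where B: "bessel_seq B v J" and Vs: "ccspan (v ` J) = V0"
    using R unfolding riesz_basis_for_iff by blast
  obtain B' where B': "bessel_seq B' w J" and Vts: "ccspan (w ` J) = Vt0"
    using Rt unfolding riesz_basis_for_iff by blast
  note bio' = biorthogonal_sym[OF bio]
  let ?E = "mixed_op w v J"
  have E: "?E f \<in> V0" for f unfolding Vs[symmetric] by (rule mixed_op_in_ccspan[OF B' B])
  have wV: "w n \<in> Vt0" if "n \<in> J" for n unfolding Vts[symmetric] using that by (intro in_ccspan imageI)
  show "V0 \<inter> (V1 \<inter> orth_compl Vt0) = {0}"
  proof
    show "V0 \<inter> (V1 \<inter> orth_compl Vt0) \<subseteq> {0}"
    proof
      fix f assume f: "f \<in> V0 \<inter> (V1 \<inter> orth_compl Vt0)"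
      then have "?E f = f" using mixed_op_id[OF B' B bio'] Vs by blast
      moreover have "?E f = 0" by (rule mixed_op_eq_0[OF B' B]) (use f wV orth_complD(1) in blast)
      ultimately show "f \<in> {0}" by simp
    qed
    have "0 \<in> V0" using closed_csubspaceD(1)[OF closed_csubspace_ccspan] Vs by blast
    then show "{0} \<subseteq> V0 \<inter> (V1 \<inter> orth_compl Vt0)" using closed_csubspaceD(1)[OF V1] by (simp add: orth_compl_def)
  qed
  show "{a + b | a b. a \<in> V0 \<and> b \<in> V1 \<inter> orth_compl Vt0} = V1"
  proof
    show "{a + b | a b. a \<in> V0 \<and> b \<in> V1 \<inter> orth_compl Vt0} \<subseteq> V1"
      using V01 closed_csubspaceD(2)[OF V1] by blast
    show "V1 \<subseteq> {a + b | a b. a \<in> V0 \<and> b \<in> V1 \<inter> orth_compl Vt0}"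
    proof
      fix f assume f: "f \<in> V1"
      have "f - ?E f \<in> orth_compl (w ` J)"
        unfolding orth_compl_def by (auto simp: cinner_diff_right cinner_mixed_op_biorthogonal[OF B' B bio'])
      then have "f - ?E f \<in> orth_compl Vt0" unfolding Vts[symmetric] orth_compl_ccspan .
      moreover have "f - ?E f \<in> V1" using closed_csubspaceD(3)[OF V1 f] E V01 by blast
      ultimately show "f \<in> {a + b | a b. a \<in> V0 \<and> b \<in> V1 \<inter> orth_compl Vt0}"
        using E[of f] by (intro CollectI exI[of _ "?E f"] exI[of _ "f - ?E f"]) simp
    qed
  qed
qed

text \<open>\<open>mixed_op (gfam y) (gfam yt)\<close> is the projection onto \<open>Vt1\<close> along the orthogonal complement of
  \<open>V1\<close>; it carries the dual basis of \<open>c\<close> inside \<open>V1\<close> to the one inside \<open>Vt1\<close>.\<close>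
lemma dual_basis_in_biorthogonal_space:
  assumes Y: "riesz_basis_for (gfam y) (G \<times> {..<s}) V1" and Yt: "riesz_basis_for (gfam yt) (G \<times> {..<s}) Vt1"
    and bio: "biorthogonal (gfam y) (gfam yt) (G \<times> {..<s})"
    and c: "riesz_basis_for (gfam c) (G \<times> {..<s}) V1"
  shows "\<exists>d. riesz_basis_for (gfam d) (G \<times> {..<s}) Vt1 \<and> biorthogonal (gfam c) (gfam d) (G \<times> {..<s})"
    "\<And>e. e \<in> Vt1 \<Longrightarrow> (\<And>n. n \<in> G \<times> {..<s} \<Longrightarrow> cinner (gfam c n) e = 0) \<Longrightarrow> e = 0"
proof -
  let ?J = "G \<times> {..<s}"
  obtain B where B: "bessel_seq B (gfam y) ?J" and V1s: "ccspan (gfam y ` ?J) = V1"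
    using Y unfolding riesz_basis_for_iff by blast
  obtain B' where B': "bessel_seq B' (gfam yt) ?J" and Vt1s: "ccspan (gfam yt ` ?J) = Vt1"
    using Yt unfolding riesz_basis_for_iff by blast
  have V1: "closed_csubspace V1" using closed_csubspace_ccspan V1s by blast
  have cs: "ccspan (gfam c ` ?J) = V1" using c unfolding riesz_basis_for_iff by blast
  define R where "R = mixed_op (gfam y) (gfam yt) ?J"
  have bR: "bclinear R" unfolding R_def by (rule bclinear_mixed_op[OF B B'])
  have RG: "G_commutes G R" unfolding R_def by (rule mixed_op_commutes[OF G B B'])
  have RV: "R f \<in> Vt1" for f unfolding R_def Vt1s[symmetric] by (rule mixed_op_in_ccspan[OF B B'])
  have Rid: "R f = f" if "f \<in> Vt1" for f unfolding R_def using mixed_op_id[OF B B' bio] that Vt1s by blast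
  have R0: "R f = 0" if "f \<in> orth_compl V1" for f
    unfolding R_def
  proof (rule mixed_op_eq_0[OF B B'])
    fix n assume "n \<in> ?J"
    then have "gfam y n \<in> V1" unfolding V1s[symmetric] by (intro in_ccspan imageI)
    then show "cinner (gfam y n) f = 0" by (rule orth_complD(1)[OF that])
  qed
  \<comment> \<open>\<open>R f\<close> and \<open>f\<close> have the same inner products with
    \<open>V1\<close>, so \<open>R\<close> transports a dual family without disturbing
    biorthogonality.\<close>
  have Rc: "cinner v (R f) = cinner v f" if v: "v \<in> V1" for v f
  proof -
    have "R f - f \<in> orth_compl (gfam y ` ?J)"
      unfolding orth_compl_def R_def by (auto simp: cinner_diff_right cinner_mixed_op_biorthogonal[OF B B' bio])
    then have "R f - f \<in> orth_compl V1" unfolding V1s[symmetric] orth_compl_ccspan .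
    then have "cinner v (R f - f) = 0" using v orth_complD(1) by blast
    then show ?thesis by (simp add: cinner_diff_right)
  qed
  show "e = 0" if e: "e \<in> Vt1" "\<And>n. n \<in> ?J \<Longrightarrow> cinner (gfam c n) e = 0" for e
  proof -
    have "e \<in> orth_compl (gfam c ` ?J)" using e(2) by (auto simp: orth_compl_def)
    then have "e \<in> orth_compl V1" unfolding cs[symmetric] orth_compl_ccspan .
    then show ?thesis using R0 Rid[OF e(1)] by metis
  qed
  have low: "1 * norm f \<le> norm (R f)" if f: "f \<in> V1" for f
  proof -
    have "cinner f f = cinner f (R f)" using Rc[OF f, of f] by simp
    from norm_le_of_cinner_self[OF this] show ?thesis by simp
  qed
  have img: "R ` V1 = Vt1"
  proof
    show "R ` V1 \<subseteq> Vt1" using RV by blast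
    show "Vt1 \<subseteq> R ` V1"
    proof
      fix f assume f: "f \<in> Vt1"
      have "R f - R (proj V1 f) = 0" using R0[OF proj_orth[OF V1, of f]] bclinear_diff[OF bR] by simp
      then have "f = R (proj V1 f)" using Rid[OF f] by simp
      then show "f \<in> R ` V1" using proj_in[OF V1] by blast
    qed
  qed
  obtain d where d: "biorthogonal (gfam c) (gfam d) ?J" "riesz_basis_for (gfam d) ?J V1"
    using dual_riesz_orbit[OF G c] by blast
  have eq: "gfam (\<lambda>j. R (d j)) n = R (gfam d n)" if "n \<in> ?J" for n
    using that G_commutesD[OF RG] by (auto simp: gfam_def)
  have "riesz_basis_for (\<lambda>n. R (gfam d n)) ?J (R ` V1)"
    by (rule riesz_basis_transfer[OF d(2) bR zero_less_one low])
  then have 1: "riesz_basis_for (gfam (\<lambda>j. R (d j))) ?J Vt1"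
    using riesz_basis_for_cong[of ?J "gfam (\<lambda>j. R (d j))" "\<lambda>n. R (gfam d n)", OF eq] img by simp
  have "biorthogonal (gfam c) (gfam (\<lambda>j. R (d j))) ?J"
    unfolding biorthogonal_def
  proof (intro ballI)
    fix n m assume n: "n \<in> ?J" and m: "m \<in> ?J"
    have "gfam c n \<in> V1" unfolding cs[symmetric] using n by (intro in_ccspan imageI)
    then show "cinner (gfam c n) (gfam (\<lambda>j. R (d j)) m) = (if n = m then 1 else 0)"
      using biorthogonalD[OF d(1) n m] by (simp add: eq[OF m] Rc)
  qed
  then show "\<exists>d. riesz_basis_for (gfam d) ?J Vt1 \<and> biorthogonal (gfam c) (gfam d) ?J" using 1 by blast
qed

text \<open>Let \<open>c\<close> be the concatenation of \<open>x\<close> and \<open>z\<close>. Its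
  dual basis \<open>d\<close> inside \<open>Vt1\<close> begins with \<open>xt\<close>, because a
  vector of \<open>Vt1\<close> is determined by its inner products with the orbit of
  \<open>c\<close>. The remaining members of \<open>d\<close> are the wanted
  \<open>zt\<close>.\<close>

lemma biorthogonal_completion:
  assumes X: "riesz_basis_for (gfam x) (G \<times> {..<r}) V0" and Xt: "riesz_basis_for (gfam xt) (G \<times> {..<r}) Vt0"
    and Y: "riesz_basis_for (gfam y) (G \<times> {..<s}) V1" and Yt: "riesz_basis_for (gfam yt) (G \<times> {..<s}) Vt1"
    and bx: "biorthogonal (gfam x) (gfam xt) (G \<times> {..<r})" and b_y: "biorthogonal (gfam y) (gfam yt) (G \<times> {..<s})"
    and V01: "V0 \<subseteq> V1" and Vt01: "Vt0 \<subseteq> Vt1" and rs: "r \<le> s"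
  defines "W0 \<equiv> V1 \<inter> orth_compl Vt0" and "Wt0 \<equiv> Vt1 \<inter> orth_compl V0"
  shows "\<exists>z. (\<forall>i<s - r. z i \<in> W0) \<and> riesz_basis_for (gfam z) (G \<times> {..<s - r}) W0 \<and>
           riesz_basis_for (gfam (concat_fam r x z)) (G \<times> {..<s}) V1 \<and>
           (\<exists>zt. (\<forall>i<s - r. zt i \<in> Wt0) \<and> riesz_basis_for (gfam zt) (G \<times> {..<s - r}) Wt0 \<and>
                 riesz_basis_for (gfam (concat_fam r xt zt)) (G \<times> {..<s}) Vt1 \<and>
                 biorthogonal (gfam zt) (gfam z) (G \<times> {..<s - r}))"
proof -
  let ?J = "G \<times> {..<s}" and ?Jr = "G \<times> {..<r}" and ?J' = "G \<times> {..<s - r}"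
  have V0s: "ccspan (gfam x ` ?Jr) = V0" and Vt0s: "ccspan (gfam xt ` ?Jr) = Vt0"
    and V1s: "ccspan (gfam y ` ?J) = V1" and Vt1s: "ccspan (gfam yt ` ?J) = Vt1"
    using X Xt Y Yt unfolding riesz_basis_for_iff by blast+
  have V1: "closed_csubspace V1" "G_invariant G V1" and Vt1: "closed_csubspace Vt1" "G_invariant G Vt1"
    and Vt0: "G_invariant G Vt0" and V0: "G_invariant G V0"
    using X Xt Y Yt riesz_basis_closed riesz_basis_G_invariant[OF G] by blast+
  have W0: "closed_csubspace W0" "G_invariant G W0" unfolding W0_def
    using closed_csubspace_Int[OF V1(1) closed_csubspace_orth_compl]
      G_invariant_Int[OF G V1(2) G_invariant_orth_compl[OF G Vt0]] by auto
  have Wt0: "closed_csubspace Wt0" "G_invariant G Wt0" unfolding Wt0_def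
    using closed_csubspace_Int[OF Vt1(1) closed_csubspace_orth_compl]
      G_invariant_Int[OF G Vt1(2) G_invariant_orth_compl[OF G V0]] by auto
  note dec = biorthogonal_decomposition[OF X Xt bx V1(1) V01, folded W0_def]
  obtain z where z: "\<forall>i<s - r. z i \<in> W0" "riesz_basis_for (gfam z) ?J' W0"
    using riesz_orbit_complement[OF G X Y V01 W0(1) dec W0(2)] by blast
  define c where "c = concat_fam r x z"
  have c: "riesz_basis_for (gfam c) ?J V1" unfolding c_def by (rule riesz_concat[OF X z(2) rs V1(1) dec])
  obtain d where d: "riesz_basis_for (gfam d) ?J Vt1" and bio: "biorthogonal (gfam c) (gfam d) ?J"
    using dual_basis_in_biorthogonal_space(1)[OF Y Yt b_y c] by blast
  have cx: "c j = x j" if "j < r" for j using that by (simp add: c_def concat_fam_def)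
  have cz: "c (r + i) = z i" for i by (simp add: c_def concat_fam_def)
  obtain A B where A: "riesz_seq A (gfam d) ?J" and B: "bessel_seq B (gfam d) ?J" and ds: "ccspan (gfam d ` ?J) = Vt1"
    using d unfolding riesz_basis_for_iff by blast
  obtain Bc where Bc: "bessel_seq Bc (gfam c) ?J" using c unfolding riesz_basis_for_iff by blast
  have dVt: "d j \<in> Vt1" if "j < s" for j unfolding ds[symmetric] using that by (intro in_ccspan gfam_in[OF G]) auto
  have xtVt: "xt j \<in> Vt0" if "j < r" for j unfolding Vt0s[symmetric] using that by (intro in_ccspan gfam_in[OF G]) auto
  have xtd: "xt j = d j" if j: "j < r" for j
  proof -
    have "xt j - d j = 0"
    proof (rule dual_basis_in_biorthogonal_space(2)[OF Y Yt b_y c])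
      show "xt j - d j \<in> Vt1" using closed_csubspaceD(3)[OF Vt1(1)] xtVt[OF j] Vt01 dVt j rs by auto
      fix n assume n: "n \<in> ?J"
      then obtain g i where gi: "n = (g, i)" "g \<in> G" "i < s" by auto
      have d1: "cinner (gfam c n) (d j) = (if n = (id, j) then 1 else 0)"
        using biorthogonalD[OF bio n, of "(id, j)"] G_id[OF G] j rs by (auto simp: gfam_def)
      \<comment> \<open>Below \<open>r\<close> this is the biorthogonality \<open>bx\<close>; from
        \<open>r\<close> on, \<open>c i\<close> lies in \<open>W0\<close> and so its translates are
        orthogonal to \<open>Vt0\<close>, which contains \<open>xt j\<close>.\<close>
      have "cinner (gfam c n) (xt j) = (if n = (id, j) then 1 else 0)"
      proof (cases "i < r")
        case True
        then show ?thesis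
          using biorthogonalD[OF bx, of n "(id, j)"] G_id[OF G] j gi by (auto simp: gfam_def cx)
      next
        case False
        then have "c i \<in> W0" using cz[of "i - r"] z(1) gi by auto
        then have "g (c i) \<in> orth_compl Vt0" using W0(2) gi unfolding W0_def G_invariant_def by blast
        then have "cinner (g (c i)) (xt j) = 0" using xtVt[OF j] by (rule orth_complD(2))
        then show ?thesis using False gi j by (auto simp: gfam_def)
      qed
      then show "cinner (gfam c n) (xt j - d j) = 0" by (simp add: cinner_diff_right d1)
    qed
    then show ?thesis by simp
  qed
  define zt where "zt i = d (r + i)" for i
  have "concat_fam r xt zt j = d j" for j by (simp add: concat_fam_def xtd zt_def)
  then have "concat_fam r xt zt = d" by (rule ext)
  then have Rt: "riesz_basis_for (gfam (concat_fam r xt zt)) ?J Vt1" using d by simp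
  have ztW: "zt i \<in> Wt0" if i: "i < s - r" for i
  proof -
    have "cinner v (zt i) = 0" if v: "v \<in> gfam x ` ?Jr" for v
    proof -
      obtain g j where gj: "g \<in> G" "j < r" "v = g (x j)" using v by (auto simp: gfam_def)
      then show ?thesis
        using biorthogonalD[OF bio, of "(g, j)" "(id, r + i)"] G_id[OF G] i rs
        by (auto simp: gfam_def cx zt_def)
    qed
    then have "zt i \<in> orth_compl (gfam x ` ?Jr)" by (simp add: orth_compl_def)
    then have "zt i \<in> orth_compl V0" unfolding V0s[symmetric] orth_compl_ccspan .
    then show ?thesis using dVt[of "r + i"] i unfolding Wt0_def by (simp add: zt_def)
  qed
  define \<phi> :: "('a \<Rightarrow> 'a) \<times> nat \<Rightarrow> ('a \<Rightarrow> 'a) \<times> nat" where "\<phi> = (\<lambda>(g, i). (g, r + i))"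
  have \<phi>: "inj_on \<phi> ?J'" "\<phi> ` ?J' \<subseteq> ?J" by (auto simp: inj_on_def \<phi>_def)
  have zt\<phi>: "gfam zt = (\<lambda>n. gfam d (\<phi> n))" and z\<phi>: "gfam z = (\<lambda>n. gfam c (\<phi> n))"
    by (auto simp: fun_eq_iff gfam_def \<phi>_def zt_def cz)
  have "riesz_seq A (gfam zt) ?J'" "bessel_seq B (gfam zt) ?J'"
    unfolding zt\<phi> by (rule riesz_seq_reindex[OF A \<phi>], rule bessel_seq_reindex[OF B \<phi>])
  moreover have "ccspan (gfam zt ` ?J') = Wt0"
  proof (rule ccspan_eq[OF Wt0(1) gfam_subset[OF G Wt0(2)]])
    show "zt j \<in> Wt0" if "j \<in> {..<s - r}" for j using ztW that by simp
    show "Wt0 \<subseteq> ccspan (gfam zt ` ?J')"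
    proof
      fix f assume f: "f \<in> Wt0"
      \<comment> \<open>In the dual expansion of a vector of \<open>Wt0\<close> the coefficients
        below \<open>r\<close> are inner products with vectors of \<open>V0\<close> and vanish; only
        translates of \<open>zt\<close> remain.\<close>
      have "mixed_op (gfam c) (gfam d) ?J f \<in> ccspan (gfam zt ` ?J')"
      proof (rule mixed_op_in[OF Bc B closed_csubspace_ccspan])
        fix n assume "n \<in> ?J"
        then obtain g i where gi: "n = (g, i)" "g \<in> G" "i < s" by auto
        show "scaleC (cinner (gfam c n) f) (gfam d n) \<in> ccspan (gfam zt ` ?J')"
        proof (cases "i < r")
          case True
          then have "gfam c n \<in> V0" unfolding V0s[symmetric]
            using gi by (intro in_ccspan image_eqI[of _ _ n]) (auto simp: gfam_def cx)
          then have "cinner (gfam c n) f = 0" using f orth_complD(1) unfolding Wt0_def by blast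
          then show ?thesis using closed_csubspaceD(1)[OF closed_csubspace_ccspan] by simp
        next
          case False
          then have "gfam d n \<in> gfam zt ` ?J'"
            using gi by (intro image_eqI[of _ _ "(g, i - r)"]) (auto simp: gfam_def zt_def)
          then show ?thesis by (intro closed_csubspaceD(4)[OF closed_csubspace_ccspan] in_ccspan)
        qed
      qed
      moreover have "mixed_op (gfam c) (gfam d) ?J f = f"
        by (rule mixed_op_id[OF Bc B bio]) (use f ds Wt0_def in blast)
      ultimately show "f \<in> ccspan (gfam zt ` ?J')" by simp
    qed
  qed
  ultimately have Rzt: "riesz_basis_for (gfam zt) ?J' Wt0" unfolding riesz_basis_for_iff by blast
  have "biorthogonal (gfam zt) (gfam z) ?J'"
    unfolding biorthogonal_def zt\<phi> z\<phi>
  proof (intro ballI)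
    fix n m assume nm: "n \<in> ?J'" "m \<in> ?J'"
    then have "\<phi> n \<in> ?J" "\<phi> m \<in> ?J" "\<phi> n = \<phi> m \<longleftrightarrow> n = m" using \<phi> by (auto dest: inj_onD)
    then show "cinner (gfam d (\<phi> n)) (gfam c (\<phi> m)) = (if n = m then 1 else 0)"
      using biorthogonalD[OF biorthogonal_sym[OF bio]] by simp
  qed
  then show ?thesis using z c Rt Rzt ztW unfolding c_def by blast
qed

end

theorem theorem4p3:
  fixes G :: "('a::complex_hilbert \<Rightarrow> 'a) set"
  assumes separable: "separable_H TYPE('a)"
    and group: "unitary_group G"
    and countable_G: "countable G"
    and infinite_G: "infinite G"
  shows
  \<comment> \<open>(a)\<close>
  "(\<forall>X Y. wandering G X \<and> wandering G Y \<and> orbit_sum G X \<subseteq> orbit_sum G Y \<and> cfinite_dim Y \<longrightarrow>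
      (\<exists>X'. wandering G X' \<and>
         (\<forall>g\<in>G. \<forall>h\<in>G. orth (g ` X) (h ` X')) \<and>
         {a + b | a b. a \<in> orbit_sum G X \<and> b \<in> orbit_sum G X'} = orbit_sum G Y \<and>
         cfinite_dim X \<and> cfinite_dim X' \<and> cdim X + cdim X' = cdim Y))
   \<and>
  \<comment> \<open>(b)\<close>
   (\<forall>(x::nat \<Rightarrow> 'a) r (y::nat \<Rightarrow> 'a) s V0 V1 W0.
      r < s \<and>
      V0 = ccspan (gfam x ` (G \<times> {..<r})) \<and> V1 = ccspan (gfam y ` (G \<times> {..<s})) \<and> V0 \<subseteq> V1 \<and>
      closed_csubspace W0 \<and> W0 \<subseteq> V1 \<and> V0 \<inter> W0 = {0} \<and> {a + b | a b. a \<in> V0 \<and> b \<in> W0} = V1 \<and>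
      riesz_basis_for (gfam x) (G \<times> {..<r}) V0 \<and> riesz_basis_for (gfam y) (G \<times> {..<s}) V1 \<longrightarrow>
      ((\<exists>z. (\<forall>i<s - r. z i \<in> W0) \<and> riesz_basis_for (gfam z) (G \<times> {..<s - r}) W0)
        \<longleftrightarrow> (\<forall>g\<in>G. g ` W0 \<subseteq> W0)))
   \<and>
  \<comment> \<open>(c)\<close>
   (\<forall>(x::nat \<Rightarrow> 'a) r (y::nat \<Rightarrow> 'a) s V0 V1 W0.
      r < s \<and>
      V0 = ccspan (gfam x ` (G \<times> {..<r})) \<and> V1 = ccspan (gfam y ` (G \<times> {..<s})) \<and> V0 \<subseteq> V1 \<and>
      closed_csubspace W0 \<and> W0 \<subseteq> V1 \<and> V0 \<inter> W0 = {0} \<and> {a + b | a b. a \<in> V0 \<and> b \<in> W0} = V1 \<and>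
      frame_for (gfam x) (G \<times> {..<r}) V0 \<and> frame_for (gfam y) (G \<times> {..<s}) V1 \<longrightarrow>
      ((\<exists>p z. 0 < p \<and> (\<forall>i<p. z i \<in> W0) \<and> frame_for (gfam z) (G \<times> {..<p}) W0)
        \<longleftrightarrow> (\<forall>g\<in>G. g ` W0 \<subseteq> W0)))
   \<and>
  \<comment> \<open>(d)\<close>
   (\<forall>(x::nat \<Rightarrow> 'a) xt r (y::nat \<Rightarrow> 'a) yt s V0 Vt0 V1 Vt1 W0 Wt0.
      V0 = ccspan (gfam x ` (G \<times> {..<r})) \<and> Vt0 = ccspan (gfam xt ` (G \<times> {..<r})) \<and>
      V1 = ccspan (gfam y ` (G \<times> {..<s})) \<and> Vt1 = ccspan (gfam yt ` (G \<times> {..<s})) \<and>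
      riesz_basis_for (gfam x) (G \<times> {..<r}) V0 \<and> riesz_basis_for (gfam xt) (G \<times> {..<r}) Vt0 \<and>
      riesz_basis_for (gfam y) (G \<times> {..<s}) V1 \<and> riesz_basis_for (gfam yt) (G \<times> {..<s}) Vt1 \<and>
      biorthogonal (gfam x) (gfam xt) (G \<times> {..<r}) \<and> biorthogonal (gfam y) (gfam yt) (G \<times> {..<s}) \<and>
      V0 \<subseteq> V1 \<and> Vt0 \<subseteq> Vt1 \<and>
      W0 = V1 \<inter> orth_compl Vt0 \<and> Wt0 = Vt1 \<inter> orth_compl V0 \<and> r < s \<longrightarrow>
      (\<exists>z. (\<forall>i<s - r. z i \<in> W0) \<and> riesz_basis_for (gfam z) (G \<times> {..<s - r}) W0 \<and>
           riesz_basis_for (gfam (concat_fam r x z)) (G \<times> {..<s}) V1 \<and>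
           (\<exists>zt. (\<forall>i<s - r. zt i \<in> Wt0) \<and> riesz_basis_for (gfam zt) (G \<times> {..<s - r}) Wt0 \<and>
                 riesz_basis_for (gfam (concat_fam r xt zt)) (G \<times> {..<s}) Vt1 \<and>
                 biorthogonal (gfam zt) (gfam z) (G \<times> {..<s - r}))))"
proof (intro conjI allI impI, goal_cases)
  case (1 X Y)
  then show ?case using wandering_complement[OF group] by blast
next
  case H: (2 x r y s V0 V1 W0)
  show ?case
  proof
    assume "\<exists>z. (\<forall>i<s - r. z i \<in> W0) \<and> riesz_basis_for (gfam z) (G \<times> {..<s - r}) W0"
    then show "\<forall>g\<in>G. g ` W0 \<subseteq> W0"
      using riesz_basis_G_invariant[OF group] unfolding G_invariant_def by blast
  next
    assume "\<forall>g\<in>G. g ` W0 \<subseteq> W0"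
    then have inv: "G_invariant G W0" by (auto simp: G_invariant_def)
    show "\<exists>z. (\<forall>i<s - r. z i \<in> W0) \<and> riesz_basis_for (gfam z) (G \<times> {..<s - r}) W0"
      by (rule riesz_orbit_complement[OF group _ _ _ _ _ _ inv, of x r V0 y s V1])
        (insert H, elim conjE, assumption)+
  qed
next
  case H: (3 x r y s V0 V1 W0)
  show ?case
  proof
    assume "\<exists>p z. 0 < p \<and> (\<forall>i<p. z i \<in> W0) \<and> frame_for (gfam z) (G \<times> {..<p}) W0"
    then obtain p z where "ccspan (gfam z ` (G \<times> {..<p::nat})) = W0" unfolding frame_for_def by blast
    then have "G_invariant G W0" using G_invariant_gfam[OF group] by metis
    then show "\<forall>g\<in>G. g ` W0 \<subseteq> W0" by (auto simp: G_invariant_def)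
  next
    assume "\<forall>g\<in>G. g ` W0 \<subseteq> W0"
    then have inv: "G_invariant G W0" by (auto simp: G_invariant_def)
    have V0: "closed_csubspace V0" "G_invariant G V0"
      using H closed_csubspace_ccspan[of "gfam x ` (G \<times> {..<r})"] G_invariant_gfam[OF group, of x "{..<r}"] by auto
    have "\<exists>z. (\<forall>i<s. z i \<in> W0) \<and> frame_for (gfam z) (G \<times> {..<s}) W0"
      by (rule frame_orbit_complement[OF group _ V0 _ _ _ inv, of y s V1])
        (insert H, elim conjE, assumption)+
    \<comment> \<open>The frame of \<open>W0\<close> has as many generators as that of
      \<open>V1\<close>, so \<open>p = s\<close>, which is positive because
      \<open>r < s\<close>.\<close>
    moreover have "0 < s" using H by auto
    ultimately show "\<exists>p z. 0 < p \<and> (\<forall>i<p. z i \<in> W0) \<and> frame_for (gfam z) (G \<times> {..<p}) W0" by blast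
  qed
next
  case H: (4 x xt r y yt s V0 Vt0 V1 Vt1 W0 Wt0)
  then have W: "W0 = V1 \<inter> orth_compl Vt0" "Wt0 = Vt1 \<inter> orth_compl V0" and le: "r \<le> s" by auto
  show ?case
    unfolding W by (rule biorthogonal_completion[OF group _ _ _ _ _ _ _ _ le, of x V0 xt Vt0 y V1 yt Vt1])
      (insert H, elim conjE, assumption)+
qed

end
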